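(* Let $q$ be a prime power, $n\geq 3$ an odd integer, $m\geq2$ a divisor of $q^n+1$ and $d$ a positive divisor of $q+1$ such that $\gcd(m,d(q-1))=1$. Let $F=\mathbb{F}_{q^{2n}}(x,y)$ with $$y^m=x^d(x^d-1)\left(\frac{1-x^{d(q-1)}}{x^d-1}\right)^{q+1}.$$ Let $\alpha_1,\dots,\alpha_d\in\mathbb{F}_{q^{2n}}$ be the (distinct) roots of $x^d-1$, and for $1\leq k\leq d$ let $Q_k$ be the unique place of $F$ over the zero of $x-\alpha_k$. For $1\leq i\leq m-1$ put $$A_i=d+\left\lceil\frac{di}{m}\right\rceil+d(q-2)\left\lceil\frac{i(q+1)}{m}\right\rceil-\left\lfloor\frac{idq(q-1)}{m}\right\rfloor.$$ (i) For $1\leq k\leq d$, $$G(Q_k)=\{mj+i\mid 1\leq i\leq m-1,\ 0\leq j\leq A_i-2\}\quad\text{and}\quad H(Q_k)=\langle m,\ m(A_i-1)+i : 1\leq i\leq m-1\rangle.$$ (ii) Let $2\leq s\leq\min\{d,\ \max_{1\leq i\leq m-1}A_i\}$. Then $$\Gamma(Q_1,\dots,Q_s)=\left\{(mj_1+i,\dots,mj_s+i)\;\Big|\;1\leq i\leq m-1,\ j_k\geq 0\ (1\leq k\leq s),\ \sum_{k=1}^s j_k=A_i-s\right\},$$ where $i,j_1,\dots,j_s$ are integers.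
   Context: $\mathbb{N}=\{1,2,\dots\}$, $\mathbb{N}_0=\mathbb{N}\cup\{0\}$, $(z)_\infty$ denotes the pole divisor of $z$, and $\langle\cdot\rangle$ the generated additive submonoid of $\mathbb{N}_0$. The places $Q_k$ are totally ramified over $\mathbb{F}_{q^{2n}}(x)$ and rational. For $t\geq1$ distinct rational (degree one) places $R_1,\dots,R_t$ of $F$, $H(R_1,\dots,R_t)=\{(n_1,\dots,n_t)\in\mathbb{N}_0^t:\exists z\in F,\ (z)_\infty=\sum n_iR_i\}$, and $G(R_1)=\mathbb{N}_0\setminus H(R_1)$. For $t\geq2$, with the componentwise partial order $\preceq$ on $\mathbb{N}_0^t$ (an element $\mathbf a$ of a set $S$ is minimal in $S$ if $\mathbf b\not\preceq\mathbf a$ for all $\mathbf b\in S\setminus\{\mathbf a\}$), $\Gamma(R_1,\dots,R_t)$ is the set of all $\mathbf a=(a_1,\dots,a_t)\in\mathbb{N}^t$ such that, for some $1\leq i\leq t$, $\mathbf a$ is minimal in $\{\mathbf n\in H(R_1,\dots,R_t): n_i=a_i\}$. *)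

theory Defs
  imports
    "HOL-Library.Cardinality"
    "HOL-Number_Theory.Prime_Powers"
    "Jordan_Normal_Form.Char_Poly"
begin

text \<open>
  A function field over a constant field is given by a type \<open>'f\<close>, a type \<open>'k\<close> and a field
  homomorphism \<open>\<iota> :: 'k \<Rightarrow> 'f\<close>; the constant field, as a subfield of \<open>'f\<close>, is \<open>range \<iota>\<close>.
\<close>

definition is_subfield :: "'f::field set \<Rightarrow> bool" where
  "is_subfield L \<longleftrightarrow> 0 \<in> L \<and> 1 \<in> L \<and>
     (\<forall>a\<in>L. \<forall>b\<in>L. a - b \<in> L \<and> a * b \<in> L) \<and> (\<forall>a\<in>L. inverse a \<in> L)"

definition adjoin :: "('k \<Rightarrow> 'f::field) \<Rightarrow> 'f set \<Rightarrow> 'f set" where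
  "adjoin \<iota> S = is_subfield hull (range \<iota> \<union> S)"

definition transcendental_over :: "('k::field \<Rightarrow> 'f::field) \<Rightarrow> 'f \<Rightarrow> bool" where
  "transcendental_over \<iota> x \<longleftrightarrow> (\<forall>p. p \<noteq> 0 \<longrightarrow> poly (map_poly \<iota> p) x \<noteq> 0)"

definition valuation_ring :: "('k::field \<Rightarrow> 'f::field) \<Rightarrow> 'f set \<Rightarrow> bool" where
  "valuation_ring \<iota> R \<longleftrightarrow> range \<iota> \<subset> R \<and> R \<subset> UNIV \<and>
     (\<forall>a\<in>R. \<forall>b\<in>R. a - b \<in> R \<and> a * b \<in> R) \<and>
     (\<forall>z. z \<noteq> 0 \<longrightarrow> z \<in> R \<or> inverse z \<in> R)"

text \<open>
  A place is the maximal ideal, i.e. the set of nonunits, of a valuation ring; the valuation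
  ring is recovered from the place \<open>P\<close> as \<open>place_ring P\<close>.
\<close>

definition places :: "('k::field \<Rightarrow> 'f::field) \<Rightarrow> 'f set set" where
  "places \<iota> = {{z \<in> R. \<not> (\<exists>w\<in>R. z * w = 1)} | R. valuation_ring \<iota> R}"

definition place_ring :: "'f::field set \<Rightarrow> 'f set" where
  "place_ring P = {z. z = 0 \<or> inverse z \<notin> P}"

text \<open>
  The discrete valuation \<open>v\<^sub>P z\<close> for \<open>z \<noteq> 0\<close>: write \<open>z = t\<^sup>n u\<close> with \<open>t\<close> a generator of \<open>P\<close>
  and \<open>u\<close> a unit of the valuation ring. The value at \<open>z = 0\<close> is meaningless and never used.
\<close>

definition place_val :: "'f::field set \<Rightarrow> 'f \<Rightarrow> int" where
  "place_val P z = (THE n. \<exists>t u. P = (\<lambda>w. t * w) ` place_ring P \<and>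
     u \<in> place_ring P - P \<and> z = t powi n * u)"

text \<open>
  The maximal ideal of the local ring of \<open>K(x)\<close> at the zero of \<open>x - a\<close>. A place \<open>P\<close> of the
  function field lies over it iff it contains it.
\<close>

definition zero_place ::
    "('k::field \<Rightarrow> 'f::field) \<Rightarrow> 'f \<Rightarrow> 'k \<Rightarrow> 'f set" where
  "zero_place \<iota> x a = {poly (map_poly \<iota> f) x / poly (map_poly \<iota> g) x | f g.
     poly f a = 0 \<and> poly g a \<noteq> 0}"

text \<open>Divisors are written as their coefficient functions.\<close>

type_synonym 'f divisor = "'f set \<Rightarrow> int"

definition pole_divisor :: "('k::field \<Rightarrow> 'f::field) \<Rightarrow> 'f \<Rightarrow> 'f divisor" where
  "pole_divisor \<iota> z = (\<lambda>P. if P \<in> places \<iota> then max 0 (- place_val P z) else 0)"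

definition divisor_of :: "'f set list \<Rightarrow> nat list \<Rightarrow> 'f divisor" where
  "divisor_of Rs ns = (\<lambda>P. \<Sum>k<length Rs. if P = Rs ! k then int (ns ! k) else 0)"

text \<open>
  In the following, \<open>t\<close>-tuples are lists of length \<open>t\<close>, with components numbered from 0, and
  \<open>Rs\<close> is a list of distinct places.
\<close>

definition weierstrass_semigroup ::
    "('k::field \<Rightarrow> 'f::field) \<Rightarrow> 'f set list \<Rightarrow> nat list set" where
  "weierstrass_semigroup \<iota> Rs = {ns. length ns = length Rs \<and>
     (\<exists>z. z \<noteq> 0 \<and> pole_divisor \<iota> z = divisor_of Rs ns)}"

definition weierstrass_semigroup1 ::
    "('k::field \<Rightarrow> 'f::field) \<Rightarrow> 'f set \<Rightarrow> nat set" where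
  "weierstrass_semigroup1 \<iota> R = {h. [h] \<in> weierstrass_semigroup \<iota> [R]}"

definition gap_set :: "('k::field \<Rightarrow> 'f::field) \<Rightarrow> 'f set \<Rightarrow> nat set" where
  "gap_set \<iota> R = UNIV - weierstrass_semigroup1 \<iota> R"

definition minimal_in :: "nat list set \<Rightarrow> nat list \<Rightarrow> bool" where
  "minimal_in S a \<longleftrightarrow> a \<in> S \<and> (\<forall>b \<in> S - {a}. \<not> list_all2 (\<le>) b a)"

definition minimal_generating_set ::
    "('k::field \<Rightarrow> 'f::field) \<Rightarrow> 'f set list \<Rightarrow> nat list set" where
  "minimal_generating_set \<iota> Rs = {a. length a = length Rs \<and> (\<forall>c \<in> set a. 1 \<le> c) \<and>
     (\<exists>i < length Rs. minimal_in {ns \<in> weierstrass_semigroup \<iota> Rs. ns ! i = a ! i} a)}"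

definition submonoid_generated :: "'a::monoid_add set \<Rightarrow> 'a set" where
  "submonoid_generated S = (\<lambda>M. 0 \<in> M \<and> (\<forall>a\<in>M. \<forall>b\<in>M. a + b \<in> M)) hull S"

definition A_num :: "nat \<Rightarrow> nat \<Rightarrow> nat \<Rightarrow> nat \<Rightarrow> int" where
  "A_num q d m i =
     int d + \<lceil>real d * real i / real m\<rceil>
       + int d * (int q - 2) * \<lceil>real i * (real q + 1) / real m\<rceil>
       - \<lfloor>real i * real d * real q * (real q - 1) / real m\<rfloor>"

end

theory Submission
  imports Defs
begin

text \<open>
  Over the zero of a simple factor \<open>x - a\<close> of the radicand of a Kummer extension \<open>y\<^sup>m = \<epsilon> \<Prod> (x - a)\<^bsup>\<mu>(a)\<^esup>\<close>
  there is a unique place, where \<open>Y = 1/y\<close> has a pole of order 1 and the rational functions take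
  values divisible by \<open>m\<close>. The terms of an expansion \<open>z = \<Sum> c\<^sub>i Y\<^sup>i\<close> with rational \<open>c\<^sub>i\<close> therefore have
  distinct values there, and the pole order of \<open>z\<close> is that of a single term. By averaging over
  the Galois group each term \<open>c\<^sub>i Y\<^sup>i\<close> is regular wherever \<open>z\<close> and its conjugates are. Regularity of a term
  away from the chosen places prescribes the zeros of \<open>c\<^sub>i\<close> up to a polynomial factor, and the place at
  infinity bounds the total degree; this bound is an inequality between the pole orders and \<open>A\<^sub>i\<close>,
  attained by a product of powers of the \<open>x - a\<close>.
\<close>

subsection \<open>Valuation rings and discrete places\<close>

text \<open>\<open>place_val\<close> is a definite description: it yields the intended number only
  if the ideal is principal and the element is a power of a generator times a unit. Hence every
  place of the field must be shown discrete before values can be used, and the places over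
  prescribed points are supplied by Zorn's lemma. Values at places other than the chosen ones are
  never computed: \<open>m\<close> times the value of \<open>c * Y ^ i\<close> is a combination of
  the values of the factors \<open>x - \<iota> a\<close>, and regularity depends only on its sign,
  whatever the ramification there. With 1/y instead of y, a coefficient of value
  \<open>- m * j\<close> gives the pole order \<open>m * j + i\<close>, so the index of the dominant
  term is the residue of the pole order modulo \<open>m\<close>. The number \<open>A i\<close> sums
  the ceilings of i \<mu>(a)/m, the orders of zero that regularity of the \<open>i\<close>-th term
  forces on its coefficient, and subtracts the floor of i/m times the sum of all \<mu>(a), the
  largest degree permitted at infinity. Averaging requires all \<open>m\<close>-th roots of unity
  among the constants; they are there because \<open>m\<close> divides q^n + 1, hence q^(2n) -
  1.\<close>

text \<open>For z \<noteq> 0 the inverse of z is a nonunit of the valuation ring exactly if z lies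
  outside it, so the maximal ideal determines the ring. Being a place thus becomes a property of
  \<open>P\<close> and \<open>place_ring P\<close>, without a quantifier over rings.\<close>

lemma places_iff:
  "P \<in> places \<iota> \<longleftrightarrow> valuation_ring \<iota> (place_ring P) \<and>
     P = {z \<in> place_ring P. \<not> (\<exists>w\<in>place_ring P. z * w = 1)}"
proof
  assume "P \<in> places \<iota>"
  then obtain R where R: "valuation_ring \<iota> R" and P: "P = {z \<in> R. \<not> (\<exists>w\<in>R. z * w = 1)}"
    by (auto simp: places_def)
  have mult: "\<And>a b. a \<in> R \<Longrightarrow> b \<in> R \<Longrightarrow> a * b \<in> R" and diff: "\<And>a b. a \<in> R \<Longrightarrow> b \<in> R \<Longrightarrow> a - b \<in> R"
    and inv: "\<And>z. z \<noteq> 0 \<Longrightarrow> z \<in> R \<or> inverse z \<in> R" and ne: "range \<iota> \<subset> R"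
    using R by (auto simp: valuation_ring_def)
  have zero: "0 \<in> R" using ne diff[of "\<iota> 0" "\<iota> 0"] by auto
  have "place_ring P = R"
  proof (rule Set.set_eqI)
    fix z
    show "z \<in> place_ring P \<longleftrightarrow> z \<in> R"
    proof (cases "z = 0")
      case True
      then show ?thesis using zero by (simp add: place_ring_def)
    next
      case False
      have "(\<exists>w\<in>R. inverse z * w = 1) \<longleftrightarrow> z \<in> R"
        using False by (metis inverse_inverse_eq inverse_unique left_inverse)
      then have "inverse z \<in> P \<longleftrightarrow> z \<notin> R"
        using inv[OF False] unfolding P by blast
      then show ?thesis using False by (simp add: place_ring_def)
    qed
  qed
  then show "valuation_ring \<iota> (place_ring P) \<and>
     P = {z \<in> place_ring P. \<not> (\<exists>w\<in>place_ring P. z * w = 1)}"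
    using R P by simp
qed (unfold places_def, blast)

locale function_field_place = field_hom \<iota> for \<iota> :: "'k::field \<Rightarrow> 'f::field" +
  fixes P :: "'f set"
  assumes place: "P \<in> places \<iota>"
begin

abbreviation "O\<^sub>P \<equiv> place_ring P"

lemma vring: "valuation_ring \<iota> O\<^sub>P"
  using place places_iff by blast

lemma const_in: "\<iota> c \<in> O\<^sub>P"
  using vring by (auto simp: valuation_ring_def)

lemma zero_in [simp]: "0 \<in> O\<^sub>P" and one_in [simp]: "1 \<in> O\<^sub>P"
  using const_in[of 0] const_in[of 1] by auto

lemma diff_in: "a \<in> O\<^sub>P \<Longrightarrow> b \<in> O\<^sub>P \<Longrightarrow> a - b \<in> O\<^sub>P"
  and mult_in: "a \<in> O\<^sub>P \<Longrightarrow> b \<in> O\<^sub>P \<Longrightarrow> a * b \<in> O\<^sub>P"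
  using vring by (auto simp: valuation_ring_def)

lemma uminus_in: "a \<in> O\<^sub>P \<Longrightarrow> - a \<in> O\<^sub>P"
  using diff_in[of 0 a] by simp

lemma add_in: "a \<in> O\<^sub>P \<Longrightarrow> b \<in> O\<^sub>P \<Longrightarrow> a + b \<in> O\<^sub>P"
  using diff_in[of a "- b"] uminus_in[of b] by simp

lemma power_in: "a \<in> O\<^sub>P \<Longrightarrow> a ^ n \<in> O\<^sub>P"
  by (induction n) (auto intro: mult_in)

lemma sum_in: "(\<And>i. i \<in> I \<Longrightarrow> f i \<in> O\<^sub>P) \<Longrightarrow> sum f I \<in> O\<^sub>P"
  by (induction I rule: infinite_finite_induct) (auto intro: add_in)

lemma inverse_in: "z \<notin> O\<^sub>P \<Longrightarrow> inverse z \<in> P"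
  by (simp add: place_ring_def)

lemma in_place_iff: "z \<in> P \<longleftrightarrow> z \<in> O\<^sub>P \<and> (z = 0 \<or> inverse z \<notin> O\<^sub>P)"
proof -
  have "z \<in> P \<longleftrightarrow> z \<in> O\<^sub>P \<and> \<not> (\<exists>w\<in>O\<^sub>P. z * w = 1)"
    using place places_iff[of P \<iota>] by blast
  moreover have "(\<exists>w\<in>O\<^sub>P. z * w = 1) \<longleftrightarrow> z \<noteq> 0 \<and> inverse z \<in> O\<^sub>P"
    by (metis inverse_unique mult_zero_left right_inverse zero_neq_one)
  ultimately show ?thesis by blast
qed

lemma place_in: "z \<in> P \<Longrightarrow> z \<in> O\<^sub>P" by (simp add: in_place_iff)

lemma zero_in_place [simp]: "0 \<in> P" and one_notin_place [simp]: "1 \<notin> P"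
  by (simp_all add: in_place_iff)

lemma mult_in_place:
  assumes "a \<in> P" "b \<in> O\<^sub>P" shows "a * b \<in> P"
proof (cases "a * b = 0")
  case False
  have "inverse (a * b) \<notin> O\<^sub>P"
  proof
    assume "inverse (a * b) \<in> O\<^sub>P"
    from mult_in[OF this assms(2)] have "inverse a \<in> O\<^sub>P"
      using False by (simp add: field_simps)
    then show False using assms False by (auto simp: in_place_iff)
  qed
  then show ?thesis using assms by (auto simp: in_place_iff intro: mult_in)
qed auto

text \<open>Of the two quotients of \<open>a\<close> and \<open>b\<close> one lies in the ring, so
  the sum is a ring multiple of one summand.\<close>

lemma add_in_place:
  assumes "a \<in> P" "b \<in> P" shows "a + b \<in> P"
proof (cases "a = 0 \<or> b = 0")
  case False
  have *: "s + t \<in> P" if "s \<in> P" "t \<in> P" "t \<noteq> 0" "s / t \<in> O\<^sub>P" for s t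
  proof -
    have "t * (s / t + 1) \<in> P" by (intro mult_in_place add_in that) simp
    moreover have "t * (s / t + 1) = s + t" using that by (simp add: distrib_left)
    ultimately show ?thesis by simp
  qed
  have "a / b \<in> O\<^sub>P \<or> b / a \<in> O\<^sub>P"
    using inverse_in[of "a / b"] place_in by auto
  then show ?thesis using *[of a b] *[of b a] assms False by (auto simp: add.commute)
qed (use assms in auto)

lemma uminus_in_place: "a \<in> P \<Longrightarrow> - a \<in> P"
  using mult_in_place[of a "- 1"] uminus_in[of 1] by simp

lemma diff_in_place: "a \<in> P \<Longrightarrow> b \<in> P \<Longrightarrow> a - b \<in> P"
  using add_in_place[of a "- b"] uminus_in_place by auto

lemma sum_in_place: "(\<And>i. i \<in> I \<Longrightarrow> f i \<in> P) \<Longrightarrow> sum f I \<in> P"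
  by (induction I rule: infinite_finite_induct) (auto intro: add_in_place)

lemma power_in_place: "a \<in> P \<Longrightarrow> n > 0 \<Longrightarrow> a ^ n \<in> P"
  by (cases n) (auto intro: mult_in_place power_in place_in)

definition unit :: "'f \<Rightarrow> bool" where "unit z \<longleftrightarrow> z \<in> O\<^sub>P - P"

lemma unit_iff: "unit z \<longleftrightarrow> z \<noteq> 0 \<and> z \<in> O\<^sub>P \<and> inverse z \<in> O\<^sub>P"
  by (auto simp: unit_def in_place_iff)

lemma unit_nonzero: "unit z \<Longrightarrow> z \<noteq> 0" by (simp add: unit_iff)

lemma unit_one [simp]: "unit 1" by (simp add: unit_iff)

lemma unit_mult: "unit a \<Longrightarrow> unit b \<Longrightarrow> unit (a * b)"
  by (auto simp: unit_iff intro: mult_in)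

lemma unit_inverse: "unit a \<Longrightarrow> unit (inverse a)"
  by (auto simp: unit_iff)

lemma unit_power: "unit a \<Longrightarrow> unit (a ^ n)"
  by (induction n) (auto intro: unit_mult)

lemma unit_powi: "unit a \<Longrightarrow> unit (a powi n)"
  by (auto simp: power_int_def intro: unit_power unit_inverse)

lemma unit_const: "c \<noteq> 0 \<Longrightarrow> unit (\<iota> c)"
  using const_in[of c] const_in[of "inverse c"] by (simp add: unit_iff hom_inverse)

lemma place_not_unit: "z \<in> P \<Longrightarrow> \<not> unit z" by (simp add: unit_def)

lemma unit_or_place: "z \<in> O\<^sub>P \<Longrightarrow> unit z \<or> z \<in> P" by (simp add: unit_def)

lemma trichotomy:
  assumes "z \<noteq> 0" obtains "z \<in> P" | "unit z" | "inverse z \<in> P"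
  using inverse_in[of z] unit_or_place[of z] by blast

lemma powi_place_unit_iff:
  assumes "p \<in> P" "p \<noteq> 0"
  shows "unit (p powi n) \<longleftrightarrow> n = 0" "p powi n \<in> P \<longleftrightarrow> n > 0"
proof -
  have pos: "p powi k \<in> P" if "k > 0" for k :: int
    using power_in_place[OF assms(1), of "nat k"] that by (simp add: power_int_def)
  have neg: "p powi k \<notin> O\<^sub>P" if "k < 0" for k :: int
    using pos[of "- k"] that assms(2) by (simp add: power_int_minus in_place_iff)
  show "unit (p powi n) \<longleftrightarrow> n = 0" "p powi n \<in> P \<longleftrightarrow> n > 0"
    using pos[of n] neg[of n] place_not_unit unit_iff[of "p powi n"] place_in
    by (cases n "0::int" rule: linorder_cases; force)+
qed

text \<open>Only a parameter is asked for, not a principal ideal: this is the form that the descent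
  in \<open>discreteI\<close> delivers, and that the parameter generates \<open>P\<close> is derived
  in \<open>uniformizer\<close>.\<close>

definition discrete :: bool where
  "discrete \<longleftrightarrow> (\<exists>t. t \<noteq> 0 \<and> t \<in> P \<and> (\<forall>z. z \<noteq> 0 \<longrightarrow> (\<exists>n::int. unit (z * t powi n))))"

text \<open>The exponent of \<open>p\<close> in \<open>z\<^sup>M\<close> is a homomorphism to the integers with kernel the units, so the
  value group is cyclic.\<close>

lemma discreteI:
  assumes p: "p \<in> P" "p \<noteq> 0" and M: "M > 0"
    and ex: "\<And>z. z \<noteq> 0 \<Longrightarrow> \<exists>n::int. unit (z ^ M * p powi n)"
  shows discrete
proof -
  \<comment> \<open>\<open>W z n\<close> reads: \<open>z ^ M\<close> is \<open>p powi n\<close> up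
    to a unit. The exponent measures z through its power, so signs can be compared with
    \<open>P\<close> although p need not generate it.\<close>
  define W where "W z n \<longleftrightarrow> z \<noteq> 0 \<and> unit (z ^ M * p powi (- n))" for z and n :: int
  have Wex: "\<exists>n. W z n" if "z \<noteq> 0" for z
    using ex[OF that] that unfolding W_def by (metis minus_minus)
  have Wmult: "W (a * b) (k + l)" if "W a k" "W b l" for a b k l
  proof -
    have "(a * b) ^ M * p powi (- (k + l)) = (a ^ M * p powi (- k)) * (b ^ M * p powi (- l))"
      using p by (simp add: power_int_diff power_int_minus field_simps power_int_add)
    then show ?thesis using that unit_mult unfolding W_def by simp
  qed
  have Winv: "W (inverse a) (- k)" if "W a k" for a k
  proof -
    have "inverse a ^ M * p powi k = inverse (a ^ M * p powi (- k))"
      using p by (simp add: power_int_minus field_simps)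
    then have "unit (inverse a ^ M * p powi k)"
      using that unit_inverse unfolding W_def by metis
    then show ?thesis using that unfolding W_def by simp
  qed
  have Wpow: "W (a ^ n) (int n * k)" if "W a k" for a k n
  proof (induction n)
    case 0
    then show ?case by (simp add: W_def)
  next
    case (Suc n)
    then show ?case using Wmult[OF that Suc] by (simp add: algebra_simps)
  qed
  have Wpowi: "W (a powi n) (n * k)" if "W a k" for a k n
    using Wpow[OF that, of "nat n"] Winv[OF Wpow[OF that, of "nat (- n)"]] that
    by (auto simp: power_int_def power_inverse W_def)
  have Wpos: "z \<in> P \<longleftrightarrow> n > 0" and W0: "unit z \<longleftrightarrow> n = 0" if "W z n" for z n
  proof -
    have z: "z \<noteq> 0" using that W_def by simp
    have *: "z ^ M = (z ^ M * p powi (- n)) * p powi n"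
      using p by (simp add: power_int_minus)
    have u: "unit (z ^ M * p powi (- n))" using that W_def by simp
    have gt: "z ^ M \<in> P" if "n > 0"
      using mult_in_place[of "p powi n" "z ^ M * p powi (- n)"]
        powi_place_unit_iff(2)[OF p, of n] that u unit_iff[of "z ^ M * p powi (- n)"] *
      by (metis mult.commute)
    have eq: "unit (z ^ M)" if "n = 0"
      using u that by simp
    have lt: "inverse z ^ M \<in> P" if "n < 0"
    proof -
      have "inverse z ^ M = p powi (- n) * inverse (z ^ M * p powi (- n))"
        using p by (simp add: power_inverse)
      then show ?thesis using powi_place_unit_iff(2)[OF p, of "- n"] that
        using mult_in_place unit_inverse[OF u] unit_iff by simp
    qed
    have "(z \<in> P \<longrightarrow> z ^ M \<in> P) \<and> (inverse z \<in> P \<longrightarrow> inverse z ^ M \<in> P) \<and> (unit z \<longrightarrow> unit (z ^ M))"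
      using M power_in_place unit_power by blast
    moreover have ex1: "\<not> (a \<in> P \<and> inverse a \<in> P)" "\<not> (a \<in> P \<and> unit a)" 
      "\<not> (inverse a \<in> P \<and> unit a)" if "a \<noteq> 0" for a
      using that by (auto simp: in_place_iff unit_iff)
    note ex1[of z] ex1[of "z ^ M"]
    ultimately show "z \<in> P \<longleftrightarrow> n > 0" "unit z \<longleftrightarrow> n = 0"
      using gt eq lt trichotomy[OF z] z
      by (cases n "0::int" rule: linorder_cases; force simp: power_inverse)+
  qed
  \<comment> \<open>The element \<open>p\<close> itself has exponent \<open>M\<close>, so positive
    exponents occur. Division with remainder by the least one leaves a remainder that is again an
    exponent, hence zero.\<close>
  define Q where "Q k \<longleftrightarrow> k > 0 \<and> (\<exists>t. W t (int k))" for k :: nat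
  have "Q M"
    using M p by (auto simp: Q_def W_def power_int_minus intro!: exI[of _ p])
  then have QL: "Q (LEAST k. Q k)" by (rule LeastI)
  define g where "g = (LEAST k. Q k)"
  obtain t where t: "W t (int g)" and g: "g > 0" using QL unfolding g_def Q_def by blast
  have min: "k \<ge> g" if "W z (int k)" "k > 0" for z k
    unfolding g_def by (rule Least_le) (use that in \<open>auto simp: Q_def\<close>)
  have "\<exists>n::int. unit (z * t powi n)" if z: "z \<noteq> 0" for z
  proof -
    obtain k where k: "W z k" using Wex z by blast
    define r where "r = k mod int g"
    have "W (z * t powi (- (k div int g))) (k + (- (k div int g)) * int g)"
      by (intro Wmult Wpowi k t)
    also have "k + (- (k div int g)) * int g = r"
      by (simp add: r_def minus_div_mult_eq_mod)
    finally have r: "W (z * t powi (- (k div int g))) r" .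
    have "0 \<le> r" "r < int g" using g by (auto simp: r_def)
    then have "r = 0" using min[of _ "nat r"] r by force
    then show ?thesis using W0[OF r] by blast
  qed
  moreover have "t \<in> P" "t \<noteq> 0" using Wpos[OF t] t g W_def by auto
  ultimately show ?thesis unfolding discrete_def by blast
qed

end

section \<open>The normalized valuation of a discrete place\<close>

locale discrete_place = function_field_place +
  assumes discrete: discrete
begin

text \<open>Two generators of \<open>P\<close> divide each other and so differ by a unit; the
  exponent does not depend on the generator. This makes the definite description in
  \<open>place_val\<close> meaningful.\<close>

lemma place_val_unique:
  assumes P1: "P = (\<lambda>w. t * w) ` O\<^sub>P" "t \<noteq> 0" and u: "unit u" "z = t powi n * u"
  shows "place_val P z = n"
  unfolding place_val_def
proof (rule the_equality)
  show "\<exists>t u. P = (*) t ` O\<^sub>P \<and> u \<in> O\<^sub>P - P \<and> z = t powi n * u"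
    using assms unit_def by blast
next
  fix k assume "\<exists>t u. P = (*) t ` O\<^sub>P \<and> u \<in> O\<^sub>P - P \<and> z = t powi k * u"
  then obtain s w where s: "P = (*) s ` O\<^sub>P" and w: "unit w" "z = s powi k * w"
    unfolding unit_def by blast
  have tP: "t \<in> P" and sP: "s \<in> P" using P1 s by force+
  obtain a where a: "a \<in> O\<^sub>P" "t = s * a" using tP s by blast
  obtain b where b: "b \<in> O\<^sub>P" "s = t * b" using sP P1 by blast
  have s0: "s \<noteq> 0" using a P1 by auto
  have "a * b = 1" using a b P1 s0 by (metis mult.assoc mult_cancel_left1 mult.commute)
  then have ua: "unit a" using a b unit_iff inverse_unique by fastforce
  have z: "z = s powi n * (a powi n * u)"
    using u(2) a by (simp add: power_int_mult_distrib)
  have "s powi (k - n) = (a powi n * u) * inverse w"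
    using z w(2) s0 unit_nonzero[OF w(1)] by (simp add: power_int_diff field_simps)
  moreover have "unit ((a powi n * u) * inverse w)"
    by (intro unit_mult unit_inverse unit_powi ua u w)
  ultimately have "unit (s powi (k - n))" by metis
  then show "k = n" using powi_place_unit_iff(1)[OF sP s0, of "k - n"] by linarith
qed

lemma uniformizer:
  obtains t where "t \<noteq> 0" "P = (\<lambda>w. t * w) ` O\<^sub>P" "\<forall>z. z \<noteq> 0 \<longrightarrow> (\<exists>u. unit u \<and> z = t powi place_val P z * u)"
    "t \<in> P"
proof -
  obtain t where t: "t \<noteq> 0" "t \<in> P" and ex: "\<And>z. z \<noteq> 0 \<Longrightarrow> \<exists>n::int. unit (z * t powi n)"
    using discrete unfolding discrete_def by blast
  have ex': "\<exists>u n. unit u \<and> z = t powi n * u" if "z \<noteq> 0" for z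
  proof -
    from ex[OF that] obtain n where "unit (z * t powi n)" by blast
    moreover have "z = t powi (- n) * (z * t powi n)" using t by (simp add: power_int_minus)
    ultimately show ?thesis by blast
  qed
  have gen: "P = (\<lambda>w. t * w) ` O\<^sub>P"
  proof
    show "P \<subseteq> (\<lambda>w. t * w) ` O\<^sub>P"
    proof
      fix z assume z: "z \<in> P"
      show "z \<in> (\<lambda>w. t * w) ` O\<^sub>P"
      proof (cases "z = 0")
        case False
        then obtain u n where u: "unit u" "z = t powi n * u" using ex' by blast
        have "t powi n \<in> P"
          using mult_in_place[OF z, of "inverse u"] u(2) unit_inverse[OF u(1)]
            unit_iff[of "inverse u"] unit_nonzero[OF u(1)] by (simp add: mult.assoc)
        then have n: "n > 0" using powi_place_unit_iff[OF t(2,1)] by simp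
        then have "t powi (n - 1) \<in> O\<^sub>P"
          using power_in[OF place_in[OF t(2)], of "nat (n - 1)"] by (simp add: power_int_def)
        moreover have "z = t * (t powi (n - 1) * u)" using u t by (simp add: power_int_diff)
        ultimately show ?thesis using u mult_in unit_iff by blast
      qed (auto intro!: image_eqI[of _ _ 0])
    qed
  qed (use t mult_in_place in blast)
  show ?thesis
  proof (rule that[OF t(1) gen _ t(2)], intro allI impI)
    fix z :: 'b assume "z \<noteq> 0"
    then obtain u n where u: "unit u" "z = t powi n * u" using ex' by blast
    then have "place_val P z = n" using place_val_unique[OF gen t(1)] by blast
    then show "\<exists>u. unit u \<and> z = t powi place_val P z * u" using u by blast
  qed
qed

abbreviation "v \<equiv> place_val P"

lemma val_mult: assumes "a \<noteq> 0" "b \<noteq> 0" shows "v (a * b) = v a + v b"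
proof -
  obtain t where t: "t \<noteq> 0" "P = (\<lambda>w. t * w) ` O\<^sub>P"
    and ex: "\<forall>z. z \<noteq> 0 \<longrightarrow> (\<exists>u. unit u \<and> z = t powi v z * u)" and tP: "t \<in> P"
    by (rule uniformizer)
  obtain u w where "unit u" "a = t powi v a * u" "unit w" "b = t powi v b * w"
    using ex assms by blast
  then have "unit (u * w)" "a * b = t powi (v a + v b) * (u * w)"
    using unit_mult t by (auto simp: power_int_add) (metis mult.assoc mult.left_commute)
  then show ?thesis using place_val_unique[OF t(2,1)] by blast
qed

lemma val_unit_iff: "z \<noteq> 0 \<Longrightarrow> v z = 0 \<longleftrightarrow> unit z"
  and val_place_iff: "z \<noteq> 0 \<Longrightarrow> v z > 0 \<longleftrightarrow> z \<in> P"
proof -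
  assume z: "z \<noteq> 0"
  obtain t where t: "t \<noteq> 0" "P = (\<lambda>w. t * w) ` O\<^sub>P"
    and ex: "\<forall>z. z \<noteq> 0 \<longrightarrow> (\<exists>u. unit u \<and> z = t powi v z * u)" and tP: "t \<in> P"
    by (rule uniformizer)
  obtain u where u: "unit u" "z = t powi v z * u" using ex z by blast
  have *: "t powi v z = z * inverse u" using u unit_nonzero
    by (metis mult.assoc mult.right_neutral right_inverse)
  show "v z = 0 \<longleftrightarrow> unit z"
    using u * unit_mult unit_inverse powi_place_unit_iff(1)[OF tP t(1), of "v z"] by metis
  show "v z > 0 \<longleftrightarrow> z \<in> P"
    using u * mult_in_place unit_inverse unit_iff powi_place_unit_iff(2)[OF tP t(1), of "v z"] by metis
qed

lemma val_nonneg_iff: "z \<noteq> 0 \<Longrightarrow> v z \<ge> 0 \<longleftrightarrow> z \<in> O\<^sub>P"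
  using val_unit_iff[of z] val_place_iff[of z] unit_or_place[of z] place_in[of z] unit_iff[of z]
  by fastforce

lemma val_one [simp]: "v 1 = 0" using val_unit_iff[of 1] by simp

lemma val_const: "c \<noteq> 0 \<Longrightarrow> v (\<iota> c) = 0" using val_unit_iff[of "\<iota> c"] unit_const by simp

lemma val_inverse: "z \<noteq> 0 \<Longrightarrow> v (inverse z) = - v z"
  using val_mult[of z "inverse z"] by simp

lemma val_power: "z \<noteq> 0 \<Longrightarrow> v (z ^ n) = int n * v z"
  by (induction n) (simp_all add: val_mult algebra_simps)

lemma val_powi: "z \<noteq> 0 \<Longrightarrow> v (z powi n) = n * v z"
  by (simp add: power_int_def val_power val_inverse)

lemma val_prod: "finite I \<Longrightarrow> (\<And>i. i \<in> I \<Longrightarrow> f i \<noteq> 0) \<Longrightarrow> v (prod f I) = (\<Sum>i\<in>I. v (f i))"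
  by (induction I rule: finite_induct) (simp_all add: val_mult)

text \<open>Records that the valuation is normalized, which later turns the negative value of
  \<open>Y\<close> at a ramified place into exactly -1.\<close>

lemma val_surj: obtains t where "t \<noteq> 0" "v t = 1"
proof -
  obtain t where t: "t \<noteq> 0" "P = (\<lambda>w. t * w) ` O\<^sub>P"
    by (rule uniformizer) blast
  then have "v t = 1" using place_val_unique[OF t(2,1), of 1 t 1] by simp
  then show ?thesis using t that by blast
qed

text \<open>Divided by the term of least value, all other terms lie in \<open>P\<close>, and 1 plus
  an element of \<open>P\<close> is a unit. Both consequences are used: the value of the sum comes
  from some term, and it bounds every term from below.\<close>

lemma val_sum_distinct:
  assumes "finite I" "I \<noteq> {}" "\<And>i. i \<in> I \<Longrightarrow> f i \<noteq> 0" "inj_on (\<lambda>i. v (f i)) I"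
  shows "sum f I \<noteq> 0 \<and> (\<exists>i\<in>I. v (sum f I) = v (f i)) \<and> (\<forall>i\<in>I. v (sum f I) \<le> v (f i))"
proof -
  obtain k where k: "k \<in> I" and min: "\<And>i. i \<in> I \<Longrightarrow> v (f k) \<le> v (f i)"
    using ex_is_arg_min_if_finite[OF assms(1,2), of "\<lambda>i. v (f i)"]
    unfolding is_arg_min_linorder by blast
  have fk: "f k \<noteq> 0" using assms(3) k by blast
  have "f i / f k \<in> P" if "i \<in> I - {k}" for i
  proof -
    have "v (f i) \<noteq> v (f k)" using inj_onD[OF assms(4) _ _ k, of i] that by blast
    moreover have "v (f k) \<le> v (f i)" using min that by blast
    ultimately have "v (f i) > v (f k)" by linarith
    then have "v (f i * inverse (f k)) > 0" using assms(3)[of i] fk that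
      by (simp add: val_mult val_inverse)
    moreover have "f i * inverse (f k) \<noteq> 0" using assms(3)[of i] fk that by simp
    ultimately show ?thesis using val_place_iff by (simp add: divide_inverse)
  qed
  then have r: "(\<Sum>i\<in>I - {k}. f i / f k) \<in> P" by (rule sum_in_place)
  define w where "w = 1 + (\<Sum>i\<in>I - {k}. f i / f k)"
  have "w \<notin> P"
    using diff_in_place[OF _ r, of w] by (auto simp: w_def)
  then have w: "unit w"
    using unit_or_place[of w] add_in[OF one_in place_in[OF r]] w_def by blast
  have "sum f I = f k * w"
    using fk assms(1) k by (simp add: w_def sum.remove[of I k] algebra_simps sum_distrib_right sum_divide_distrib[symmetric])
  moreover have "v (f k * w) = v (f k)"
    using val_mult[OF fk unit_nonzero[OF w]] val_unit_iff[OF unit_nonzero[OF w]] w by simp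
  ultimately show ?thesis using k min fk unit_nonzero[OF w] by auto
qed

end

subsection \<open>Extension of places\<close>

text \<open>The candidates among which Zorn's lemma picks a maximal one; the dichotomy between z and
  its inverse, which would make them valuation rings, is what maximality has to produce.\<close>

definition subring_over :: "('k::field \<Rightarrow> 'f::field) \<Rightarrow> 'f set \<Rightarrow> bool" where
  "subring_over \<iota> R \<longleftrightarrow> range \<iota> \<subseteq> R \<and> (\<forall>a\<in>R. \<forall>b\<in>R. a - b \<in> R \<and> a * b \<in> R)"

lemma (in field_hom) subring_over_closed:
  assumes "subring_over hom R"
  shows "hom c \<in> R" "0 \<in> R" "1 \<in> R" "a \<in> R \<Longrightarrow> b \<in> R \<Longrightarrow> a - b \<in> R" "a \<in> R \<Longrightarrow> b \<in> R \<Longrightarrow> a * b \<in> R"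
    "a \<in> R \<Longrightarrow> b \<in> R \<Longrightarrow> a + b \<in> R" "(\<And>i. i \<in> I \<Longrightarrow> f i \<in> R) \<Longrightarrow> sum f I \<in> R"
proof -
  show c: "hom c \<in> R" for c using assms by (auto simp: subring_over_def)
  show z: "0 \<in> R" and "1 \<in> R" using c[of 0] c[of 1] by auto
  show d: "a - b \<in> R" if "a \<in> R" "b \<in> R" for a b using that assms by (simp add: subring_over_def)
  show "a \<in> R \<Longrightarrow> b \<in> R \<Longrightarrow> a * b \<in> R" using assms by (simp add: subring_over_def)
  show p: "a + b \<in> R" if "a \<in> R" "b \<in> R" for a b
    using d[OF that(1) d[OF z that(2)]] by simp
  show "(\<And>i. i \<in> I \<Longrightarrow> f i \<in> R) \<Longrightarrow> sum f I \<in> R"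
    by (induction I rule: infinite_finite_induct) (auto intro: z p)
qed

lemma (in field_hom) subring_over_adjoin:
  assumes R: "subring_over hom R"
  shows "subring_over hom {poly p z | p. \<forall>i. coeff p i \<in> R}" (is "subring_over hom ?A")
    and "R \<subseteq> {poly p z | p. \<forall>i. coeff p i \<in> R}" and "z \<in> {poly p z | p. \<forall>i. coeff p i \<in> R}"
proof -
  note c = subring_over_closed[OF R]
  show sub: "R \<subseteq> ?A"
  proof
    fix a assume "a \<in> R"
    then have "\<forall>i. coeff [:a:] i \<in> R" using c(2) by (auto simp: coeff_pCons split: nat.split)
    then show "a \<in> ?A" by (intro CollectI exI[of _ "[:a:]"]) auto
  qed
  have "\<forall>i. coeff [:0, 1:] i \<in> R" using c(2,3) by (auto simp: coeff_pCons split: nat.split)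
  then show "z \<in> ?A" by (intro CollectI exI[of _ "[:0, 1:]"]) auto
  show "subring_over hom ?A"
    unfolding subring_over_def
  proof (intro conjI ballI)
    show "range hom \<subseteq> ?A" using sub c(1) by auto
  next
    fix a b assume "a \<in> ?A" "b \<in> ?A"
    then obtain p q where pq: "a = poly p z" "b = poly q z" "\<forall>i. coeff p i \<in> R" "\<forall>i. coeff q i \<in> R"
      by auto
    have "a - b = poly (p - q) z" "\<forall>i. coeff (p - q) i \<in> R" using pq c(4) by auto
    then show "a - b \<in> ?A" by blast
    have "a * b = poly (p * q) z" "\<forall>i. coeff (p * q) i \<in> R"
      using pq c(5) by (auto simp: coeff_mult intro!: c(7))
    then show "a * b \<in> ?A" by blast
  qed
qed

text \<open>The leading term of \<open>1 = \<Sum> p\<^sub>i z\<^sup>i\<close> is eliminated by means of \<open>1 = \<Sum> q\<^sub>j z\<^sup>-\<^sup>j\<close>.\<close>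

lemma unit_relation_reduce:
  fixes p q :: "'f::field poly"
  assumes z: "z \<noteq> 0" and p: "poly p z = 1" and q: "poly q (inverse z) = 1"
    and deg: "degree q \<le> degree p" "degree p > 0"
    and I: "0 \<in> I" "\<And>s t. s \<in> I \<Longrightarrow> t \<in> I \<Longrightarrow> s + t \<in> I" "coeff q 0 \<in> I"
      "\<And>i. (1 - coeff q 0) * coeff p i \<in> I" "\<And>i j. coeff p i * coeff q j \<in> I"
  obtains r where "\<And>i. coeff r i \<in> I" "poly r z = 1" "degree r < degree p"
proof -
  define n where "n = degree p"
  define b0 where "b0 = coeff q 0"
  define c where "c = coeff p n"
  define w where "w = (\<Sum>j\<in>{1..degree q}. monom (coeff q j) (n - j))"
  \<comment> \<open>Multiplied by \<open>z ^ n\<close>, the relation for the inverse expresses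
    \<open>(1 - b0) * z ^ n\<close> by the lower powers collected in \<open>w\<close>. So
    \<open>1 - b0\<close> times the relation for \<open>z\<close> can have its top term replaced by
    \<open>c * w\<close>, and adding \<open>b0\<close> restores the value 1.\<close>
  define r where "r = [:b0:] + Polynomial.smult (1 - b0) (p - monom c n) + Polynomial.smult c w"
  have n: "n > 0" "degree q \<le> n" using deg by (auto simp: n_def)
  have "1 = (\<Sum>j\<le>degree q. coeff q j * inverse z ^ j)" using q by (simp add: poly_altdef)
  also have "\<dots> = b0 + (\<Sum>j\<in>{1..degree q}. coeff q j * inverse z ^ j)"
    by (simp add: b0_def sum.atMost_shift atLeast0AtMost[symmetric] sum.atLeast_Suc_atMost)
  finally have "1 - b0 = (\<Sum>j\<in>{1..degree q}. coeff q j * inverse z ^ j)"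
    by (simp add: diff_eq_eq add.commute)
  then have "(1 - b0) * z ^ n = (\<Sum>j\<in>{1..degree q}. coeff q j * inverse z ^ j) * z ^ n"
    by simp
  also have "\<dots> = poly w z"
    unfolding w_def poly_sum sum_distrib_right
  proof (rule sum.cong)
    fix j assume "j \<in> {1..degree q}"
    then have "z ^ n = z ^ (n - j) * z ^ j" using n by (simp flip: power_add)
    then show "coeff q j * inverse z ^ j * z ^ n = poly (monom (coeff q j) (n - j)) z"
      using z by (simp add: poly_monom power_inverse)
  qed simp
  finally have w: "poly w z = (1 - b0) * z ^ n" by simp
  have 1: "poly r z = 1"
    unfolding r_def poly_add poly_smult poly_diff poly_monom p w by (simp add: algebra_simps)
  have cw: "coeff w i = (if i < n \<and> n - i \<le> degree q then coeff q (n - i) else 0)" for i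
  proof -
    have "coeff w i = (\<Sum>j\<in>{1..degree q}. if j = n - i \<and> i < n then coeff q j else 0)"
      unfolding w_def coeff_sum by (intro sum.cong) (use n in auto)
    also have "\<dots> = (if i < n \<and> n - i \<le> degree q then coeff q (n - i) else 0)"
      by (cases "i < n") (auto simp: sum.delta)
    finally show ?thesis .
  qed
  have cr: "coeff r i = (if i = 0 then b0 else 0) + (1 - b0) * (if i = n then 0 else coeff p i) + c * coeff w i" for i
    by (simp add: r_def c_def coeff_pCons split: nat.split)
  have dr: "degree r < n"
  proof (rule degree_lessI)
    show "\<forall>k\<ge>n. coeff r k = 0"
      using n by (auto simp: cr cw n_def coeff_eq_0)
  qed (use n in simp)
  show ?thesis
  proof (rule that[OF _ 1 dr[unfolded n_def]])
    show "coeff r i \<in> I" for i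
      unfolding cr cw b0_def c_def by (intro I(2)) (auto intro: I)
  qed
qed

text \<open>Chevalley's extension theorem. Let \<open>R\<close> be maximal among the rings over
  \<open>S\<close> that omit the inverse of \<open>a\<close>. If \<open>R\<close> contained neither
  z nor its inverse, adjoining either would produce the inverse of \<open>a\<close>, that is, a
  relation expressing 1 as a polynomial in it with coefficients in \<open>a * R\<close>. Of two such
  relations of least degree, the longer could be shortened by the other.\<close>

lemma (in field_hom) exists_place_containing:
  assumes S: "subring_over hom S" and a: "a \<in> S" "a \<noteq> 0" "inverse a \<notin> S"
  obtains P where "P \<in> places hom" "a \<in> P" "S \<subseteq> place_ring P"
proof -
  define \<A> where "\<A> = {R. subring_over hom R \<and> S \<subseteq> R \<and> inverse a \<notin> R}"
  have "\<exists>M\<in>\<A>. \<forall>X\<in>\<A>. M \<subseteq> X \<longrightarrow> X = M"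
  proof (rule subset_Zorn_nonempty)
    show "\<A> \<noteq> {}" using S a by (auto simp: \<A>_def)
  next
    fix C assume C: "C \<noteq> {}" "subset.chain \<A> C"
    have sub: "C \<subseteq> \<A>" and cmp: "\<And>X Y. X \<in> C \<Longrightarrow> Y \<in> C \<Longrightarrow> X \<subseteq> Y \<or> Y \<subseteq> X"
      using C(2) by (auto simp: subset.chain_def)
    have "u - w \<in> \<Union>C \<and> u * w \<in> \<Union>C" if uw: "u \<in> \<Union>C" "w \<in> \<Union>C" for u w
    proof -
      obtain X Y where XY: "X \<in> C" "u \<in> X" "Y \<in> C" "w \<in> Y" using uw by blast
      then obtain Z where Z: "Z \<in> C" "u \<in> Z" "w \<in> Z" using cmp[of X Y] by blast
      then have "subring_over hom Z" using sub \<A>_def by blast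
      then show ?thesis using Z by (auto simp: subring_over_def)
    qed
    moreover obtain X where "X \<in> C" using C by blast
    moreover have "range hom \<subseteq> X" "S \<subseteq> X" if "X \<in> C" for X
    proof -
      have "X \<in> \<A>" using that sub by blast
      then show "range hom \<subseteq> X" "S \<subseteq> X" by (simp_all add: \<A>_def subring_over_def)
    qed
    ultimately have "subring_over hom (\<Union>C)" "S \<subseteq> \<Union>C"
      unfolding subring_over_def by blast+
    moreover have "inverse a \<notin> \<Union>C" using sub by (auto simp: \<A>_def)
    ultimately show "\<Union>C \<in> \<A>" by (simp add: \<A>_def)
  qed
  then obtain R where RA: "R \<in> \<A>" and max: "\<And>X. X \<in> \<A> \<Longrightarrow> R \<subseteq> X \<Longrightarrow> X = R" by blast
  have R: "subring_over hom R" "S \<subseteq> R" "inverse a \<notin> R" using RA by (auto simp: \<A>_def)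
  note c = subring_over_closed[OF R(1)]
  have aR: "a \<in> R" using a R by blast
  \<comment> \<open>This ideal is proper precisely because \<open>R\<close> omits the inverse of
    \<open>a\<close>; a relation with coefficients in it therefore has positive degree.\<close>
  define I where "I = (\<lambda>r. a * r) ` R"
  have Iadd: "s + t \<in> I" if "s \<in> I" "t \<in> I" for s t
    using that c(6) unfolding I_def by (auto simp flip: distrib_left)
  have Imult: "s * t \<in> I" if "s \<in> I" "t \<in> R" for s t
    using that c(5) unfolding I_def by (auto simp: mult.assoc)
  have IR: "I \<subseteq> R" using aR c(5) by (auto simp: I_def)
  have I0: "0 \<in> I" using c(2) by (auto simp: I_def intro!: image_eqI[of _ _ 0])
  have I1: "1 \<notin> I"
  proof
    assume "1 \<in> I"
    then obtain r where "r \<in> R" "a * r = 1" by (auto simp: I_def)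
    then show False using R(3) inverse_unique[of a r] by simp
  qed
  define rel where "rel z p \<longleftrightarrow> (\<forall>i. coeff p i \<in> I) \<and> poly p z = 1" for z p
  have ex_rel: "\<exists>p. rel z p" if z: "z \<notin> R" for z
  proof -
    define A where "A = {poly p z | p. \<forall>i. coeff p i \<in> R}"
    have A: "subring_over hom A" "R \<subseteq> A" "z \<in> A"
      using subring_over_adjoin[OF R(1)] unfolding A_def by auto
    have "A \<notin> \<A>" using max[of A] A z by blast
    then have "inverse a \<in> A" using A R(2) by (auto simp: \<A>_def)
    then obtain p where p: "inverse a = poly p z" "\<forall>i. coeff p i \<in> R" by (auto simp: A_def)
    have "rel z (Polynomial.smult a p)"
      using p a(2) by (auto simp: rel_def I_def simp flip: p(1))
    then show ?thesis by blast
  qed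
  have desc: "\<exists>p'. rel z p' \<and> degree p' < degree p"
    if hyps: "z \<noteq> 0" "rel z p" "rel (inverse z) q" "degree q \<le> degree p" for z p q
  proof -
    have "degree p > 0"
    proof (rule ccontr)
      assume "\<not> degree p > 0"
      then obtain s where "p = [:s:]" using degree_eq_zeroE by blast
      then show False using that(2) I1 by (auto simp: rel_def dest: spec[of _ 0])
    qed
    moreover have pI: "coeff p i \<in> I" and qI: "coeff q i \<in> I" for i using that by (auto simp: rel_def)
    have "(1 - coeff q 0) * coeff p i \<in> I" for i
      using Imult[OF pI[of i], of "1 - coeff q 0"] c(4)[OF c(3)] qI IR by (auto simp: mult.commute)
    moreover have "coeff p i * coeff q j \<in> I" for i j
      using Imult[OF pI[of i], of "coeff q j"] qI IR by blast
    moreover have "poly p z = 1" "poly q (inverse z) = 1" using that by (auto simp: rel_def)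
    ultimately obtain r where "\<forall>i. coeff r i \<in> I" "poly r z = 1" "degree r < degree p"
      using unit_relation_reduce[OF hyps(1) _ _ hyps(4) _ I0 Iadd qI] by metis
    then show ?thesis using rel_def by blast
  qed
  have val: "z \<in> R \<or> inverse z \<in> R" if z: "z \<noteq> 0" for z
  proof (rule ccontr)
    assume "\<not> (z \<in> R \<or> inverse z \<in> R)"
    then obtain p0 q0 where ex: "rel z p0" "rel (inverse z) q0" using ex_rel by blast
    obtain p where p: "rel z p" "\<And>p'. rel z p' \<Longrightarrow> degree p \<le> degree p'"
      using arg_min_natI[of "rel z", OF ex(1)] arg_min_nat_le[of "rel z"] by metis
    obtain q where q: "rel (inverse z) q" "\<And>p'. rel (inverse z) p' \<Longrightarrow> degree q \<le> degree p'"
      using arg_min_natI[of "rel (inverse z)", OF ex(2)] arg_min_nat_le[of "rel (inverse z)"] by metis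
    show False
    proof (cases "degree q \<le> degree p")
      case True
      then show False using desc[OF z p(1) q(1)] p(2) by fastforce
    next
      case False
      then show False using desc[of "inverse z" q p] z p(1) q by fastforce
    qed
  qed
  have ne: "a \<notin> range hom"
  proof
    assume "a \<in> range hom"
    then obtain k where "a = hom k" by blast
    then have "inverse a = hom (inverse k)" by (simp add: hom_inverse)
    then show False using R(3) c(1) by simp
  qed
  have vr: "valuation_ring hom R"
    unfolding valuation_ring_def using c aR ne R(3) val by auto
  define P where "P = {z \<in> R. \<not> (\<exists>w\<in>R. z * w = 1)}"
  have P: "P \<in> places hom" using vr by (auto simp: places_def P_def)
  have "a \<in> P"
    using aR R(3) inverse_unique[of a] by (auto simp: P_def)
  moreover have "R \<subseteq> place_ring P"
  proof
    fix z assume "z \<in> R"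
    then show "z \<in> place_ring P"
      by (cases "z = 0") (auto simp: place_ring_def P_def intro!: bexI[of _ z])
  qed
  ultimately show ?thesis using that P R(2) by blast
qed

subsection \<open>Linear algebra over a subfield\<close>

lemma is_subfield_closed:
  assumes "is_subfield L"
  shows "0 \<in> L" "1 \<in> L" "a \<in> L \<Longrightarrow> b \<in> L \<Longrightarrow> a - b \<in> L" "a \<in> L \<Longrightarrow> b \<in> L \<Longrightarrow> a * b \<in> L"
    "a \<in> L \<Longrightarrow> inverse a \<in> L" "a \<in> L \<Longrightarrow> b \<in> L \<Longrightarrow> a + b \<in> L" "a \<in> L \<Longrightarrow> - a \<in> L"
    "a \<in> L \<Longrightarrow> b \<in> L \<Longrightarrow> a / b \<in> L" "(\<And>i. i \<in> I \<Longrightarrow> f i \<in> L) \<Longrightarrow> sum f I \<in> L"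
    "a \<in> L \<Longrightarrow> a ^ k \<in> L" "a \<in> L \<Longrightarrow> a powi n \<in> L" "(\<And>i. i \<in> I \<Longrightarrow> f i \<in> L) \<Longrightarrow> prod f I \<in> L"
proof -
  show 0: "0 \<in> L" and 1: "1 \<in> L" using assms by (auto simp: is_subfield_def)
  show d: "a - b \<in> L" and m: "a * b \<in> L" if "a \<in> L" "b \<in> L" for a b
    using that assms by (auto simp: is_subfield_def)
  show i: "inverse a \<in> L" if "a \<in> L" for a using that assms by (auto simp: is_subfield_def)
  show u: "- a \<in> L" if "a \<in> L" for a using d[OF 0 that] by simp
  show p: "a + b \<in> L" if "a \<in> L" "b \<in> L" for a b using d[OF that(1) u[OF that(2)]] by simp
  show "a \<in> L \<Longrightarrow> b \<in> L \<Longrightarrow> a / b \<in> L" using m i by (simp add: divide_inverse)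
  show "(\<And>i. i \<in> I \<Longrightarrow> f i \<in> L) \<Longrightarrow> sum f I \<in> L"
    by (induction I rule: infinite_finite_induct) (auto intro: 0 p)
  show "(\<And>i. i \<in> I \<Longrightarrow> f i \<in> L) \<Longrightarrow> prod f I \<in> L"
    by (induction I rule: infinite_finite_induct) (auto intro: 1 m)
  show pw: "a ^ k \<in> L" if "a \<in> L" for a k using that by (induction k) (auto intro: 1 m)
  show "a powi n \<in> L" if "a \<in> L" using pw i that by (simp add: power_int_def)
qed

text \<open>Gaussian elimination by induction on the number of coordinates. The scalars form a
  subset because the rational functions are a subfield of \<open>'f\<close> and not a type of their
  own.\<close>

lemma exists_linear_relation:
  fixes W :: "'i \<Rightarrow> nat \<Rightarrow> 'f::field"
  assumes L: "is_subfield L" and "finite J" "card J > n" "\<And>j i. j \<in> J \<Longrightarrow> W j i \<in> L"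
  obtains c where "\<And>j. j \<in> J \<Longrightarrow> c j \<in> L" "\<exists>j\<in>J. c j \<noteq> 0" "\<And>i. i < n \<Longrightarrow> (\<Sum>j\<in>J. c j * W j i) = 0"
proof -
  note cl = is_subfield_closed[OF L]
  have "\<exists>c. (\<forall>j\<in>J. c j \<in> L) \<and> (\<exists>j\<in>J. c j \<noteq> 0) \<and> (\<forall>i<n. (\<Sum>j\<in>J. c j * W j i) = 0)"
    using assms(2-)
  proof (induction n arbitrary: J W)
    case 0
    then obtain j where "j \<in> J" by (auto simp: card_gt_0_iff)
    then show ?case by (intro exI[of _ "\<lambda>_. 1"]) (auto intro: cl)
  next
    case (Suc n)
    show ?case
    proof (cases "\<forall>j\<in>J. W j n = 0")
      case True
      obtain c where c: "\<forall>j\<in>J. c j \<in> L" "\<exists>j\<in>J. c j \<noteq> 0" "\<forall>i<n. (\<Sum>j\<in>J. c j * W j i) = 0"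
        using Suc.IH[of J W] Suc.prems by auto
      then have "\<forall>i<Suc n. (\<Sum>j\<in>J. c j * W j i) = 0"
        using True by (auto simp: less_Suc_eq)
      then show ?thesis using c by blast
    next
      case False
      then obtain p where p: "p \<in> J" "W p n \<noteq> 0" by blast
      define K where "K = J - {p}"
      define V where "V j i = W j i - W j n / W p n * W p i" for j i
      have "finite K" "card K > n" using Suc.prems p by (auto simp: K_def)
      moreover have "V j i \<in> L" if "j \<in> K" for j i
        using that p Suc.prems(3) by (auto simp: V_def K_def intro!: cl)
      ultimately obtain c where c: "\<forall>j\<in>K. c j \<in> L" "\<exists>j\<in>K. c j \<noteq> 0" "\<forall>i<n. (\<Sum>j\<in>K. c j * V j i) = 0"
        using Suc.IH[of K V] by auto
      \<comment> \<open>The coefficient of the pivot that cancels coordinate \<open>n\<close>. In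
        the other coordinates the combination then equals that of the reduced vectors
        \<open>V\<close>.\<close>
      define e where "e = - (\<Sum>j\<in>K. c j * W j n) / W p n"
      define c' where "c' = c(p := e)"
      have sums: "(\<Sum>j\<in>J. c' j * W j i) = e * W p i + (\<Sum>j\<in>K. c j * W j i)" for i
      proof -
        have "(\<Sum>j\<in>J. c' j * W j i) = c' p * W p i + (\<Sum>j\<in>K. c' j * W j i)"
          unfolding K_def using Suc.prems(1) p(1) by (rule sum.remove)
        also have "(\<Sum>j\<in>K. c' j * W j i) = (\<Sum>j\<in>K. c j * W j i)"
          by (intro sum.cong) (auto simp: c'_def K_def)
        finally show ?thesis by (simp add: c'_def)
      qed
      have "(\<Sum>j\<in>J. c' j * W j i) = 0" if "i < Suc n" for i
      proof (cases "i = n")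
        case True
        then show ?thesis using p by (simp add: sums e_def)
      next
        case False
        have "(\<Sum>j\<in>K. c j * V j i) = (\<Sum>j\<in>K. c j * W j i - c j * W j n * (W p i / W p n))"
          by (intro sum.cong) (simp_all add: V_def algebra_simps)
        also have "\<dots> = (\<Sum>j\<in>K. c j * W j i) - (\<Sum>j\<in>K. c j * W j n) * (W p i / W p n)"
          by (simp only: sum_subtractf sum_distrib_right)
        also have "\<dots> = (\<Sum>j\<in>J. c' j * W j i)" by (simp add: sums e_def)
        finally show ?thesis using c(3) False that by simp
      qed
      moreover have "e \<in> L" using c(1) Suc.prems(3) p by (auto simp: e_def K_def intro!: cl)
      then have "\<forall>j\<in>J. c' j \<in> L" using c(1) by (auto simp: c'_def K_def)
      moreover have "\<exists>j\<in>J. c' j \<noteq> 0" using c(2) by (auto simp: c'_def K_def)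
      ultimately show ?thesis by blast
    qed
  qed
  then show ?thesis using that by blast
qed

subsection \<open>The rational subfield\<close>

locale rational_subfield = field_hom \<iota> for \<iota> :: "'k::field \<Rightarrow> 'f::field" +
  fixes x :: 'f
  assumes transcendental: "transcendental_over \<iota> x"
begin

abbreviation ev :: "'k poly \<Rightarrow> 'f" where "ev p \<equiv> poly (map_poly \<iota> p) x"

lemma ev_eq_0_iff [simp]: "ev p = 0 \<longleftrightarrow> p = 0"
  using transcendental by (auto simp: transcendental_over_def)

lemma ev_simps: "ev (p + q) = ev p + ev q" "ev (p - q) = ev p - ev q" "ev (p * q) = ev p * ev q"
  "ev (p ^ n) = ev p ^ n" "ev [:c:] = \<iota> c" "ev [:- c, 1:] = x - \<iota> c" "ev (pCons c p) = \<iota> c + x * ev p"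
proof -
  interpret map_poly_hom: map_poly_comm_ring_hom \<iota> ..
  show "ev (p + q) = ev p + ev q" "ev (p - q) = ev p - ev q" "ev (p * q) = ev p * ev q"
    "ev (p ^ n) = ev p ^ n" "ev [:c:] = \<iota> c" "ev [:- c, 1:] = x - \<iota> c"
    "ev (pCons c p) = \<iota> c + x * ev p"
    by (simp_all add: hom_distribs map_poly_hom.hom_minus map_poly_hom.hom_mult map_poly_hom.hom_power)
qed

lemma x_minus_const_nonzero [simp]: "x - \<iota> a \<noteq> 0"
  using ev_eq_0_iff[of "[:- a, 1:]"] unfolding ev_simps(6) by simp

lemma x_neq_const [simp]: "x \<noteq> \<iota> a"
  using x_minus_const_nonzero[of a] by simp

lemma x_nonzero [simp]: "x \<noteq> 0"
  using x_neq_const[of 0] by simp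

text \<open>The rational function field K(x) inside \<open>'f\<close>.\<close>

definition L :: "'f set" where "L = {ev f / ev g | f g. g \<noteq> 0}"

lemma L_I: "ev f / ev g \<in> L"
proof (cases "g = 0")
  case True
  then have "ev f / ev g = ev 0 / ev 1" by simp
  then show ?thesis unfolding L_def by (metis (mono_tags, lifting) mem_Collect_eq one_neq_zero)
qed (auto simp: L_def)

lemma ev_in_L: "ev f \<in> L" using L_I[of f 1] by simp

lemma L_E: assumes "c \<in> L" obtains f g where "g \<noteq> 0" "c = ev f / ev g"
  using assms by (auto simp: L_def)

lemma subfield_L: "is_subfield L"
  unfolding is_subfield_def
proof (intro conjI ballI)
  show "0 \<in> L" "1 \<in> L" using ev_in_L[of 0] ev_in_L[of 1] by simp_all
next
  fix a b assume "a \<in> L" "b \<in> L"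
  then obtain f g h k where *: "g \<noteq> 0" "a = ev f / ev g" "k \<noteq> 0" "b = ev h / ev k" by (metis L_E)
  have "a - b = ev (f * k - h * g) / ev (g * k)" "a * b = ev (f * h) / ev (g * k)"
    using *(1,3) unfolding *(2,4) ev_simps by (simp_all add: diff_frac_eq)
  then show "a - b \<in> L" "a * b \<in> L" using L_I by metis+
next
  fix a assume "a \<in> L"
  then obtain f g where "a = ev f / ev g" by (metis L_E)
  then have "inverse a = ev g / ev f" by simp
  then show "inverse a \<in> L" using L_I by metis
qed

lemmas L_closed = is_subfield_closed[OF subfield_L]

lemma const_in_L: "\<iota> c \<in> L" using ev_in_L[of "[:c:]"] by (simp add: ev_simps)

lemma x_in_L: "x \<in> L" using ev_in_L[of "[:0, 1:]"] by (simp add: ev_simps)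

text \<open>Numerator and denominator are split by their orders at \<open>a\<close>. What remains is
  a unit at every place over \<open>a\<close>, so the exponent determines the value there up to the
  factor \<open>v (x - \<iota> a)\<close>.\<close>

lemma L_order_at:
  assumes "c \<in> L" "c \<noteq> 0"
  obtains n g h where "c = (x - \<iota> a) powi n * (ev g / ev h)" "poly g a \<noteq> 0" "poly h a \<noteq> 0"
proof -
  obtain f e where fe: "e \<noteq> 0" "c = ev f / ev e" using assms L_E by blast
  have f: "f \<noteq> 0" using fe assms by auto
  obtain g where g: "f = [:- a, 1:] ^ order a f * g" "\<not> [:- a, 1:] dvd g" using order_decomp[OF f] by blast
  obtain h where h: "e = [:- a, 1:] ^ order a e * h" "\<not> [:- a, 1:] dvd h" using order_decomp[OF fe(1)] by blast
  have "ev f = (x - \<iota> a) ^ order a f * ev g" "ev e = (x - \<iota> a) ^ order a e * ev h"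
    using g(1) h(1) ev_simps(3,4,6) by metis+
  then have "c = (x - \<iota> a) powi (int (order a f) - int (order a e)) * (ev g / ev h)"
    using fe by (simp add: power_int_diff)
  then show ?thesis using that g(2) h(2) by (simp add: poly_eq_0_iff_dvd)
qed

end

text \<open>If one term strictly dominated all others, the sum would be that term times a unit and
  could not vanish. The conclusion speaks of unit quotients and not of values, since it serves to
  prove that a place is discrete.\<close>

lemma (in function_field_place) sum_zero_unit_quotient:
  assumes "finite I" "I \<noteq> {}" "\<And>i. i \<in> I \<Longrightarrow> f i \<noteq> 0" "sum f I = 0"
  obtains i j where "i \<in> I" "j \<in> I" "i \<noteq> j" "unit (f i / f j)"
proof -
  have "\<exists>k\<in>I. \<forall>i\<in>I. f i / f k \<in> O\<^sub>P"
    using assms(1-3)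
  proof (induction I rule: finite_ne_induct)
    case (singleton a)
    then show ?case by simp
  next
    case (insert a I)
    then obtain k where k: "k \<in> I" "\<And>i. i \<in> I \<Longrightarrow> f i / f k \<in> O\<^sub>P" by auto
    have nz: "f a \<noteq> 0" "f k \<noteq> 0" using insert k by auto
    show ?case
    proof (cases "f a / f k \<in> O\<^sub>P")
      case True
      then show ?thesis using k by auto
    next
      case False
      then have ka: "f k / f a \<in> O\<^sub>P" using inverse_in[OF False] place_in by simp
      have "f i / f a \<in> O\<^sub>P" if "i \<in> I" for i
        using mult_in[OF k(2)[OF that] ka] nz by simp
      then show ?thesis using nz by auto
    qed
  qed
  then obtain k where k: "k \<in> I" "\<And>i. i \<in> I \<Longrightarrow> f i / f k \<in> O\<^sub>P" by blast
  have "(\<Sum>i\<in>I. f i / f k) = 0" using assms(4) by (simp flip: sum_divide_distrib)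
  then have "(\<Sum>i\<in>I - {k}. f i / f k) = - 1"
    using assms(1,3) k(1) by (simp add: sum.remove eq_neg_iff_add_eq_0 add.commute)
  then have "\<exists>i\<in>I - {k}. f i / f k \<notin> P"
    using sum_in_place[of "I - {k}" "\<lambda>i. f i / f k"] uminus_in_place[of "- 1"] one_notin_place by force
  then show ?thesis using that k unit_or_place by blast
qed

section \<open>Restriction of a place to the rational subfield\<close>

locale rational_place = rational_subfield \<iota> x + function_field_place \<iota> P
  for \<iota> :: "'k::field \<Rightarrow> 'f::field" and x :: 'f and P :: "'f set"
begin

lemma ev_in: "x \<in> O\<^sub>P \<Longrightarrow> ev p \<in> O\<^sub>P"
  by (induction p) (auto simp: ev_simps(7) intro!: add_in const_in mult_in)

text \<open>Since x - a divides g - g(a), the element g(x) is congruent modulo \<open>P\<close> to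
  the nonzero constant g(a).\<close>

lemma ev_unit:
  assumes a: "x - \<iota> a \<in> P" and g: "poly g a \<noteq> 0"
  shows "unit (ev g)"
proof -
  have x: "x \<in> O\<^sub>P" using add_in[OF place_in[OF a] const_in[of a]] by simp
  have "[:- a, 1:] dvd g - [:poly g a:]" by (simp add: dvd_iff_poly_eq_0)
  then obtain s where "g - [:poly g a:] = [:- a, 1:] * s" by (rule dvdE)
  then have "ev g - \<iota> (poly g a) = (x - \<iota> a) * ev s" by (metis ev_simps(2,3,5,6))
  then have "ev g - \<iota> (poly g a) \<in> P" using mult_in_place[OF a ev_in[OF x]] by simp
  then have "ev g \<notin> P"
    using diff_in_place[of "ev g" "ev g - \<iota> (poly g a)"] unit_const[OF g] place_not_unit by auto
  then show ?thesis using ev_in[OF x] unit_or_place by blast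
qed

lemma unit_divide: "unit a \<Longrightarrow> unit b \<Longrightarrow> unit (a / b)"
  by (simp add: divide_inverse unit_mult unit_inverse)

lemma other_unit:
  assumes "x - \<iota> a \<in> P" "b \<noteq> a" shows "unit (x - \<iota> b)"
  using ev_unit[OF assms(1), of "[:- b, 1:]", unfolded ev_simps(6)] assms(2) by simp

lemma infinite_inverse_x: "x \<notin> O\<^sub>P \<Longrightarrow> inverse x \<in> P" by (rule inverse_in)

text \<open>Divided by the top power of x, a polynomial is its leading coefficient plus multiples of
  1/x, which lie in \<open>P\<close>.\<close>

lemma infinite_unit:
  assumes "x \<notin> O\<^sub>P" "p \<noteq> 0"
  shows "unit (ev p * inverse x ^ degree p)"
  using assms(2)
proof (induction p)
  case (pCons a p)
  have xP: "inverse x \<in> P" using infinite_inverse_x assms by blast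
  show ?case
  proof (cases "p = 0")
    case True
    then show ?thesis using pCons unit_const by (simp add: hom_distribs)
  next
    case False
    define w where "w = ev p * inverse x ^ degree p"
    have w: "unit w" using pCons False w_def by simp
    have eq: "ev (pCons a p) * inverse x ^ degree (pCons a p) = \<iota> a * inverse x ^ Suc (degree p) + w"
      using False by (simp add: ev_simps(7) w_def algebra_simps)
    have i: "\<iota> a * inverse x ^ Suc (degree p) \<in> P"
      using mult_in_place[OF power_in_place[OF xP] const_in[of a], of "Suc (degree p)"]
      by (simp add: mult.commute)
    have "\<iota> a * inverse x ^ Suc (degree p) + w \<notin> P"
      using diff_in_place[OF _ i, of "\<iota> a * inverse x ^ Suc (degree p) + w"] place_not_unit w by auto
    then show ?thesis unfolding eq using unit_or_place add_in[OF place_in[OF i]] w unit_iff by blast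
  qed
qed simp

lemma infinite_power_unit:
  assumes "x \<notin> O\<^sub>P" "c \<in> L" "c \<noteq> 0"
  shows "\<exists>n::int. unit (c * inverse x powi n)"
proof -
  obtain f g where fg: "g \<noteq> 0" "c = ev f / ev g" using assms L_E by blast
  then have f: "f \<noteq> 0" using assms by auto
  have "unit ((ev f * inverse x ^ degree f) / (ev g * inverse x ^ degree g))"
    using assms fg f by (intro unit_divide infinite_unit)
  also have "(ev f * inverse x ^ degree f) / (ev g * inverse x ^ degree g)
      = c * inverse x powi (int (degree f) - int (degree g))"
    using fg(2) power_int_diff[of "inverse x" "int (degree f)" "int (degree g)"] by simp
  finally show ?thesis by blast
qed

text \<open>The element \<open>c0\<close> witnesses that \<open>P\<close> is not trivial on K(x). At
  infinity 1/x is a parameter. Otherwise some nonzero polynomial has its value in \<open>P\<close>;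
  one of least degree divides all of these, and splitting it off repeatedly ends in a unit.\<close>

lemma exists_parameter:
  assumes "c0 \<in> L" "c0 \<noteq> 0" "c0 \<in> P"
  obtains \<pi> where "\<pi> \<in> P" "\<pi> \<noteq> 0" "\<And>c. c \<in> L \<Longrightarrow> c \<noteq> 0 \<Longrightarrow> \<exists>n::int. unit (c * \<pi> powi n)"
proof (cases "x \<in> O\<^sub>P")
  case False
  then show ?thesis
    using that[of "inverse x"] infinite_inverse_x infinite_power_unit x_nonzero
      nonzero_imp_inverse_nonzero by blast
next
  case True
  define A where "A p \<longleftrightarrow> p \<noteq> 0 \<and> ev p \<in> P" for p
  obtain f g where fg: "g \<noteq> 0" "c0 = ev f / ev g" using assms L_E by blast
  then have "ev f \<in> P" using mult_in_place[OF assms(3) ev_in[OF True, of g]] by simp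
  moreover have "f \<noteq> 0" using fg assms by auto
  ultimately have "A f" by (simp add: A_def)
  then obtain p where p: "A p" and min: "\<And>q. A q \<Longrightarrow> degree p \<le> degree q"
    using arg_min_natI[of A f degree] arg_min_nat_le[of A _ degree] by blast
  have nz: "p \<noteq> 0" and pP: "ev p \<in> P" using p by (simp_all add: A_def)
  have dvd: "p dvd q" if "ev q \<in> P" for q
  proof (rule ccontr)
    assume "\<not> p dvd q"
    then have r: "q mod p \<noteq> 0" by (simp add: mod_eq_0_iff_dvd)
    have "ev (q mod p) = ev q - ev p * ev (q div p)"
      by (metis ev_simps(2,3) minus_mult_div_eq_mod)
    also have "\<dots> \<in> P" using that mult_in_place[OF pP ev_in[OF True]] diff_in_place by blast
    finally have "degree p \<le> degree (q mod p)" using min A_def r by blast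
    then show False using degree_mod_less'[OF nz r] by simp
  qed
  have deg: "degree p > 0"
  proof (rule ccontr)
    assume "\<not> degree p > 0"
    then obtain k where "p = [:k:]" using degree_eq_zeroE by blast
    then show False using nz pP unit_const[of k] place_not_unit by (simp add: ev_simps(5))
  qed
  have dec: "\<exists>n. unit (ev q * ev p powi n)" if "q \<noteq> 0" for q
    using that
  proof (induction "degree q" arbitrary: q rule: less_induct)
    case less
    show ?case
    proof (cases "ev q \<in> P")
      case notin: False
      then have "unit (ev q * ev p powi 0)" using unit_or_place[OF ev_in[OF True, of q]] notin by simp
      then show ?thesis by blast
    next
      case True
      then obtain r where r: "q = p * r" using dvd by (metis dvdE)
      have "degree r < degree q" using r deg less.prems by (simp add: degree_mult_eq)
      moreover have "r \<noteq> 0" using r less.prems by auto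
      ultimately obtain n where n: "unit (ev r * ev p powi n)" using less.hyps[of r] by blast
      have "ev q * ev p powi (n - 1) = ev r * ev p powi n"
        using r nz by (simp add: ev_simps power_int_diff)
      then show ?thesis using n by metis
    qed
  qed
  show ?thesis
  proof (rule that[of "ev p"])
    fix c assume c: "c \<in> L" "c \<noteq> 0"
    obtain f g where "g \<noteq> 0" "c = ev f / ev g" by (rule L_E[OF c(1)])
    with c(2) have fg: "g \<noteq> 0" "c = ev f / ev g" "f \<noteq> 0" by auto
    obtain k l where k: "unit (ev f * ev p powi k)" and l: "unit (ev g * ev p powi l)"
      using dec fg by blast
    have "c * ev p powi (k - l) = (ev f * ev p powi k) / (ev g * ev p powi l)"
      using fg nz by (simp add: power_int_diff)
    then show "\<exists>n. unit (c * ev p powi n)" using unit_divide[OF k l] by metis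
  qed (use nz pP in auto)
qed

end

subsection \<open>Adjoining a radical\<close>

locale radical_extension = rational_subfield \<iota> x
  for \<iota> :: "'k::field \<Rightarrow> 'f::field" and x :: 'f +
  fixes y :: 'f and m :: nat
  assumes m_pos: "m > 0" and radicand: "y ^ m \<in> L" and y_nonzero: "y \<noteq> 0"
    and adjoin_UNIV: "adjoin \<iota> {x, y} = UNIV"
begin

definition Y :: 'f where "Y = inverse y"

lemma Y_nonzero [simp]: "Y \<noteq> 0" using y_nonzero by (simp add: Y_def)

lemma Y_pow_m: "Y ^ m \<in> L" using L_closed(5)[OF radicand] by (simp add: Y_def power_inverse)

text \<open>The span of 1, Y, ..., Y^(m-1) over K(x). Here it is only shown to be a field and hence
  everything; independence of the powers follows later from a ramified place.\<close>

definition B :: "'f set" where "B = {\<Sum>i<m. c i * Y ^ i | c. \<forall>i<m. c i \<in> L}"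

lemma B_I: "(\<And>i. i < m \<Longrightarrow> c i \<in> L) \<Longrightarrow> (\<Sum>i<m. c i * Y ^ i) \<in> B"
  by (auto simp: B_def)

lemma B_E: assumes "z \<in> B" obtains c where "\<And>i. i < m \<Longrightarrow> c i \<in> L" "z = (\<Sum>i<m. c i * Y ^ i)"
  using assms by (auto simp: B_def)

lemma B_diff: assumes "a \<in> B" "b \<in> B" shows "a - b \<in> B"
proof -
  obtain c where c: "\<And>i. i < m \<Longrightarrow> c i \<in> L" "a = (\<Sum>i<m. c i * Y ^ i)" using B_E[OF assms(1)] by blast
  obtain d where d: "\<And>i. i < m \<Longrightarrow> d i \<in> L" "b = (\<Sum>i<m. d i * Y ^ i)" using B_E[OF assms(2)] by blast
  have "a - b = (\<Sum>i<m. (c i - d i) * Y ^ i)"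
    using c d by (simp add: sum_subtractf left_diff_distrib)
  also have "\<dots> \<in> B" using c d L_closed(3) by (intro B_I) blast
  finally show ?thesis .
qed

lemma B_zero: "0 \<in> B" using B_I[of "\<lambda>_. 0"] L_closed(1) by simp

lemma B_add: assumes "a \<in> B" "b \<in> B" shows "a + b \<in> B"
  using B_diff[OF assms(1) B_diff[OF B_zero assms(2)]] by simp

lemma B_sum: "(\<And>i. i \<in> I \<Longrightarrow> f i \<in> B) \<Longrightarrow> sum f I \<in> B"
  by (induction I rule: infinite_finite_induct) (auto intro: B_zero B_add)

lemma monomial_reduce: "Y ^ i = (Y ^ m) ^ (i div m) * Y ^ (i mod m)"
  by (metis mult_div_mod_eq power_add power_mult)

lemma B_monomial: assumes "c \<in> L" shows "c * Y ^ i \<in> B"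
proof -
  have "(\<Sum>k<m. (if k = i mod m then c * (Y ^ m) ^ (i div m) else 0) * Y ^ k)
      = c * (Y ^ m) ^ (i div m) * Y ^ (i mod m)"
    using m_pos by (simp add: sum.delta if_distrib[of "\<lambda>u. u * _"] cong: if_cong)
  also have "\<dots> = c * Y ^ i" by (subst (3) monomial_reduce) simp
  finally show ?thesis
    using B_I[of "\<lambda>k. if k = i mod m then c * (Y ^ m) ^ (i div m) else 0"] assms Y_pow_m L_closed
    by (metis (full_types))
qed

lemma B_mult: assumes "a \<in> B" "b \<in> B" shows "a * b \<in> B"
proof -
  obtain c where c: "\<And>i. i < m \<Longrightarrow> c i \<in> L" "a = (\<Sum>i<m. c i * Y ^ i)" using B_E[OF assms(1)] by blast
  obtain d where d: "\<And>i. i < m \<Longrightarrow> d i \<in> L" "b = (\<Sum>i<m. d i * Y ^ i)" using B_E[OF assms(2)] by blast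
  have "a * b = (\<Sum>i<m. \<Sum>j<m. c i * d j * Y ^ (i + j))"
    unfolding c(2) d(2) sum_product by (simp add: power_add mult_ac)
  also have "\<dots> \<in> B"
    using c(1) d(1) by (intro B_sum B_monomial L_closed) auto
  finally show ?thesis .
qed

text \<open>The \<open>m + 1\<close> powers of \<open>z\<close> have only \<open>m\<close>
  coordinates each.\<close>

lemma B_algebraic:
  assumes "z \<in> B"
  obtains c where "\<And>j. j \<le> m \<Longrightarrow> c j \<in> L" "\<exists>j\<le>m. c j \<noteq> 0" "(\<Sum>j\<le>m. c j * z ^ j) = 0"
proof -
  have one: "1 \<in> B" using B_monomial[of 1 0] L_closed(2) by simp
  have "z ^ j \<in> B" for j by (induction j) (auto intro: one B_mult assms)
  then have "\<exists>w. (\<forall>i<m. w i \<in> L) \<and> z ^ j = (\<Sum>i<m. w i * Y ^ i)" for j using B_E by metis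
  then obtain w where w: "\<And>j i. i < m \<Longrightarrow> w j i \<in> L" "\<And>j. z ^ j = (\<Sum>i<m. w j i * Y ^ i)"
    by metis
  define W where "W j i = (if i < m then w j i else 0)" for j i
  obtain c where c: "\<And>j. j \<in> {..m} \<Longrightarrow> c j \<in> L" "\<exists>j\<in>{..m}. c j \<noteq> 0"
    "\<And>i. i < m \<Longrightarrow> (\<Sum>j\<in>{..m}. c j * W j i) = 0"
    by (rule exists_linear_relation[OF subfield_L, of "{..m}" m W])
      (auto simp: W_def intro: w L_closed)
  have "(\<Sum>j\<le>m. c j * z ^ j) = (\<Sum>j\<le>m. \<Sum>i<m. c j * W j i * Y ^ i)"
    unfolding w(2) sum_distrib_left by (intro sum.cong) (simp_all add: W_def mult.assoc)
  also have "\<dots> = (\<Sum>i<m. (\<Sum>j\<le>m. c j * W j i) * Y ^ i)"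
    by (subst sum.swap) (simp add: sum_distrib_right)
  also have "\<dots> = 0" using c(3) by simp
  finally show ?thesis using that c(1,2) by auto
qed

text \<open>In an algebraic relation for \<open>z\<close> the lowest occurring power cancels, and
  what is left writes a nonzero element of \<open>L\<close> as \<open>z\<close> times a polynomial
  in \<open>z\<close>.\<close>

lemma B_inverse: assumes "z \<in> B" shows "inverse z \<in> B"
proof (cases "z = 0")
  case False
  obtain c where c: "\<And>j. j \<le> m \<Longrightarrow> c j \<in> L" "\<exists>j\<le>m. c j \<noteq> 0" "(\<Sum>j\<le>m. c j * z ^ j) = 0"
    using B_algebraic[OF assms] by metis
  define k where "k = (LEAST j. j \<le> m \<and> c j \<noteq> 0)"
  have k: "k \<le> m" "c k \<noteq> 0" using LeastI_ex[of "\<lambda>j. j \<le> m \<and> c j \<noteq> 0"] c(2) by (auto simp: k_def)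
  have low: "c j = 0" if "j < k" for j using not_less_Least[OF that[unfolded k_def]] that k by auto
  have "0 = (\<Sum>j\<in>{k..m}. c j * z ^ j)"
    using c(3) by (subst (asm) sum.mono_neutral_right[of "{..m}" "{k..m}"]) (auto simp: low)
  also have "\<dots> = c k * z ^ k + (\<Sum>j\<in>{Suc k..m}. c j * z ^ j)"
    using k by (simp add: sum.atLeast_Suc_atMost)
  also have "(\<Sum>j\<in>{Suc k..m}. c j * z ^ j) = z ^ Suc k * (\<Sum>j\<in>{Suc k..m}. c j * z ^ (j - Suc k))"
    unfolding sum_distrib_left
    by (intro sum.cong) (auto simp: mult.left_commute simp flip: power_add power_Suc)
  finally have "z ^ k * (c k + z * (\<Sum>j\<in>{Suc k..m}. c j * z ^ (j - Suc k))) = 0"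
    by (simp add: algebra_simps)
  then have eq: "z * (\<Sum>j\<in>{Suc k..m}. c j * z ^ (j - Suc k)) = - c k"
    using False by (simp add: add_eq_0_iff)
  have one: "1 \<in> B" using B_monomial[of 1 0] L_closed(2) by simp
  have pw: "z ^ j \<in> B" for j by (induction j) (auto intro: one B_mult assms)
  have LB: "a \<in> B" if "a \<in> L" for a using B_monomial[OF that, of 0] by simp
  have "z * ((\<Sum>j\<in>{Suc k..m}. c j * z ^ (j - Suc k)) * inverse (- c k)) = 1"
    using eq k by (simp flip: mult.assoc)
  then have "inverse z = (\<Sum>j\<in>{Suc k..m}. c j * z ^ (j - Suc k)) * inverse (- c k)"
    by (rule inverse_unique)
  also have "\<dots> \<in> B"
    by (intro B_mult B_sum LB pw L_closed c) (use k in auto)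
  finally show ?thesis .
qed (use assms in simp)

lemma B_UNIV: "B = UNIV"
proof -
  have "is_subfield B"
    unfolding is_subfield_def
    using B_zero B_monomial[of 1 0] L_closed(2) B_diff B_mult B_inverse by auto
  moreover have "range \<iota> \<union> {x, y} \<subseteq> B"
    using B_monomial[OF const_in_L, of _ 0] B_monomial[OF x_in_L, of 0]
      B_inverse[of Y] B_monomial[of 1 1] L_closed(2) by (auto simp: Y_def)
  ultimately have "adjoin \<iota> {x, y} \<subseteq> B"
    unfolding adjoin_def by (intro hull_minimal)
  then show ?thesis using adjoin_UNIV by blast
qed

lemma algebraic:
  obtains c where "\<And>j. j \<le> m \<Longrightarrow> c j \<in> L" "\<exists>j\<le>m. c j \<noteq> 0" "(\<Sum>j\<le>m. c j * z ^ j) = 0"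
  using B_algebraic[of z] B_UNIV by blast

text \<open>In an algebraic relation over K(x) two terms have a unit quotient. If \<open>P\<close>
  were trivial on K(x), this would fail for an element outside the ring, whose powers all have
  different sizes. So K(x) has a parameter at \<open>P\<close>, and a positive power of any z with
  exponent at most \<open>m\<close> agrees with an element of K(x) up to a unit.\<close>

lemma place_discrete:
  assumes P: "P \<in> places \<iota>"
  shows "discrete_place \<iota> P"
proof -
  interpret rational_place \<iota> x P using P by unfold_locales
  have "\<exists>c\<in>L. c \<notin> O\<^sub>P"
  proof (rule ccontr)
    assume "\<not> (\<exists>c\<in>L. c \<notin> O\<^sub>P)"
    then have LO: "c \<in> O\<^sub>P" if "c \<in> L" for c using that by blast
    obtain z where z: "z \<notin> O\<^sub>P" using vring by (auto simp: valuation_ring_def)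
    then have iz: "inverse z \<in> P" "z \<noteq> 0" using inverse_in by auto
    obtain c where c: "\<And>j. j \<le> m \<Longrightarrow> c j \<in> L" "\<exists>j\<le>m. c j \<noteq> 0" "(\<Sum>j\<le>m. c j * z ^ j) = 0"
      using algebraic[of z] by metis
    define I where "I = {j. j \<le> m \<and> c j \<noteq> 0}"
    have "sum (\<lambda>j. c j * z ^ j) I = (\<Sum>j\<le>m. c j * z ^ j)"
      by (rule sum.mono_neutral_left) (auto simp: I_def)
    then obtain i j where ij: "i \<in> I" "j \<in> I" "i \<noteq> j" "unit (c i * z ^ i / (c j * z ^ j))"
      using sum_zero_unit_quotient[of I "\<lambda>j. c j * z ^ j"] c(2,3) iz(2) by (auto simp: I_def)
    have False if "i < j" "i \<in> I" "j \<in> I" "unit (c i * z ^ i / (c j * z ^ j))" for i j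
    proof -
      have "c i * z ^ i / (c j * z ^ j) = inverse z ^ (j - i) * (c i / c j)"
        using that iz(2) by (simp add: field_simps power_diff I_def)
      moreover have "c i / c j \<in> O\<^sub>P" using that c by (intro LO L_closed) (auto simp: I_def)
      ultimately show False
        using mult_in_place[OF power_in_place[OF iz(1)], of "j - i" "c i / c j"] that place_not_unit by auto
    qed
    from this[of i j] this[of j i] show False
      using ij unit_inverse[OF ij(4)] by (cases i j rule: linorder_cases) auto
  qed
  then obtain c0 where "inverse c0 \<in> L" "inverse c0 \<noteq> 0" "inverse c0 \<in> P"
    using inverse_in L_closed(5) by (metis inverse_zero inverse_inverse_eq zero_in)
  then obtain \<pi> where \<pi>: "\<pi> \<in> P" "\<pi> \<noteq> 0" "\<forall>c. c \<in> L \<longrightarrow> c \<noteq> 0 \<longrightarrow> (\<exists>n::int. unit (c * \<pi> powi n))"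
    using exists_parameter by metis
  have discrete
  \<comment> \<open>The exponent of z obtained from a relation is a difference of indices up to
    \<open>m\<close>; the factorial is a common multiple of all of them and so serves every z at
    once.\<close>
  proof (rule discreteI[OF \<pi>(1,2), of "fact m"])
    fix z :: 'f assume z: "z \<noteq> 0"
    obtain c where c: "\<And>j. j \<le> m \<Longrightarrow> c j \<in> L" "\<exists>j\<le>m. c j \<noteq> 0" "(\<Sum>j\<le>m. c j * z ^ j) = 0"
      using algebraic[of z] by metis
    define I where "I = {j. j \<le> m \<and> c j \<noteq> 0}"
    have "sum (\<lambda>j. c j * z ^ j) I = (\<Sum>j\<le>m. c j * z ^ j)"
      by (rule sum.mono_neutral_left) (auto simp: I_def)
    then obtain i j where ij: "i \<in> I" "j \<in> I" "i \<noteq> j" "unit (c i * z ^ i / (c j * z ^ j))"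
      using sum_zero_unit_quotient[of I "\<lambda>j. c j * z ^ j"] c(2,3) z by (auto simp: I_def)
    have *: "\<exists>n::int. unit (z ^ fact m * \<pi> powi n)"
      if h: "j < i" "i \<in> I" "j \<in> I" "unit (c i * z ^ i / (c j * z ^ j))" for i j
    proof -
      have "c i * z ^ i / (c j * z ^ j) = z ^ (i - j) * (c i / c j)"
        using h z by (simp add: field_simps power_diff I_def)
      moreover have e: "c i / c j \<in> L" "c i / c j \<noteq> 0"
        using h c by (auto simp: I_def intro: L_closed)
      then obtain n where n: "unit (c i / c j * \<pi> powi n)" using \<pi>(3) by blast
      ultimately have "unit (z ^ (i - j) * (c i / c j))" using h(4) by metis
      from unit_divide[OF this n]
      have "unit (z ^ (i - j) * (c i / c j) / (c i / c j * \<pi> powi n))" .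
      moreover have "z ^ (i - j) * (c i / c j) / (c i / c j * \<pi> powi n) = z ^ (i - j) * \<pi> powi (- n)"
        using nonzero_mult_divide_mult_cancel_left[OF e(2), of "z ^ (i - j)" "\<pi> powi n"]
        by (simp only: power_int_minus divide_inverse[of _ "\<pi> powi n"] mult.commute)
      ultimately have u: "unit (z ^ (i - j) * \<pi> powi (- n))" by simp
      have "(i - j) dvd fact m" using h by (intro dvd_fact) (auto simp: I_def)
      then obtain r where r: "fact m = (i - j) * r" by (rule dvdE)
      have "unit ((z ^ (i - j) * \<pi> powi (- n)) ^ r)" using u by (rule unit_power)
      also have "(z ^ (i - j) * \<pi> powi (- n)) ^ r = z ^ fact m * \<pi> powi (- n * int r)"
        using power_int_power'[of \<pi> "- n" r] by (simp add: r power_mult_distrib power_mult)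
      finally show ?thesis by blast
    qed
    show "\<exists>n::int. unit (z ^ fact m * \<pi> powi n)"
      using *[of i j] *[of j i] ij unit_inverse[OF ij(4)] by (cases i j rule: linorder_cases) auto
  qed simp
  then show ?thesis by unfold_locales
qed

end

subsection \<open>Places of a Kummer extension of the rational function field\<close>

context rational_subfield
begin

text \<open>A nonconstant polynomial has no inverse in the ring of polynomials. That ring is taken
  inside the large field, so the place found is already one of that field and need not be extended
  from K(x).\<close>

lemma place_over_polynomial:
  assumes "degree p > 0"
  obtains P where "P \<in> places \<iota>" "ev p \<in> P" "x \<in> place_ring P"
proof -
  have S: "subring_over \<iota> (range ev)"
    unfolding subring_over_def
  proof (intro conjI ballI)
    show "range \<iota> \<subseteq> range ev" using ev_simps(5) by (metis image_subsetI rangeI)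
  next
    fix a b assume "a \<in> range ev" "b \<in> range ev"
    then show "a - b \<in> range ev" "a * b \<in> range ev" by (auto simp flip: ev_simps(2,3))
  qed
  have "inverse (ev p) \<notin> range ev"
  proof
    assume "inverse (ev p) \<in> range ev"
    then obtain q where q: "inverse (ev p) = ev q" by blast
    have p: "p \<noteq> 0" using assms by auto
    then have "ev (p * q) = ev 1" unfolding ev_simps(3) q[symmetric] by simp
    then have "ev (p * q - 1) = 0" by (simp add: ev_simps(2))
    then have pq: "p * q = 1" by (simp only: ev_eq_0_iff right_minus_eq)
    then have "p dvd 1" by (metis dvd_triv_left)
    then show False using assms by (simp add: is_unit_iff_degree[OF p])
  qed
  moreover have "ev p \<noteq> 0" using assms by auto
  ultimately obtain P where "P \<in> places \<iota>" "ev p \<in> P" "range ev \<subseteq> place_ring P"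
    using exists_place_containing[OF S] by blast
  moreover have "x = ev [:0, 1:]" by (simp add: ev_simps)
  then have "x \<in> range ev" by (rule range_eqI)
  ultimately show ?thesis using that by blast
qed

lemma infinite_place:
  obtains P where "P \<in> places \<iota>" "inverse x \<in> P"
proof -
  \<comment> \<open>The local ring of K(x) at infinity, where 1/x is a nonunit.\<close>
  define S where "S = {ev f / ev g | f g. g \<noteq> 0 \<and> degree f \<le> degree g}"
  have S: "subring_over \<iota> S"
    unfolding subring_over_def
  proof (intro conjI ballI)
    have "\<iota> c = ev [:c:] / ev 1 \<and> (1::'k poly) \<noteq> 0 \<and> degree [:c:] \<le> degree (1::'k poly)" for c
      by (simp add: ev_simps(5))
    then show "range \<iota> \<subseteq> S" unfolding S_def by blast
  next
    fix a b assume "a \<in> S" "b \<in> S"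
    then obtain f g h k where *: "g \<noteq> 0" "a = ev f / ev g" "k \<noteq> 0" "b = ev h / ev k"
      "degree f \<le> degree g" "degree h \<le> degree k" unfolding S_def by blast
    have "a - b = ev (f * k - h * g) / ev (g * k)" "a * b = ev (f * h) / ev (g * k)"
      using *(1,3) unfolding *(2,4) ev_simps by (simp_all add: diff_frac_eq)
    moreover have "g * k \<noteq> 0" "degree (f * k - h * g) \<le> degree (g * k)" "degree (f * h) \<le> degree (g * k)"
      using * degree_mult_le[of f k] degree_mult_le[of h g] degree_mult_le[of f h]
      by (auto simp: degree_mult_eq intro!: degree_diff_le)
    ultimately show "a - b \<in> S" "a * b \<in> S" unfolding S_def by blast+
  qed
  have "inverse x = ev 1 / ev [:0, 1:]" by (simp add: ev_simps divide_inverse)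
  then have 1: "inverse x \<in> S" unfolding S_def by (intro CollectI exI[of _ 1] exI[of _ "[:0, 1:]"]) simp
  have 2: "inverse (inverse x) \<notin> S"
  proof
    assume "inverse (inverse x) \<in> S"
    then obtain f g where fg: "g \<noteq> 0" "x = ev f / ev g" "degree f \<le> degree g" by (auto simp: S_def)
    then have "x * ev g = ev f" using ev_eq_0_iff nonzero_eq_divide_eq by metis
    then have "ev ([:0, 1:] * g - f) = 0"
      unfolding ev_simps(2,3) by (simp add: ev_simps)
    then have "[:0, 1:] * g = f" by (simp only: ev_eq_0_iff right_minus_eq)
    then have "degree f = Suc (degree g)" using fg(1) by (auto simp: degree_mult_eq)
    then show False using fg(3) by simp
  qed
  obtain P where "P \<in> places \<iota>" "inverse x \<in> P"
    using exists_place_containing[OF S 1 _ 2] x_nonzero by (metis nonzero_imp_inverse_nonzero)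
  then show ?thesis using that by blast
qed

text \<open>The Euclidean algorithm with the cofactors carried along, so that a fraction in lowest
  terms comes with a witness of coprimality.\<close>

lemma poly_bezout:
  fixes p q :: "'k poly"
  assumes "q \<noteq> 0"
  obtains r a b p' q' where "r = a * p + b * q" "p = r * p'" "q = r * q'"
proof -
  have "\<exists>r a b p' q'. r = a * p + b * q \<and> p = r * p' \<and> q = r * q'"
  proof (induction "degree q" arbitrary: p q rule: less_induct)
    case less
    show ?case
    proof (cases "q = 0 \<or> p mod q = 0")
      case True
      then show ?thesis
      proof
        assume "q = 0"
        then show ?thesis by (intro exI[of _ p] exI[of _ 1] exI[of _ 0]) auto
      next
        assume "p mod q = 0"
        then obtain s where "p = q * s" by (metis mod_eq_0_iff_dvd dvdE)
        then show ?thesis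
          by (intro exI[of _ q] exI[of _ 0] exI[of _ 1] exI[of _ s] exI[of _ 1]) simp
      qed
    next
      case False
      have *: "p = (p div q) * q + p mod q" by simp
      have "degree (p mod q) < degree q"
        using False degree_mod_less'[of q p] by blast
      from less[OF this, of q] obtain r a b q' s where
        r: "r = a * q + b * (p mod q)" "q = r * q'" "p mod q = r * s" by blast
      have "r = b * p + (a - b * (p div q)) * q"
        using r(1) by (simp add: algebra_simps minus_div_mult_eq_mod[symmetric])
      moreover have "p = r * ((p div q) * q' + s)"
        using * r(2,3) by (metis distrib_left mult.left_commute)
      ultimately show ?thesis using r(2) by blast
    qed
  qed
  then show ?thesis using that by blast
qed

text \<open>Write G in lowest terms as N'/D' with a N' + b D' = 1. At a place where a nonconstant D'
  vanishes, regularity of G makes N' vanish as well, and 1 would lie in the place.\<close>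

lemma regular_imp_polynomial:
  assumes G: "G \<in> L" and reg: "\<And>P. P \<in> places \<iota> \<Longrightarrow> x \<in> place_ring P \<Longrightarrow> G \<in> place_ring P"
  obtains g where "G = ev g"
proof -
  obtain N D where ND: "D \<noteq> 0" "G = ev N / ev D" using L_E G by blast
  obtain r a b N' D' where r: "r = a * N + b * D" "N = r * N'" "D = r * D'"
    using poly_bezout[OF ND(1)] by blast
  have nz: "r \<noteq> 0" "D' \<noteq> 0" using r ND by auto
  then have G': "G * ev D' = ev N'" using ND(2) r(2,3) by (simp add: ev_simps)
  have "r * (a * N' + b * D') = a * (r * N') + b * (r * D')" by (simp add: algebra_simps)
  also have "\<dots> = r * 1" using r by simp
  finally have "r * (a * N' + b * D') = r * 1" .
  then have one: "a * N' + b * D' = 1" using nz by (metis mult_left_cancel)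
  have "degree D' = 0"
  proof (rule ccontr)
    assume "degree D' \<noteq> 0"
    then obtain P where P: "P \<in> places \<iota>" "ev D' \<in> P" "x \<in> place_ring P"
      using place_over_polynomial by blast
    then interpret rational_place \<iota> x P by unfold_locales
    have "ev N' \<in> P"
      using mult_in_place[OF P(2) reg[OF P(1,3)]] G' by (simp add: mult.commute)
    then have "ev a * ev N' + ev b * ev D' \<in> P"
      using P ev_in by (auto simp: mult.commute[of "ev a"] mult.commute[of "ev b"] intro!: add_in_place mult_in_place)
    moreover have "ev a * ev N' + ev b * ev D' = 1"
      using arg_cong[OF one, of ev] unfolding ev_simps(1,3) by simp
    ultimately show False using one_notin_place by simp
  qed
  then obtain k where k: "D' = [:k:]" "k \<noteq> 0" using nz degree_eq_zeroE by blast
  have "G * \<iota> k = ev N'" using G' k(1) by (simp add: ev_simps(5))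
  moreover have "G = G * \<iota> k * \<iota> (inverse k)" using k(2) by (simp add: hom_inverse mult.assoc)
  ultimately have "G = ev N' * \<iota> (inverse k)" by simp
  then have "G = ev (N' * [:inverse k:])" unfolding ev_simps(3,5) .
  then show ?thesis using that by blast
qed

end

section \<open>Kummer extensions with a radicand split into linear factors\<close>

locale kummer_extension = rational_subfield \<iota> x
  for \<iota> :: "'k::field \<Rightarrow> 'f::field" and x :: 'f +
  fixes y :: 'f and m :: nat and Z :: "'k set" and \<mu> :: "'k \<Rightarrow> nat" and \<epsilon> :: 'k
  assumes m_pos: "m > 0" and finite_Z: "finite Z" and \<epsilon>: "\<epsilon> \<noteq> 0"
    and kummer_eq: "y ^ m = \<iota> \<epsilon> * (\<Prod>a\<in>Z. (x - \<iota> a) ^ \<mu> a)"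
    and adjoin_UNIV: "adjoin \<iota> {x, y} = UNIV"
begin

lemma kummer_nonzero: "\<iota> \<epsilon> * (\<Prod>a\<in>Z. (x - \<iota> a) ^ \<mu> a) \<noteq> 0"
  using \<epsilon> finite_Z by simp

lemma y_nonzero: "y \<noteq> 0" using kummer_nonzero kummer_eq m_pos by (metis power_eq_0_iff)

sublocale radical_extension \<iota> x y m
proof
  show "y ^ m \<in> L" unfolding kummer_eq
    by (intro L_closed const_in_L x_in_L)
qed (use m_pos y_nonzero adjoin_UNIV in auto)

end

locale kummer_place = kummer_extension \<iota> x y m Z \<mu> \<epsilon>
  for \<iota> :: "'k::field \<Rightarrow> 'f::field" and x y :: 'f and m :: nat and Z :: "'k set"
    and \<mu> :: "'k \<Rightarrow> nat" and \<epsilon> :: 'k +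
  fixes P :: "'f set"
  assumes P: "P \<in> places \<iota>"
begin

sublocale rational_place \<iota> x P using P by unfold_locales

sublocale discrete_place \<iota> P using place_discrete[OF P] .

text \<open>The Kummer equation determines only \<open>m\<close> times the value of
  \<open>Y\<close>; later estimates are multiplied by \<open>m\<close> so that ramification need not
  be known.\<close>

lemma val_Y: "int m * v Y = - (\<Sum>a\<in>Z. int (\<mu> a) * v (x - \<iota> a))"
proof -
  have "v (y ^ m) = int m * v y" using y_nonzero by (rule val_power)
  moreover have "v (y ^ m) = (\<Sum>a\<in>Z. int (\<mu> a) * v (x - \<iota> a))"
    unfolding kummer_eq using \<epsilon> finite_Z by (simp add: val_mult val_const val_prod val_power)
  moreover have "v Y = - v y" unfolding Y_def using y_nonzero by (rule val_inverse)
  ultimately show ?thesis by simp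
qed

lemma val_powi_prod: "v (\<Prod>a\<in>Z. (x - \<iota> a) powi e a) = (\<Sum>a\<in>Z. e a * v (x - \<iota> a))"
  using finite_Z by (simp add: val_prod val_powi power_int_eq_0_iff)

text \<open>Together with \<open>sum_elsewhere\<close> and \<open>sum_infinite\<close> this covers
  all places: those over a point of \<open>Z\<close>, the remaining finite ones, and those at
  infinity.\<close>

lemma sum_at_zero:
  assumes "x - \<iota> a \<in> P" "a \<in> Z"
  shows "(\<Sum>b\<in>Z. f b * v (x - \<iota> b)) = f a * v (x - \<iota> a)"
proof -
  have "v (x - \<iota> b) = 0" if "b \<noteq> a" for b
    using other_unit[OF assms(1) that] val_unit_iff by simp
  then have "(\<Sum>b\<in>Z. f b * v (x - \<iota> b)) = (\<Sum>b\<in>Z. if b = a then f a * v (x - \<iota> a) else 0)"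
    by (intro sum.cong) auto
  then show ?thesis using assms finite_Z by simp
qed

lemma sum_elsewhere:
  assumes "x \<in> O\<^sub>P" "\<And>a. a \<in> Z \<Longrightarrow> x - \<iota> a \<notin> P"
  shows "(\<Sum>b\<in>Z. f b * v (x - \<iota> b)) = 0"
proof -
  have "v (x - \<iota> b) = 0" if "b \<in> Z" for b
    using assms(2)[OF that] unit_or_place diff_in[OF assms(1) const_in] val_unit_iff[OF x_minus_const_nonzero] by blast
  then show ?thesis by simp
qed

lemma val_ev_infinite:
  assumes "x \<notin> O\<^sub>P" "p \<noteq> 0"
  shows "v (ev p) = - int (degree p) * v (inverse x)"
proof -
  have "v (ev p * inverse x ^ degree p) = 0"
    using infinite_unit[OF assms] val_unit_iff unit_nonzero by blast
  then show ?thesis using assms by (simp add: val_mult val_power)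
qed

text \<open>At infinity all factors x - b have the same pole order, so only the total degree
  counts.\<close>

lemma sum_infinite:
  assumes "x \<notin> O\<^sub>P"
  shows "(\<Sum>b\<in>Z. f b * v (x - \<iota> b)) = - (\<Sum>b\<in>Z. f b) * v (inverse x)"
proof -
  have "v (x - \<iota> b) = - v (inverse x)" for b
    using val_ev_infinite[OF assms, of "[:- b, 1:]", unfolded ev_simps(6)] by simp
  then show ?thesis by (simp add: sum_distrib_right sum_negf)
qed

lemma val_at_zero:
  assumes "x - \<iota> a \<in> P" "poly g a \<noteq> 0" "poly h a \<noteq> 0"
  shows "v ((x - \<iota> a) powi n * (ev g / ev h)) = n * v (x - \<iota> a)"
proof -
  have u: "unit (ev g / ev h)" using ev_unit[OF assms(1)] assms(2,3) unit_divide by blast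
  then have "v (ev g / ev h) = 0" "ev g / ev h \<noteq> 0" using val_unit_iff unit_nonzero by blast+
  then show ?thesis using val_mult[of "(x - \<iota> a) powi n" "ev g / ev h"] by (simp add: val_powi power_int_eq_0_iff)
qed

lemma val_x_minus_pos: "x - \<iota> a \<in> P \<Longrightarrow> v (x - \<iota> a) > 0"
  using val_place_iff[OF x_minus_const_nonzero] by blast

lemma val_inverse_x_pos: "x \<notin> O\<^sub>P \<Longrightarrow> v (inverse x) > 0"
  using infinite_inverse_x val_place_iff by simp

end

section \<open>Total ramification over a simple zero of the radicand\<close>

locale ramified_place = kummer_place \<iota> x y m Z \<mu> \<epsilon> P
  for \<iota> :: "'k::field \<Rightarrow> 'f::field" and x y :: 'f and m :: nat and Z :: "'k set"
    and \<mu> :: "'k \<Rightarrow> nat" and \<epsilon> :: 'k and P :: "'f set" +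
  fixes a :: 'k
  assumes a: "a \<in> Z" "\<mu> a = 1" and over_a: "x - \<iota> a \<in> P"
begin

lemma val_x_minus_eq: "v (x - \<iota> a) = - int m * v Y"
  using val_Y sum_at_zero[OF over_a a(1), of "\<lambda>b. int (\<mu> b)"] a by simp

lemma L_val: "c \<in> L \<Longrightarrow> c \<noteq> 0 \<Longrightarrow> \<exists>n. v c = - int m * n * v Y"
  using L_order_at[of c a] val_at_zero[OF over_a] val_x_minus_eq by (metis mult.assoc mult.commute)

lemma val_Y_neg: "v Y < 0"
  using val_x_minus_pos[OF over_a] val_x_minus_eq m_pos by (simp add: mult_less_0_iff zero_less_mult_iff)

text \<open>Rational functions have values divisible by \<open>m * v Y\<close>, so the value of
  \<open>c i * Y ^ i\<close> determines \<open>i\<close> modulo \<open>m\<close>.\<close>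

lemma val_terms_inj:
  assumes c: "\<And>i. i < m \<Longrightarrow> c i \<in> L"
  shows "inj_on (\<lambda>i. v (c i * Y ^ i)) {i. i < m \<and> c i \<noteq> 0}"
proof (rule inj_onI)
  fix i j assume i: "i \<in> {i. i < m \<and> c i \<noteq> 0}" and j: "j \<in> {i. i < m \<and> c i \<noteq> 0}"
    and eq: "v (c i * Y ^ i) = v (c j * Y ^ j)"
  obtain n k where n: "v (c i) = - int m * n * v Y" and k: "v (c j) = - int m * k * v Y"
    using L_val c i j by (metis (mono_tags, lifting) mem_Collect_eq)
  have "(int i - int m * n) * v Y = (int j - int m * k) * v Y"
    using eq i j n k by (simp add: val_mult val_power algebra_simps)
  then have "int i - int m * n = int j - int m * k" using val_Y_neg by simp
  then have "int i mod int m = int j mod int m" by (metis mod_mult_self2 diff_add_cancel mult.commute mod_mult_self1 diff_conv_add_uminus mult_minus_right)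
  then show "i = j" using i j by simp
qed

lemma val_expansion:
  assumes c: "\<And>i. i < m \<Longrightarrow> c i \<in> L" and ex: "\<exists>i<m. c i \<noteq> 0"
  defines "z \<equiv> \<Sum>i<m. c i * Y ^ i"
  shows "z \<noteq> 0" "\<exists>i<m. c i \<noteq> 0 \<and> v z = v (c i * Y ^ i)"
    "\<And>i. i < m \<Longrightarrow> c i \<noteq> 0 \<Longrightarrow> v z \<le> v (c i * Y ^ i)"
proof -
  let ?I = "{i. i < m \<and> c i \<noteq> 0}"
  have z: "z = (\<Sum>i\<in>?I. c i * Y ^ i)"
    unfolding z_def by (rule sum.mono_neutral_right) auto
  have "sum (\<lambda>i. c i * Y ^ i) ?I \<noteq> 0 \<and> (\<exists>i\<in>?I. v (sum (\<lambda>i. c i * Y ^ i) ?I) = v (c i * Y ^ i))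
    \<and> (\<forall>i\<in>?I. v (sum (\<lambda>i. c i * Y ^ i) ?I) \<le> v (c i * Y ^ i))"
    by (rule val_sum_distinct) (use ex val_terms_inj[OF c] in auto)
  then show "z \<noteq> 0" "\<exists>i<m. c i \<noteq> 0 \<and> v z = v (c i * Y ^ i)"
    "\<And>i. i < m \<Longrightarrow> c i \<noteq> 0 \<Longrightarrow> v z \<le> v (c i * Y ^ i)"
    unfolding z by auto
qed

text \<open>An element of value 1 shares its value with a term of its expansion, and values of terms
  are multiples of \<open>v Y\<close>.\<close>

lemma val_Y_eq: "v Y = - 1"
proof -
  obtain t where t: "t \<noteq> 0" "v t = 1" by (rule val_surj)
  obtain c where c: "\<And>i. i < m \<Longrightarrow> c i \<in> L" "t = (\<Sum>i<m. c i * Y ^ i)"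
    using B_E[of t] B_UNIV by blast
  have ex: "\<exists>i<m. c i \<noteq> 0" using t(1) c(2) by (metis (mono_tags, lifting) lessThan_iff mult_zero_left sum.neutral)
  then obtain i where i: "i < m" "c i \<noteq> 0" "v t = v (c i * Y ^ i)"
    using val_expansion(2)[OF c(1) ex] unfolding c(2)[symmetric] by blast
  obtain n where n: "v (c i) = - int m * n * v Y" using L_val c(1) i by blast
  have "1 = (int i - int m * n) * v Y"
    using i n t(2) by (simp add: val_mult val_power algebra_simps)
  then have "v Y dvd 1" by (metis dvd_triv_right)
  then show ?thesis using val_Y_neg by (auto simp: zdvd1_eq)
qed

lemma val_x_minus: "v (x - \<iota> a) = int m"
  using val_x_minus_eq val_Y_eq by simp

lemma val_term:
  assumes "poly g a \<noteq> 0" "poly h a \<noteq> 0"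
  shows "v ((x - \<iota> a) powi n * (ev g / ev h) * Y ^ i) = int m * n - int i"
proof -
  have "ev g / ev h \<noteq> 0" using assms by auto
  then show ?thesis
    using val_mult[of "(x - \<iota> a) powi n * (ev g / ev h)" "Y ^ i"] val_at_zero[OF over_a assms, of n]
    by (simp only: val_x_minus val_Y_eq val_power[OF Y_nonzero]) (simp add: power_int_eq_0_iff)
qed

lemma val_term_unique:
  assumes "ramified_place \<iota> x y m Z \<mu> \<epsilon> P' a" "c \<in> L" "c \<noteq> 0"
  shows "place_val P' (c * Y ^ i) = v (c * Y ^ i)"
proof -
  interpret P': ramified_place \<iota> x y m Z \<mu> \<epsilon> P' a by fact
  obtain n g h where "c = (x - \<iota> a) powi n * (ev g / ev h)" "poly g a \<noteq> 0" "poly h a \<noteq> 0"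
    using L_order_at[OF assms(2,3)] by metis
  then show ?thesis using val_term P'.val_term by simp
qed

text \<open>Each term has the same value at both places. At one place the value of \<open>z\<close>
  is that of some term, at the other it is at most that of every term. One inequality suffices, as
  the places can be exchanged.\<close>

lemma val_unique:
  assumes "ramified_place \<iota> x y m Z \<mu> \<epsilon> P' a" "z \<noteq> 0"
  shows "place_val P' z \<le> v z"
proof -
  interpret P': ramified_place \<iota> x y m Z \<mu> \<epsilon> P' a by fact
  obtain c where c: "\<And>i. i < m \<Longrightarrow> c i \<in> L" "z = (\<Sum>i<m. c i * Y ^ i)"
    using B_E[of z] B_UNIV by blast
  have ex: "\<exists>i<m. c i \<noteq> 0" using assms(2) c(2) by (metis (mono_tags, lifting) lessThan_iff mult_zero_left sum.neutral)
  then obtain i where i: "i < m" "c i \<noteq> 0" "v z = v (c i * Y ^ i)"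
    using val_expansion(2)[OF c(1) ex] unfolding c(2)[symmetric] by blast
  have "place_val P' (c i * Y ^ i) = v (c i * Y ^ i)"
    using val_term_unique[OF assms(1) c(1)[OF i(1)] i(2)] .
  then show ?thesis using P'.val_expansion(3)[OF c(1) ex i(1,2)] c(2) i(3) by simp
qed

end

lemma (in kummer_extension) ramified_place_unique:
  assumes "ramified_place \<iota> x y m Z \<mu> \<epsilon> P a" "ramified_place \<iota> x y m Z \<mu> \<epsilon> P' a"
  shows "P = P'"
proof -
  interpret P: ramified_place \<iota> x y m Z \<mu> \<epsilon> P a by fact
  interpret P': ramified_place \<iota> x y m Z \<mu> \<epsilon> P' a by fact
  have "place_val P z = place_val P' z" if "z \<noteq> 0" for z
    using P.val_unique[OF assms(2) that] P'.val_unique[OF assms(1) that] by simp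
  then have "z \<in> place_ring P \<longleftrightarrow> z \<in> place_ring P'" for z
    using P.val_nonneg_iff[of z] P'.val_nonneg_iff[of z] by (cases "z = 0") auto
  then show ?thesis using P.in_place_iff P'.in_place_iff by blast
qed

subsection \<open>The Galois action and regularity of the homogeneous components\<close>

text \<open>The assumptions on \<open>m\<close> provide a group of \<open>m\<close> roots of unity
  that acts by scaling \<open>Y\<close>, and allow division by its order. A simple zero provides a
  totally ramified place, from which linear independence of the powers of \<open>Y\<close> is read
  off.\<close>

locale kummer_galois = kummer_extension \<iota> x y m Z \<mu> \<epsilon>
  for \<iota> :: "'k::field \<Rightarrow> 'f::field" and x y :: 'f and m :: nat and Z :: "'k set"
    and \<mu> :: "'k \<Rightarrow> nat" and \<epsilon> :: 'k +
  assumes char_m: "of_nat m \<noteq> (0 :: 'k)" and card_roots: "card {u :: 'k. u ^ m = 1} = m"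
    and simple_zero: "\<exists>a\<in>Z. \<mu> a = 1"
begin

definition U :: "'k set" where "U = {u. u ^ m = 1}"

lemma U_nonzero: "u \<in> U \<Longrightarrow> u \<noteq> 0" using m_pos by (auto simp: U_def power_0_left)

lemma U_mult: "u \<in> U \<Longrightarrow> w \<in> U \<Longrightarrow> u * w \<in> U" by (simp add: U_def power_mult_distrib)

lemma U_inverse: "u \<in> U \<Longrightarrow> inverse u \<in> U" by (simp add: U_def power_inverse)

lemma U_power_mod: "u \<in> U \<Longrightarrow> u ^ (i mod m) = u ^ i"
proof -
  assume u: "u \<in> U"
  have "u ^ i = u ^ (m * (i div m) + i mod m)" by simp
  also have "\<dots> = (u ^ m) ^ (i div m) * u ^ (i mod m)" by (simp only: power_add power_mult)
  finally show ?thesis using u by (simp add: U_def)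
qed

text \<open>Otherwise a nonzero polynomial of degree at most \<open>j - i\<close>, which is less
  than \<open>m\<close>, would have all \<open>m\<close> roots of unity as zeros.\<close>

lemma U_separates:
  assumes "i < j" "j < m" obtains u where "u \<in> U" "u ^ i \<noteq> u ^ j"
proof -
  have "\<not> U \<subseteq> {u. poly (monom 1 (j - i) - 1) u = 0}" (is "\<not> U \<subseteq> ?R")
  proof
    assume sub: "U \<subseteq> ?R"
    define p :: "'k poly" where "p = monom 1 (j - i) - 1"
    have "coeff p (j - i) = 1" using assms by (simp add: p_def coeff_diff)
    then have p: "p \<noteq> 0" by auto
    have "degree p \<le> j - i" unfolding p_def by (intro degree_diff_le) (auto simp: degree_monom_le)
    moreover have "card U \<le> card {u. poly p u = 0}"
      using sub poly_roots_finite[OF p] unfolding p_def by (intro card_mono) auto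
    ultimately have "m \<le> j - i"
      using card_roots card_poly_roots_bound[OF p] by (simp add: U_def)
    then show False using assms by simp
  qed
  then obtain u where u: "u \<in> U" "u ^ (j - i) \<noteq> 1" by (auto simp: poly_monom)
  have "u ^ j = u ^ i * u ^ (j - i)" using assms by (simp flip: power_add)
  then have "u ^ i \<noteq> u ^ j" using u U_nonzero[OF u(1)] by auto
  then show ?thesis using that u by blast
qed

text \<open>Translation by a root of unity \<open>w\<close> that separates \<open>i\<close> and
  \<open>k\<close> permutes the summands, yet multiplies the sum by a factor other than 1.\<close>

lemma character_orthogonality:
  assumes "i < m" "k < m"
  shows "(\<Sum>u\<in>U. inverse u ^ i * u ^ k) = (if i = k then of_nat m else 0)"
proof (cases "i = k")
  case True
  have "(\<Sum>u\<in>U. inverse u ^ i * u ^ k) = (\<Sum>u\<in>U. 1)"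
    using True U_nonzero by (intro sum.cong) (auto simp flip: power_mult_distrib)
  then show ?thesis using True card_roots by (simp add: U_def)
next
  case False
  obtain w where w: "w \<in> U" "w ^ i \<noteq> w ^ k"
    using U_separates[of i k] U_separates[of k i] assms False by (metis linorder_neqE_nat)
  let ?S = "\<Sum>u\<in>U. inverse u ^ i * u ^ k"
  have "?S = (\<Sum>u\<in>U. inverse (w * u) ^ i * (w * u) ^ k)"
    by (rule sum.reindex_bij_witness[of _ "\<lambda>u. w * u" "\<lambda>u. inverse w * u"])
      (use w(1) U_nonzero U_mult U_inverse in \<open>auto simp flip: mult.assoc\<close>)
  also have "\<dots> = (inverse w ^ i * w ^ k) * ?S"
    unfolding sum_distrib_left by (intro sum.cong) (auto simp: power_mult_distrib mult_ac)
  finally have "?S = 0 \<or> inverse w ^ i * w ^ k = 1" by (simp only: mult_cancel_right1)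
  moreover have "inverse w ^ i * w ^ k \<noteq> 1"
    using w U_nonzero[OF w(1)] by (simp add: power_inverse field_simps)
  ultimately show ?thesis using False by simp
qed

lemma ramified_placeI:
  "P \<in> places \<iota> \<Longrightarrow> a \<in> Z \<Longrightarrow> \<mu> a = 1 \<Longrightarrow> x - \<iota> a \<in> P \<Longrightarrow> ramified_place \<iota> x y m Z \<mu> \<epsilon> P a"
  by unfold_locales

lemma exists_ramified_place: "\<exists>P a. ramified_place \<iota> x y m Z \<mu> \<epsilon> P a"
proof -
  obtain a where a: "a \<in> Z" "\<mu> a = 1" using simple_zero by blast
  have "degree [:- a, 1:] > 0" by simp
  then obtain P where "P \<in> places \<iota>" "ev [:- a, 1:] \<in> P"
    by (rule place_over_polynomial)
  then show ?thesis using ramified_placeI a unfolding ev_simps(6) by blast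
qed

text \<open>At a totally ramified place the terms of the difference have distinct values and cannot
  cancel. This takes the place of irreducibility of the Kummer polynomial.\<close>

lemma expansion_unique:
  assumes c: "\<And>i. i < m \<Longrightarrow> c i \<in> L" and d: "\<And>i. i < m \<Longrightarrow> d i \<in> L"
    and eq: "(\<Sum>i<m. c i * Y ^ i) = (\<Sum>i<m. d i * Y ^ i)" and i: "i < m"
  shows "c i = d i"
proof (rule ccontr)
  assume "c i \<noteq> d i"
  then have ex: "\<exists>i<m. c i - d i \<noteq> 0" using i by auto
  obtain P a where "ramified_place \<iota> x y m Z \<mu> \<epsilon> P a" using exists_ramified_place by blast
  then have "(\<Sum>i<m. (c i - d i) * Y ^ i) \<noteq> 0"
    by (rule ramified_place.val_expansion(1)[OF _ _ ex]) (use c d L_closed(3) in blast)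
  then show False using eq by (simp add: left_diff_distrib sum_subtractf)
qed

text \<open>By \<open>expansion_unique\<close> the choice is forced for indices below
  \<open>m\<close>; at all other indices it is arbitrary.\<close>

definition coef :: "'f \<Rightarrow> nat \<Rightarrow> 'f" where
  "coef z = (SOME c. (\<forall>i<m. c i \<in> L) \<and> z = (\<Sum>i<m. c i * Y ^ i))"

lemma coef: "i < m \<Longrightarrow> coef z i \<in> L" "z = (\<Sum>i<m. coef z i * Y ^ i)"
proof -
  have "\<exists>c. (\<forall>i<m. c i \<in> L) \<and> z = (\<Sum>i<m. c i * Y ^ i)"
    using B_E[of z] B_UNIV by blast
  from someI_ex[OF this] show "i < m \<Longrightarrow> coef z i \<in> L" "z = (\<Sum>i<m. coef z i * Y ^ i)"
    unfolding coef_def by auto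
qed

text \<open>The automorphism over K(x) that scales \<open>Y\<close> by \<open>u\<close>. It is
  additive by construction, while multiplicativity holds for \<open>u\<close> in
  \<open>U\<close>.\<close>

definition \<sigma> :: "'k \<Rightarrow> 'f \<Rightarrow> 'f" where
  "\<sigma> u z = (\<Sum>i<m. coef z i * \<iota> (u ^ i) * Y ^ i)"

lemma \<sigma>_expansion:
  assumes "\<And>i. i < m \<Longrightarrow> c i \<in> L"
  shows "\<sigma> u (\<Sum>i<m. c i * Y ^ i) = (\<Sum>i<m. c i * \<iota> (u ^ i) * Y ^ i)"
proof -
  have "coef (\<Sum>i<m. c i * Y ^ i) i = c i" if "i < m" for i
    using expansion_unique[OF coef(1) assms coef(2)[symmetric] that] .
  then show ?thesis unfolding \<sigma>_def by (intro sum.cong) auto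
qed

lemma \<sigma>_diff: "\<sigma> u (a - b) = \<sigma> u a - \<sigma> u b"
proof -
  have "a - b = (\<Sum>i<m. (coef a i - coef b i) * Y ^ i)"
    using coef(2)[of a] coef(2)[of b] by (simp add: left_diff_distrib sum_subtractf)
  then have "\<sigma> u (a - b) = (\<Sum>i<m. (coef a i - coef b i) * \<iota> (u ^ i) * Y ^ i)"
    using \<sigma>_expansion[of "\<lambda>i. coef a i - coef b i" u] coef(1) L_closed(3) by simp
  then show ?thesis by (simp add: \<sigma>_def left_diff_distrib sum_subtractf)
qed

lemma \<sigma>_zero: "\<sigma> u 0 = 0" using \<sigma>_diff[of u 0 0] by simp

lemma \<sigma>_add: "\<sigma> u (a + b) = \<sigma> u a + \<sigma> u b"
  using \<sigma>_diff[of u a "- b"] \<sigma>_diff[of u 0 b] \<sigma>_zero by simp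

lemma \<sigma>_sum: "\<sigma> u (sum f I) = (\<Sum>i\<in>I. \<sigma> u (f i))"
  by (induction I rule: infinite_finite_induct) (simp_all add: \<sigma>_zero \<sigma>_add)

text \<open>Exponents from \<open>m\<close> on are reduced by means of Y^m in \<open>L\<close>,
  which the action fixes; this agrees with the factor \<open>u ^ i\<close> because u^m = 1.
  Multiplicativity of \<open>\<sigma>\<close> rests on it.\<close>

lemma \<sigma>_monomial:
  assumes "u \<in> U" "c \<in> L"
  shows "\<sigma> u (c * Y ^ i) = c * \<iota> (u ^ i) * Y ^ i"
proof -
  define d where "d k = (if k = i mod m then c * (Y ^ m) ^ (i div m) else 0)" for k
  have d: "d k \<in> L" for k using assms Y_pow_m L_closed by (auto simp: d_def)
  have *: "(\<Sum>k<m. d k * f k) = c * (Y ^ m) ^ (i div m) * f (i mod m)" for f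
    using m_pos by (simp add: d_def sum.delta if_distrib[of "\<lambda>u. u * _"] cong: if_cong)
  have Yi: "(Y ^ m) ^ (i div m) * Y ^ (i mod m) = Y ^ i" using monomial_reduce[of i] by simp
  have "\<sigma> u (c * Y ^ i) = \<sigma> u (\<Sum>k<m. d k * Y ^ k)"
    unfolding * by (simp add: mult.assoc Yi)
  also have "\<dots> = (\<Sum>k<m. d k * (\<iota> (u ^ k) * Y ^ k))"
    using \<sigma>_expansion[of d u] d by (simp add: mult.assoc)
  also have "\<dots> = c * ((Y ^ m) ^ (i div m) * Y ^ (i mod m)) * \<iota> (u ^ i)"
    unfolding * by (simp add: U_power_mod[OF assms(1)] mult_ac)
  also have "\<dots> = c * \<iota> (u ^ i) * Y ^ i" unfolding Yi by (simp add: mult_ac)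
  finally show ?thesis .
qed

lemma \<sigma>_L: "u \<in> U \<Longrightarrow> c \<in> L \<Longrightarrow> \<sigma> u c = c"
  using \<sigma>_monomial[of u c 0] by simp

lemma \<sigma>_mult: assumes "u \<in> U" shows "\<sigma> u (a * b) = \<sigma> u a * \<sigma> u b"
proof -
  have "a * b = (\<Sum>i<m. \<Sum>j<m. (coef a i * coef b j) * Y ^ (i + j))"
    by (subst coef(2)[of a], subst coef(2)[of b]) (simp add: sum_product power_add mult_ac)
  then have "\<sigma> u (a * b) = (\<Sum>i<m. \<Sum>j<m. coef a i * coef b j * \<iota> (u ^ (i + j)) * Y ^ (i + j))"
    using assms coef(1) L_closed(4) by (simp add: \<sigma>_sum \<sigma>_monomial)
  also have "\<dots> = \<sigma> u a * \<sigma> u b"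
    unfolding \<sigma>_def sum_product by (simp add: power_add hom_mult mult_ac)
  finally show ?thesis .
qed

lemma \<sigma>_compose:
  assumes "u \<in> U" "w \<in> U" shows "\<sigma> u (\<sigma> w z) = \<sigma> (u * w) z"
proof -
  have "\<sigma> u (\<sigma> w z) = (\<Sum>i<m. coef z i * \<iota> (w ^ i) * \<iota> (u ^ i) * Y ^ i)"
    unfolding \<sigma>_def[of w z] using coef(1) by (intro \<sigma>_expansion L_closed const_in_L)
  then show ?thesis by (simp add: \<sigma>_def power_mult_distrib hom_mult mult_ac)
qed

lemma \<sigma>_one: "\<sigma> 1 z = z"
  using coef(2)[of z] by (simp add: \<sigma>_def)

lemma \<sigma>_inverse:
  assumes "u \<in> U" shows "\<sigma> u (inverse z) = inverse (\<sigma> u z)"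
proof (cases "z = 0")
  case False
  have "\<sigma> u z * \<sigma> u (inverse z) = 1"
    using \<sigma>_mult[OF assms, of z "inverse z"] False \<sigma>_L[OF assms L_closed(2)] by simp
  then show ?thesis using inverse_unique by metis
qed (simp add: \<sigma>_zero)

lemma \<sigma>_inj: assumes "u \<in> U" shows "\<sigma> (inverse u) (\<sigma> u z) = z" "\<sigma> u (\<sigma> (inverse u) z) = z"
  using \<sigma>_compose[OF U_inverse[OF assms] assms, of z] \<sigma>_compose[OF assms U_inverse[OF assms], of z]
    U_nonzero[OF assms] \<sigma>_one by simp_all

lemma conjugate_place:
  assumes u: "u \<in> U" and P: "P \<in> places \<iota>"
  shows "{z. \<sigma> u z \<in> P} \<in> places \<iota>" "place_ring {z. \<sigma> u z \<in> P} = {z. \<sigma> u z \<in> place_ring P}"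
proof -
  interpret function_field_place \<iota> P using P by unfold_locales
  let ?R = "{z. \<sigma> u z \<in> O\<^sub>P}"
  have z0: "\<sigma> u z = 0 \<longleftrightarrow> z = 0" for z using \<sigma>_inj(1)[OF u, of z] \<sigma>_zero by metis
  show ring: "place_ring {z. \<sigma> u z \<in> P} = ?R"
    by (auto simp: place_ring_def \<sigma>_inverse[OF u] z0)
  obtain w where w: "w \<notin> O\<^sub>P" using vring by (auto simp: valuation_ring_def)
  have vr: "valuation_ring \<iota> ?R"
    unfolding valuation_ring_def
  proof (intro conjI ballI allI impI)
    have "range \<iota> \<subseteq> ?R" using \<sigma>_L[OF u const_in_L] const_in by auto
    moreover obtain t where t: "t \<in> O\<^sub>P" "t \<notin> range \<iota>" using vring by (auto simp: valuation_ring_def)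
    have "\<sigma> (inverse u) t \<in> ?R" using \<sigma>_inj(2)[OF u] t by simp
    moreover have "\<sigma> (inverse u) t \<notin> range \<iota>"
    proof
      assume "\<sigma> (inverse u) t \<in> range \<iota>"
      then obtain k where "\<sigma> (inverse u) t = \<iota> k" by blast
      then have "t = \<sigma> u (\<iota> k)" using \<sigma>_inj(2)[OF u, of t] by simp
      then show False using t \<sigma>_L[OF u const_in_L] by simp
    qed
    ultimately show "range \<iota> \<subset> ?R" by blast
    have "\<sigma> (inverse u) w \<notin> ?R" using w \<sigma>_inj(2)[OF u] by simp
    then show "?R \<subset> UNIV" by blast
  next
    fix a b assume "a \<in> ?R" "b \<in> ?R"
    then show "a - b \<in> ?R" "a * b \<in> ?R" by (auto simp: \<sigma>_diff \<sigma>_mult[OF u] intro: diff_in mult_in)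
  next
    fix z :: 'f assume "z \<noteq> 0"
    then show "z \<in> ?R \<or> inverse z \<in> ?R"
      using inverse_in[of "\<sigma> u z"] place_in by (auto simp: \<sigma>_inverse[OF u])
  qed
  have "z \<in> {z. \<sigma> u z \<in> P} \<longleftrightarrow> z \<in> ?R \<and> \<not> (\<exists>w\<in>?R. z * w = 1)" for z
  proof -
    have "(\<exists>w\<in>?R. z * w = 1) \<longleftrightarrow> z \<noteq> 0 \<and> inverse z \<in> ?R"
      by (metis inverse_unique mult_zero_left right_inverse zero_neq_one)
    then show ?thesis using in_place_iff[of "\<sigma> u z"] by (auto simp: \<sigma>_inverse[OF u] z0)
  qed
  then show "{z. \<sigma> u z \<in> P} \<in> places \<iota>"
    unfolding places_iff ring using vr by blast
qed

text \<open>The Galois group fixes each totally ramified place, so it permutes the remaining ones; averaging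
  the conjugates of \<open>z\<close> against a character isolates a single component.\<close>

lemma component_regular:
  assumes S: "\<And>P. P \<in> S \<Longrightarrow> \<exists>a. ramified_place \<iota> x y m Z \<mu> \<epsilon> P a"
    and reg: "\<And>P. P \<in> places \<iota> \<Longrightarrow> P \<notin> S \<Longrightarrow> z \<in> place_ring P"
    and P: "P \<in> places \<iota>" "P \<notin> S" and i: "i < m"
  shows "coef z i * Y ^ i \<in> place_ring P"
proof -
  interpret function_field_place \<iota> P using P by unfold_locales
  have conj: "\<sigma> u z \<in> O\<^sub>P" if u: "u \<in> U" for u
  proof -
    let ?P = "{z. \<sigma> u z \<in> P}"
    have "?P \<notin> S"
    proof
      assume "?P \<in> S"
      then obtain a where r: "ramified_place \<iota> x y m Z \<mu> \<epsilon> ?P a" using S by blast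
      then interpret r: ramified_place \<iota> x y m Z \<mu> \<epsilon> ?P a .
      have "x - \<iota> a \<in> L" by (intro L_closed x_in_L const_in_L)
      then have "x - \<iota> a \<in> P" using r.over_a \<sigma>_L[OF u] by simp
      then have "ramified_place \<iota> x y m Z \<mu> \<epsilon> P a" using ramified_placeI P r.a by blast
      then have "P = ?P" using ramified_place_unique r by blast
      then show False using P \<open>?P \<in> S\<close> by simp
    qed
    then have "z \<in> place_ring ?P" using reg conjugate_place(1)[OF u P(1)] by blast
    then show ?thesis using conjugate_place(2)[OF u P(1)] by simp
  qed
  have "(\<Sum>u\<in>U. \<iota> (inverse u ^ i) * \<sigma> u z) = (\<Sum>u\<in>U. \<Sum>k<m. coef z k * Y ^ k * \<iota> (inverse u ^ i * u ^ k))"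
    unfolding \<sigma>_def sum_distrib_left by (simp add: hom_mult mult_ac)
  also have "\<dots> = (\<Sum>k<m. coef z k * Y ^ k * \<iota> (\<Sum>u\<in>U. inverse u ^ i * u ^ k))"
    by (subst sum.swap) (simp add: sum_distrib_left hom_sum)
  also have "\<dots> = (\<Sum>k<m. if k = i then coef z i * Y ^ i * \<iota> (of_nat m) else 0)"
    by (intro sum.cong) (use i character_orthogonality in auto)
  also have "\<dots> = coef z i * Y ^ i * \<iota> (of_nat m)" using i by simp
  finally have *: "(\<Sum>u\<in>U. \<iota> (inverse u ^ i) * \<sigma> u z) = coef z i * Y ^ i * \<iota> (of_nat m)" .
  have "coef z i * Y ^ i = (\<Sum>u\<in>U. \<iota> (inverse u ^ i) * \<sigma> u z) * \<iota> (inverse (of_nat m))"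
    unfolding * using char_m by (simp add: hom_inverse mult.assoc)
  also have "\<dots> \<in> O\<^sub>P" by (intro mult_in sum_in const_in conj)
  finally show ?thesis .
qed

end

subsection \<open>Weierstrass semigroups at totally ramified places\<close>

text \<open>Without repetitions in the list, the sum in \<open>divisor_of\<close> has a single
  contribution at each entry, so the equality splits into conditions at the chosen places and
  regularity elsewhere.\<close>

lemma pole_divisor_eq_iff:
  assumes Rs: "distinct Rs" "set Rs \<subseteq> places \<iota>"
  shows "pole_divisor \<iota> z = divisor_of Rs ns \<longleftrightarrow>
    (\<forall>k<length Rs. max 0 (- place_val (Rs ! k) z) = int (ns ! k)) \<and>
    (\<forall>P\<in>places \<iota> - set Rs. 0 \<le> place_val P z)"
proof -
  have at: "divisor_of Rs ns (Rs ! k) = int (ns ! k)" if "k < length Rs" for k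
  proof -
    have "divisor_of Rs ns (Rs ! k) = (\<Sum>l<length Rs. if l = k then int (ns ! k) else 0)"
      unfolding divisor_of_def
      by (intro sum.cong) (use that Rs in \<open>auto simp: nth_eq_iff_index_eq\<close>)
    then show ?thesis using that by simp
  qed
  have off: "divisor_of Rs ns P = 0" if "P \<notin> set Rs" for P
    unfolding divisor_of_def by (intro sum.neutral) (use that in auto)
  show ?thesis
  proof
    assume eq: "pole_divisor \<iota> z = divisor_of Rs ns"
    have "max 0 (- place_val (Rs ! k) z) = int (ns ! k)" if "k < length Rs" for k
      using fun_cong[OF eq, of "Rs ! k"] at[OF that] Rs(2) nth_mem[OF that] by (auto simp: pole_divisor_def)
    moreover have "0 \<le> place_val P z" if "P \<in> places \<iota> - set Rs" for P
      using fun_cong[OF eq, of P] off[of P] that by (auto simp: pole_divisor_def max_def split: if_splits)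
    ultimately show "(\<forall>k<length Rs. max 0 (- place_val (Rs ! k) z) = int (ns ! k)) \<and>
      (\<forall>P\<in>places \<iota> - set Rs. 0 \<le> place_val P z)" by blast
  next
    assume R: "(\<forall>k<length Rs. max 0 (- place_val (Rs ! k) z) = int (ns ! k)) \<and>
      (\<forall>P\<in>places \<iota> - set Rs. 0 \<le> place_val P z)"
    show "pole_divisor \<iota> z = divisor_of Rs ns"
    proof
      fix P
      consider k where "k < length Rs" "P = Rs ! k" | "P \<notin> set Rs" by (metis in_set_conv_nth)
      then show "pole_divisor \<iota> z P = divisor_of Rs ns P"
      proof cases
        case 1
        then have "P \<in> places \<iota>" using Rs(2) by auto
        then show ?thesis using R at[OF 1(1)] 1 by (simp add: pole_divisor_def)
      next
        case 2
        then have "P \<in> places \<iota> \<Longrightarrow> 0 \<le> place_val P z" using R by blast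
        then show ?thesis using off[OF 2] by (auto simp: pole_divisor_def)
      qed
    qed
  qed
qed

lemma le_div_iff_mult_le:
  fixes k l n :: int
  assumes "l > 0" shows "n \<le> k div l \<longleftrightarrow> n * l \<le> k"
proof
  assume "n \<le> k div l"
  then have "n * l \<le> k div l * l" using assms by (intro mult_right_mono) auto
  also have "\<dots> \<le> k" using assms pos_mod_sign[of l k] by (simp add: minus_mod_eq_div_mult[symmetric])
  finally show "n * l \<le> k" .
next
  assume "n * l \<le> k"
  then show "n \<le> k div l" using zdiv_mono1[of "n * l" k l] assms by simp
qed

text \<open>The ceiling of k/l. Through \<open>ceil_div_le_iff\<close> and
  \<open>le_div_iff_mult_le\<close>, ceilings and floors are used only by their adjunctions with
  multiplication.\<close>

definition ceil_div :: "int \<Rightarrow> int \<Rightarrow> int" where "ceil_div k l = - ((- k) div l)"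

lemma ceil_div_le_iff: "l > 0 \<Longrightarrow> ceil_div k l \<le> n \<longleftrightarrow> k \<le> l * n"
  using le_div_iff_mult_le[of l "- n" "- k"]
  by (auto simp: ceil_div_def mult.commute minus_le_iff)

lemma mult_ceil_div_ge: "l > 0 \<Longrightarrow> k \<le> l * ceil_div k l"
  using ceil_div_le_iff by blast

context kummer_place
begin

lemma val_L_at_zero:
  assumes "x - \<iota> a \<in> P" "c \<in> L" "c \<noteq> 0" obtains n where "v c = n * v (x - \<iota> a)"
  using L_order_at[OF assms(2,3), of a] val_at_zero[OF assms(1)] by metis

lemma val_times_Y_power:
  assumes "c \<noteq> 0"
  shows "int m * v (c * Y ^ i) = int m * v c - (\<Sum>a\<in>Z. (int i * int (\<mu> a)) * v (x - \<iota> a))"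
proof -
  have "int m * v (c * Y ^ i) = int m * v c + int i * (int m * v Y)"
    using assms by (simp add: val_mult val_power algebra_simps)
  then show ?thesis unfolding val_Y by (simp add: sum_distrib_left mult.assoc)
qed

lemma val_times_powi_prod:
  assumes "c \<noteq> 0"
  shows "v (c * (\<Prod>a\<in>Z. (x - \<iota> a) powi e a)) = v c + (\<Sum>a\<in>Z. e a * v (x - \<iota> a))"
  using assms finite_Z val_mult[OF assms, of "\<Prod>a\<in>Z. (x - \<iota> a) powi e a"] val_powi_prod
  by (simp add: power_int_eq_0_iff)

end

text \<open>The list fixes the order of the components. Tuples are written \<open>map N as\<close>
  with \<open>N\<close> a function on points, so that sums over components become sums over
  \<open>set as\<close>.\<close>

locale ramified_places = kummer_galois \<iota> x y m Z \<mu> \<epsilon>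
  for \<iota> :: "'k::field \<Rightarrow> 'f::field" and x y :: 'f and m :: nat and Z :: "'k set"
    and \<mu> :: "'k \<Rightarrow> nat" and \<epsilon> :: 'k +
  fixes as :: "'k list" and R :: "'k \<Rightarrow> 'f set"
  assumes distinct_as: "distinct as"
    and ramified: "\<And>a. a \<in> set as \<Longrightarrow> ramified_place \<iota> x y m Z \<mu> \<epsilon> (R a) a"
begin

abbreviation "Rs \<equiv> map R as"

lemma R_place: "a \<in> set as \<Longrightarrow> R a \<in> places \<iota>"
  using ramified ramified_place.axioms(1) kummer_place.axioms(2) kummer_place_axioms_def by metis

lemma as_Z: "a \<in> set as \<Longrightarrow> a \<in> Z" "a \<in> set as \<Longrightarrow> \<mu> a = 1" "a \<in> set as \<Longrightarrow> x - \<iota> a \<in> R a"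
  using ramified ramified_place.a ramified_place.over_a by metis+

lemma R_inj: "inj_on R (set as)"
proof (rule inj_onI)
  fix a b assume a: "a \<in> set as" and b: "b \<in> set as" and eq: "R a = R b"
  interpret ramified_place \<iota> x y m Z \<mu> \<epsilon> "R a" a using ramified a .
  show "a = b" using other_unit[OF over_a, of b] as_Z(3)[OF b] eq place_not_unit by auto
qed

lemma over_as_iff:
  assumes "P \<in> places \<iota>" "a \<in> set as" shows "x - \<iota> a \<in> P \<longleftrightarrow> P = R a"
  using ramified_place_unique[OF ramified[OF assms(2)] ramified_placeI[OF assms(1)]] as_Z assms by blast

lemma val_nonneg_iff_mem:
  assumes "P \<in> places \<iota>" "z \<noteq> 0" shows "0 \<le> place_val P z \<longleftrightarrow> z \<in> place_ring P"
proof -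
  interpret discrete_place \<iota> P using place_discrete assms(1) .
  show ?thesis using val_nonneg_iff[OF assms(2)] .
qed

lemma semigroup_iff:
  "map N as \<in> weierstrass_semigroup \<iota> Rs \<longleftrightarrow>
    (\<exists>z. z \<noteq> 0 \<and> (\<forall>a\<in>set as. max 0 (- place_val (R a) z) = int (N a)) \<and>
       (\<forall>P\<in>places \<iota>. P \<notin> R ` set as \<longrightarrow> z \<in> place_ring P))"
proof -
  have "distinct Rs" "set Rs \<subseteq> places \<iota>"
    using R_inj distinct_as R_place by (auto simp: distinct_map)
  note eq = pole_divisor_eq_iff[OF this]
  have 1: "(\<forall>k<length Rs. max 0 (- place_val (Rs ! k) z) = int (map N as ! k))
      \<longleftrightarrow> (\<forall>a\<in>set as. max 0 (- place_val (R a) z) = int (N a))" for z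
    by (auto simp: all_set_conv_all_nth)
  have 2: "(\<forall>P\<in>places \<iota> - set Rs. 0 \<le> place_val P z) \<longleftrightarrow>
      (\<forall>P\<in>places \<iota>. P \<notin> R ` set as \<longrightarrow> z \<in> place_ring P)" if "z \<noteq> 0" for z
    using val_nonneg_iff_mem[OF _ that] by auto
  show ?thesis
    unfolding weierstrass_semigroup_def mem_Collect_eq eq 1
    using 2 by (simp only: length_map simp_thms cong: conj_cong)
qed

text \<open>The witness is \<open>c * Y ^ i\<close> with \<open>c\<close> a product of powers of the
  x - a: order \<open>- J a\<close> at a chosen point, the least order compatible with regularity at
  any other. The assumption is regularity at infinity. A negative \<open>J a\<close> is allowed: the
  function then has no pole at \<open>R a\<close>, and \<open>nat\<close> returns 0.\<close>

lemma semigroup_sufficient: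
  fixes J :: "'k \<Rightarrow> int"
  assumes le: "(\<Sum>a\<in>Z - set as. ceil_div (int i * int (\<mu> a)) (int m))
      \<le> (int i * (\<Sum>a\<in>Z. int (\<mu> a))) div int m + (\<Sum>a\<in>set as. J a)"
  shows "map (\<lambda>a. nat (int m * J a + int i)) as \<in> weierstrass_semigroup \<iota> Rs"
proof -
  define e where "e a = (if a \<in> set as then - J a else ceil_div (int i * int (\<mu> a)) (int m))" for a
  define c where "c = 1 * (\<Prod>a\<in>Z. (x - \<iota> a) powi e a)"
  have c0: "c \<noteq> 0" using finite_Z by (simp add: c_def power_int_eq_0_iff)
  have mp: "int m > 0" using m_pos by simp
  have val: "int m * place_val P (c * Y ^ i) = (\<Sum>a\<in>Z. (int m * e a - int i * int (\<mu> a)) * place_val P (x - \<iota> a))"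
    if "P \<in> places \<iota>" for P
  proof -
    interpret kummer_place \<iota> x y m Z \<mu> \<epsilon> P using that by unfold_locales
    have "v c = (\<Sum>a\<in>Z. e a * v (x - \<iota> a))" using val_times_powi_prod[of 1] by (simp add: c_def)
    then show ?thesis
      unfolding val_times_Y_power[OF c0] by (simp add: sum_distrib_left sum_subtractf left_diff_distrib mult.assoc)
  qed
  have sub: "set as \<subseteq> Z" using as_Z by blast
  have sum_e: "(\<Sum>a\<in>Z. e a) = (\<Sum>a\<in>Z - set as. ceil_div (int i * int (\<mu> a)) (int m)) - (\<Sum>a\<in>set as. J a)"
    using sum.subset_diff[OF sub finite_Z, of e] by (simp add: e_def sum_negf)
  have "max 0 (- place_val (R a) (c * Y ^ i)) = int (nat (int m * J a + int i))" if aS: "a \<in> set as" for a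
  proof -
    interpret ramified_place \<iota> x y m Z \<mu> \<epsilon> "R a" a using ramified aS .
    have "int m * v (c * Y ^ i) = int m * (- int m * J a - int i)"
      using val[OF R_place[OF aS]] sum_at_zero[OF over_a, of "\<lambda>a. int m * e a - int i * int (\<mu> a)"] as_Z aS
      by (simp add: val_x_minus e_def mult.commute)
    then have "v (c * Y ^ i) = - int m * J a - int i" using mp by simp
    then show ?thesis by simp
  qed
  moreover have "c * Y ^ i \<in> place_ring P" if P: "P \<in> places \<iota>" and notR: "P \<notin> R ` set as" for P
  proof -
    interpret kummer_place \<iota> x y m Z \<mu> \<epsilon> P using P by unfold_locales
    have "int m * v (c * Y ^ i) \<ge> 0"
    proof (cases "x \<in> O\<^sub>P")
      case False
      have "int m * (\<Sum>a\<in>Z. e a) \<le> int i * (\<Sum>a\<in>Z. int (\<mu> a))"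
        using le le_div_iff_mult_le[OF mp, of "\<Sum>a\<in>Z. e a" "int i * (\<Sum>a\<in>Z. int (\<mu> a))"] sum_e
        by (simp add: mult.commute)
      then have "(\<Sum>a\<in>Z. int m * e a - int i * int (\<mu> a)) \<le> 0"
        by (simp add: sum_subtractf sum_distrib_left)
      then show ?thesis
        unfolding val[OF P] sum_infinite[OF False] using val_inverse_x_pos[OF False]
        by (simp add: mult_nonpos_nonneg)
    next
      case fin: True
      show ?thesis
      proof (cases "\<exists>a\<in>Z. x - \<iota> a \<in> P")
        case False
        then show ?thesis unfolding val[OF P] using sum_elsewhere[OF fin] by simp
      next
        case True
        then obtain a where a: "a \<in> Z" "x - \<iota> a \<in> P" by blast
        then have "a \<notin> set as" using over_as_iff[OF P, of a] notR by blast
        then have "int m * e a - int i * int (\<mu> a) \<ge> 0"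
          using mult_ceil_div_ge[OF mp, of "int i * int (\<mu> a)"] by (simp add: e_def)
        then show ?thesis unfolding val[OF P] sum_at_zero[OF a(2,1)]
          using val_x_minus_pos[OF a(2)] by simp
      qed
    qed
    then show ?thesis using mp val_nonneg_iff[of "c * Y ^ i"] c0 by (simp add: zero_le_mult_iff)
  qed
  moreover have "c * Y ^ i \<noteq> 0" using c0 by simp
  ultimately show ?thesis unfolding semigroup_iff by blast
qed

text \<open>The component of \<open>z\<close> with index \<open>i\<close> is nonzero, because the
  pole at \<open>R b\<close> can only come from the term with that residue. Its coefficient, divided
  by the factors prescribed by regularity, is a polynomial, and the inequality is that its degree is
  nonnegative. Residues at the other chosen places are arbitrary, hence the floors.\<close>

lemma semigroup_necessary:
  assumes N: "map N as \<in> weierstrass_semigroup \<iota> Rs" and b: "b \<in> set as"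
    and i: "i = N b mod m" "i \<noteq> 0"
  shows "(\<Sum>a\<in>Z - set as. ceil_div (int i * int (\<mu> a)) (int m))
      \<le> (int i * (\<Sum>a\<in>Z. int (\<mu> a))) div int m + (\<Sum>a\<in>set as. (int (N a) - int i) div int m)"
proof -
  obtain z where z: "z \<noteq> 0" and pole: "\<And>a. a \<in> set as \<Longrightarrow> max 0 (- place_val (R a) z) = int (N a)"
    and reg: "\<And>P. P \<in> places \<iota> \<Longrightarrow> P \<notin> R ` set as \<Longrightarrow> z \<in> place_ring P"
    using N unfolding semigroup_iff by blast
  have mp: "int m > 0" using m_pos by simp
  have im: "i < m" using i m_pos by simp
  define c where "c = coef z i"
  have cL: "c \<in> L" using coef(1) im c_def by blast
  have ex: "\<exists>i<m. coef z i \<noteq> 0"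
    using z coef(2)[of z] by (metis (mono_tags, lifting) lessThan_iff mult_zero_left sum.neutral)
  have c0: "c \<noteq> 0"
  proof -
    interpret ramified_place \<iota> x y m Z \<mu> \<epsilon> "R b" b using ramified b .
    have "N b > 0" using i by (cases "N b = 0") auto
    then have vz: "v z = - int (N b)" using pole[OF b] by (auto simp: max_def split: if_splits)
    obtain j where j: "j < m" "coef z j \<noteq> 0" "v z = v (coef z j * Y ^ j)"
      using val_expansion(2)[OF coef(1) ex] unfolding coef(2)[of z, symmetric] by blast
    obtain n where n: "v (coef z j) = - int m * n * v Y" using L_val coef(1) j by blast
    have "int (N b) = int j + int m * (- n)"
      using j n vz by (simp add: val_mult val_power val_Y_eq)
    then have "int (N b) mod int m = int j mod int m" by (simp only: mod_mult_self2)
    then have "int (N b) mod int m = int j" using j by simp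
    then have "j = i" using i by (simp flip: zmod_int)
    then show ?thesis using j c_def by simp
  qed
  have regt: "c * Y ^ i \<in> place_ring P" if "P \<in> places \<iota>" "P \<notin> R ` set as" for P
    unfolding c_def by (rule component_regular[OF _ reg that im]) (use ramified in blast)
  \<comment> \<open>The least order at \<open>a\<close> that the known bounds leave to
    \<open>c\<close>: at a chosen point the term has a pole of order at most \<open>N a\<close>, at
    any other it is regular.\<close>
  define e where "e a = (if a \<in> set as then - ((int (N a) - int i) div int m) else ceil_div (int i * int (\<mu> a)) (int m))" for a
  define G where "G = c * (\<Prod>a\<in>Z. (x - \<iota> a) powi (- e a))"
  have GL: "G \<in> L" unfolding G_def by (intro L_closed cL x_in_L const_in_L)
  have G0: "G \<noteq> 0" using c0 finite_Z by (simp add: G_def power_int_eq_0_iff)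
  have "G \<in> place_ring P" if P: "P \<in> places \<iota>" and fin: "x \<in> place_ring P" for P
  proof -
    interpret kummer_place \<iota> x y m Z \<mu> \<epsilon> P using P by unfold_locales
    have vG: "v G = v c + (\<Sum>a\<in>Z. - e a * v (x - \<iota> a))"
      unfolding G_def by (rule val_times_powi_prod[OF c0])
    note vt = val_times_Y_power[OF c0, of i]
    have "v G \<ge> 0"
    proof (cases "\<exists>a\<in>Z. x - \<iota> a \<in> P")
      case False
      then have "P \<notin> R ` set as" using as_Z by blast
      then have "v (c * Y ^ i) \<ge> 0" using regt[OF P] c0 val_nonneg_iff[of "c * Y ^ i"] by simp
      then show ?thesis
        using vG vt False sum_elsewhere[OF fin, of "\<lambda>a. - e a"]
          sum_elsewhere[OF fin, of "\<lambda>a. int i * int (\<mu> a)"] mp by simp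
    next
      case True
      then obtain a where a: "a \<in> Z" "x - \<iota> a \<in> P" by blast
      obtain n where n: "v c = n * v (x - \<iota> a)" by (rule val_L_at_zero[OF a(2) cL c0])
      have pos: "v (x - \<iota> a) > 0" using val_x_minus_pos a by blast
      have vt': "int m * v (c * Y ^ i) = (int m * n - int i * int (\<mu> a)) * v (x - \<iota> a)"
        unfolding vt sum_at_zero[OF a(2,1)] n by (simp add: algebra_simps)
      have "e a \<le> n"
      proof (cases "a \<in> set as")
        case False
        have "P \<notin> R ` set as"
        proof
          assume "P \<in> R ` set as"
          then obtain b where "b \<in> set as" "P = R b" by blast
          then show False
            using as_Z(3)[of b] other_unit[OF a(2), of b] place_not_unit False by metis
        qed
        then have "v (c * Y ^ i) \<ge> 0" using regt[OF P] c0 val_nonneg_iff[of "c * Y ^ i"] by simp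
        then have "(int m * n - int i * int (\<mu> a)) * v (x - \<iota> a) \<ge> 0" using vt' mp by (metis mult_nonneg_nonneg less_imp_le)
        then have "int i * int (\<mu> a) \<le> int m * n" using pos by (simp add: zero_le_mult_iff)
        then show ?thesis using False ceil_div_le_iff[OF mp] by (simp add: e_def)
      next
        case True
        then have PR: "P = R a" using over_as_iff[OF P, of a] a by blast
        interpret r: ramified_place \<iota> x y m Z \<mu> \<epsilon> P a using ramified[OF True] PR by simp
        have "v z \<le> v (c * Y ^ i)"
          using r.val_expansion(3)[OF coef(1) ex im] c0 unfolding coef(2)[of z, symmetric] c_def by blast
        moreover have "- int (N a) \<le> v z" using pole[OF True] PR by (auto simp: max_def split: if_splits)
        moreover have "int m * v (c * Y ^ i) = int m * (int m * n - int i)"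
          using vt' r.val_x_minus r.a by simp
        then have "v (c * Y ^ i) = int m * n - int i" using mp by simp
        ultimately have "(- n) * int m \<le> int (N a) - int i" by (simp add: mult.commute)
        then have "- n \<le> (int (N a) - int i) div int m" using mp by (simp add: le_div_iff_mult_le)
        then show ?thesis using True by (simp add: e_def)
      qed
      moreover have "v G = (n - e a) * v (x - \<iota> a)"
        unfolding vG sum_at_zero[OF a(2,1)] n by (simp add: algebra_simps)
      ultimately show ?thesis using pos by simp
    qed
    then show ?thesis using val_nonneg_iff[OF G0] by simp
  qed
  then obtain g where g: "G = ev g" using regular_imp_polynomial[OF GL] by blast
  have g0: "g \<noteq> 0" using g G0 by auto
  \<comment> \<open>One place at infinity is enough: the value of the term there is the same
    expression in the total degree times the positive value of 1/x.\<close>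
  obtain P where P: "P \<in> places \<iota>" and iP: "inverse x \<in> P" using infinite_place by blast
  interpret kummer_place \<iota> x y m Z \<mu> \<epsilon> P using P by unfold_locales
  have inf: "x \<notin> O\<^sub>P" using iP in_place_iff[of "inverse x"] by auto
  have pos: "v (inverse x) > 0" using val_inverse_x_pos inf by blast
  have "P \<notin> R ` set as"
  proof
    assume "P \<in> R ` set as"
    then obtain a where "x - \<iota> a \<in> P" using as_Z by blast
    then show False using add_in[OF place_in const_in[of a]] inf by fastforce
  qed
  then have "v (c * Y ^ i) \<ge> 0" using regt[OF P] c0 val_nonneg_iff[of "c * Y ^ i"] by simp
  moreover have "v G = v c + (\<Sum>a\<in>Z. - e a * v (x - \<iota> a))"
    unfolding G_def by (rule val_times_powi_prod[OF c0])
  then have vc: "v c = - (int (degree g) + (\<Sum>a\<in>Z. e a)) * v (inverse x)"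
    unfolding g val_ev_infinite[OF inf g0] sum_infinite[OF inf] by (simp add: sum_negf algebra_simps)
  have "int m * v (c * Y ^ i) =
      (int i * (\<Sum>a\<in>Z. int (\<mu> a)) - int m * (int (degree g) + (\<Sum>a\<in>Z. e a))) * v (inverse x)"
    unfolding val_times_Y_power[OF c0] sum_infinite[OF inf] vc sum_distrib_left[symmetric]
    by (simp add: algebra_simps)
  ultimately have "int m * (int (degree g) + (\<Sum>a\<in>Z. e a)) \<le> int i * (\<Sum>a\<in>Z. int (\<mu> a))"
    using pos mp by (metis diff_ge_0_iff_ge less_imp_le mult_nonneg_nonneg not_less zero_le_mult_iff)
  then have "int (degree g) + (\<Sum>a\<in>Z. e a) \<le> (int i * (\<Sum>a\<in>Z. int (\<mu> a))) div int m"
    using mp by (simp add: le_div_iff_mult_le mult.commute)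
  moreover have sub: "set as \<subseteq> Z" using as_Z by blast
  have "(\<Sum>a\<in>Z. e a) = (\<Sum>a\<in>Z - set as. ceil_div (int i * int (\<mu> a)) (int m))
      - (\<Sum>a\<in>set as. (int (N a) - int i) div int m)"
    using sum.subset_diff[OF sub finite_Z, of e] by (simp add: e_def sum_negf)
  ultimately show ?thesis by linarith
qed

end

section \<open>The numbers \<open>A i\<close>, the semigroups and the minimal generating
  sets\<close>

context kummer_extension
begin

text \<open>A chosen point is a simple zero and contributes the ceiling 1. With t chosen places,
  \<open>A i - t\<close> is therefore the least sum of exponents \<open>J\<close> that admits a
  function with residue \<open>i\<close>.\<close>

definition A :: "nat \<Rightarrow> int" where
  "A i = (\<Sum>a\<in>Z. ceil_div (int i * int (\<mu> a)) (int m)) - (int i * (\<Sum>a\<in>Z. int (\<mu> a))) div int m"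

lemma ceil_div_less_one: "0 < i \<Longrightarrow> i < m \<Longrightarrow> ceil_div (int i) (int m) = 1"
  by (simp add: ceil_div_def zdiv_zminus1_eq_if)

text \<open>At a simple zero the ceiling strictly exceeds i/m. Positivity makes
  \<open>m * (A i - 1) + i\<close> a natural number.\<close>

lemma A_pos:
  assumes "0 < i" "i < m" "a \<in> Z" "\<mu> a = 1" shows "A i \<ge> 1"
proof -
  have mp: "int m > 0" using m_pos by simp
  have "int i * (\<Sum>a\<in>Z. int (\<mu> a)) < (\<Sum>a\<in>Z. int m * ceil_div (int i * int (\<mu> a)) (int m))"
    unfolding sum_distrib_left
  proof (rule sum_strict_mono_ex1[OF finite_Z])
    show "\<forall>a\<in>Z. int i * int (\<mu> a) \<le> int m * ceil_div (int i * int (\<mu> a)) (int m)"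
      using mult_ceil_div_ge[OF mp] by blast
    show "\<exists>a\<in>Z. int i * int (\<mu> a) < int m * ceil_div (int i * int (\<mu> a)) (int m)"
      using assms ceil_div_less_one by (intro bexI[of _ a]) auto
  qed
  then have "\<not> (\<Sum>a\<in>Z. ceil_div (int i * int (\<mu> a)) (int m)) \<le> (int i * (\<Sum>a\<in>Z. int (\<mu> a))) div int m"
    unfolding le_div_iff_mult_le[OF mp] by (simp add: sum_distrib_left mult.commute)
  then show ?thesis by (simp add: A_def)
qed

end

context ramified_places
begin

lemma sum_complement:
  assumes "0 < i" "i < m"
  shows "(\<Sum>a\<in>Z - set as. ceil_div (int i * int (\<mu> a)) (int m))
    = (\<Sum>a\<in>Z. ceil_div (int i * int (\<mu> a)) (int m)) - int (length as)"
proof -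
  have "set as \<subseteq> Z" using as_Z by blast
  moreover have "(\<Sum>a\<in>set as. ceil_div (int i * int (\<mu> a)) (int m)) = (\<Sum>a\<in>set as. 1)"
    using as_Z ceil_div_less_one[OF assms] by (intro sum.cong) auto
  ultimately show ?thesis
    using sum.subset_diff[OF _ finite_Z, of "set as" "\<lambda>a. ceil_div (int i * int (\<mu> a)) (int m)"]
      distinct_as by (simp add: distinct_card)
qed

lemma semigroup_lower_bound:
  assumes "map N as \<in> weierstrass_semigroup \<iota> Rs" "b \<in> set as" "N b mod m = i" "i \<noteq> 0"
  shows "A i - int (length as) \<le> (\<Sum>a\<in>set as. (int (N a) - int i) div int m)"
proof -
  have "0 < i" "i < m" using assms m_pos by auto
  from semigroup_necessary[OF assms(1,2) assms(3)[symmetric] assms(4)]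
  show ?thesis unfolding sum_complement[OF \<open>0 < i\<close> \<open>i < m\<close>] A_def by linarith
qed

lemma semigroup_member:
  assumes "0 < i" "i < m" "A i - int (length as) \<le> (\<Sum>a\<in>set as. J a)"
  shows "map (\<lambda>a. nat (int m * J a + int i)) as \<in> weierstrass_semigroup \<iota> Rs"
  by (rule semigroup_sufficient, unfold sum_complement[OF assms(1,2)])
    (use assms(3) in \<open>simp add: A_def\<close>)

text \<open>For residue 0 the witness is a rational function with exponents \<open>- J a\<close>,
  and the assumption says that its degree is not positive.\<close>

lemma semigroup_member_multiple:
  assumes "0 \<le> (\<Sum>a\<in>set as. J a)"
  shows "map (\<lambda>a. nat (int m * J a)) as \<in> weierstrass_semigroup \<iota> Rs"
  using semigroup_sufficient[of 0 J] assms by (simp add: ceil_div_def)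

lemma list_as_map: assumes "length l = length as" obtains N where "l = map N as"
proof
  show "l = map (\<lambda>a. the (map_of (zip as l) a)) as"
    using assms distinct_as by (intro nth_equalityI) (auto simp: map_of_zip_nth)
qed

lemma minimal_in_map_iff:
  assumes "k < length as"
  shows "minimal_in {ns \<in> weierstrass_semigroup \<iota> Rs. ns ! k = map N as ! k} (map N as) \<longleftrightarrow>
    map N as \<in> weierstrass_semigroup \<iota> Rs \<and>
    (\<forall>N'. map N' as \<in> weierstrass_semigroup \<iota> Rs \<longrightarrow> N' (as ! k) = N (as ! k) \<longrightarrow>
       (\<forall>a\<in>set as. N' a \<le> N a) \<longrightarrow> (\<forall>a\<in>set as. N' a = N a))"
proof -
  have le: "list_all2 (\<le>) (map N' as) (map N as) \<longleftrightarrow> (\<forall>a\<in>set as. N' a \<le> N a)" for N' :: "'k \<Rightarrow> nat"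
    by (simp add: list_all2_map1 list_all2_map2 list_all2_same)
  have len: "length ns = length as" if "ns \<in> weierstrass_semigroup \<iota> Rs" for ns
    using that by (simp add: weierstrass_semigroup_def)
  show ?thesis (is "?L \<longleftrightarrow> ?R")
  proof
    assume L: ?L
    show ?R
    proof (intro conjI allI impI)
      show "map N as \<in> weierstrass_semigroup \<iota> Rs" using L by (simp add: minimal_in_def)
    next
      fix N' assume N': "map N' as \<in> weierstrass_semigroup \<iota> Rs" "N' (as ! k) = N (as ! k)"
        "\<forall>a\<in>set as. N' a \<le> N a"
      then have "map N' as = map N as"
        using L le[of N'] assms unfolding minimal_in_def by auto
      then show "\<forall>a\<in>set as. N' a = N a" by simp
    qed
  next
    assume R: ?R
    show ?L
      unfolding minimal_in_def
    proof (intro conjI ballI)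
      show "map N as \<in> {ns \<in> weierstrass_semigroup \<iota> Rs. ns ! k = map N as ! k}" using R by simp
    next
      fix l assume l: "l \<in> {ns \<in> weierstrass_semigroup \<iota> Rs. ns ! k = map N as ! k} - {map N as}"
      then obtain N' where N': "l = map N' as" using len list_as_map by blast
      show "\<not> list_all2 (\<le>) l (map N as)"
        using l R assms unfolding N' le by auto
    qed
  qed
qed

text \<open>Rounding the components of a member down to the residue \<open>i\<close> of the fixed
  one keeps it in the semigroup, so a minimal tuple has one common residue. Its sum of exponents
  attains the lower bound, since otherwise a component other than the fixed one could be lowered;
  two components are needed for this. Conversely, a smaller member with the same fixed component
  would violate the bound.\<close>

theorem minimal_generating_set_eq:
  assumes len: "length as \<ge> 2"
  shows "minimal_generating_set \<iota> Rs =
    {map (\<lambda>j. m * j + i) js | i js. 1 \<le> i \<and> i \<le> m - 1 \<and> length js = length as \<and>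
       int (sum_list js) = A i - int (length as)}" (is "?L = ?R")
proof
  have mp: "int m > 0" using m_pos by simp
  have other: "\<exists>a\<in>set as. a \<noteq> b" for b
  proof (rule ccontr)
    assume "\<not> (\<exists>a\<in>set as. a \<noteq> b)"
    then have "card (set as) \<le> card {b}" by (intro card_mono) auto
    then show False using len distinct_as by (simp add: distinct_card)
  qed
  show "?L \<subseteq> ?R"
  proof
    fix l assume l: "l \<in> ?L"
    then have "length l = length as" by (simp add: minimal_generating_set_def)
    then obtain N where lN: "l = map N as" using list_as_map by blast
    have pos: "N a \<ge> 1" if "a \<in> set as" for a
      using l that unfolding lN minimal_generating_set_def by auto
    obtain k where k: "k < length as"
      and min: "minimal_in {ns \<in> weierstrass_semigroup \<iota> Rs. ns ! k = map N as ! k} (map N as)"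
      using l unfolding lN minimal_generating_set_def by auto
    define b where "b = as ! k"
    have b: "b \<in> set as" using k b_def by simp
    have N: "map N as \<in> weierstrass_semigroup \<iota> Rs"
      and minN: "\<And>N' a. map N' as \<in> weierstrass_semigroup \<iota> Rs \<Longrightarrow> N' b = N b \<Longrightarrow>
        (\<forall>a\<in>set as. N' a \<le> N a) \<Longrightarrow> a \<in> set as \<Longrightarrow> N' a = N a"
      using min unfolding minimal_in_map_iff[OF k] b_def by blast+
    obtain a where a: "a \<in> set as" "a \<noteq> b" using other by blast
    define i where "i = N b mod m"
    have im: "i < m" using m_pos by (simp add: i_def)
    show "l \<in> ?R"
    proof (cases "i = 0")
      case True
      \<comment> \<open>If \<open>m\<close> divides the fixed component, a negative power of x - b
        has a pole of that order at \<open>b\<close> and no pole at the other chosen places.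
        Minimality would make component \<open>a\<close> zero, against positivity.\<close>
      define J where "J c = (if c = b then int (N b div m) else 0)" for c
      have Jb: "nat (int m * J b) = N b"
      proof -
        have "m * (N b div m) = N b" using True mult_div_mod_eq[of m "N b"] unfolding i_def by linarith
        then show ?thesis by (simp add: J_def flip: of_nat_mult)
      qed
      have J0: "nat (int m * J c) = 0" if "c \<noteq> b" for c using that by (simp add: J_def)
      have "map (\<lambda>a. nat (int m * J a)) as \<in> weierstrass_semigroup \<iota> Rs"
        by (rule semigroup_member_multiple) (auto simp: J_def intro!: sum_nonneg)
      from minN[OF this Jb _ a(1)] have "nat (int m * J a) = N a"
        using Jb J0 by (metis le0 order_refl)
      then show ?thesis using J0[OF a(2)] pos[OF a(1)] by simp
    next
      case False
      define J where "J c = (int (N c) - int i) div int m" for c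
      have sumJ: "A i - int (length as) \<le> (\<Sum>a\<in>set as. J a)"
        unfolding J_def by (rule semigroup_lower_bound[OF N b _ False]) (simp add: i_def)
      have Jle: "int m * J c + int i \<le> int (N c)" for c
        using le_div_iff_mult_le[OF mp, of "J c" "int (N c) - int i"] by (simp add: J_def mult.commute)
      have Jb: "int m * J b + int i = int (N b)"
        by (simp add: J_def i_def of_nat_mod minus_mod_eq_mult_div[symmetric] mult.commute zmod_int)
      have J: "int m * J c + int i = int (N c)" if c: "c \<in> set as" for c
      proof -
        have "nat (int m * J c + int i) = N c"
        proof (rule minN[of "\<lambda>c. nat (int m * J c + int i)", OF _ _ _ c])
          show "map (\<lambda>c. nat (int m * J c + int i)) as \<in> weierstrass_semigroup \<iota> Rs"
            using semigroup_member[OF _ im sumJ] False by simp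
          show "nat (int m * J b + int i) = N b" using Jb by simp
          show "\<forall>a\<in>set as. nat (int m * J a + int i) \<le> N a" using Jle by (simp add: nat_le_iff)
        qed
        \<comment> \<open>Since \<open>N c\<close> is at least 1, \<open>nat\<close> has not cut off
          a negative number.\<close>
        then show ?thesis using pos[OF c] by linarith
      qed
      have J0: "J c \<ge> 0" if c: "c \<in> set as" for c
      proof (rule ccontr)
        assume "\<not> J c \<ge> 0"
        then have "int m * J c \<le> int m * (- 1)" using mp by (intro mult_left_mono) auto
        then show False using J[OF c] im by simp
      qed
      have "\<not> A i - int (length as) < (\<Sum>a\<in>set as. J a)"
      proof
        assume less: "A i - int (length as) < (\<Sum>a\<in>set as. J a)"
        \<comment> \<open>Lowering the exponent at \<open>a\<close>, which differs from
          \<open>b\<close>, keeps the fixed component and still meets the bound.\<close>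
        define J' where "J' = J(a := J a - 1)"
        have "(\<Sum>a\<in>set as. J' a) = (\<Sum>a\<in>set as. J a) - 1"
          using a(1) by (simp add: J'_def sum.remove)
        then have "map (\<lambda>c. nat (int m * J' c + int i)) as \<in> weierstrass_semigroup \<iota> Rs"
          using semigroup_member[OF _ im, of J'] False less by simp
        moreover have "nat (int m * J' b + int i) = N b" using a(2) Jb by (simp add: J'_def)
        moreover have le: "int m * J' c + int i \<le> int (N c)" for c
          using Jle[of c] mp by (auto simp: J'_def right_diff_distrib)
        ultimately have "nat (int m * J' a + int i) = N a"
          using minN[of "\<lambda>c. nat (int m * J' c + int i)", OF _ _ _ a(1)] by (simp add: nat_le_iff)
        then show False using pos[OF a(1)] J[OF a(1)] mp by (simp add: J'_def right_diff_distrib)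
      qed
      then have sum: "(\<Sum>a\<in>set as. J a) = A i - int (length as)" using sumJ by simp
      define js where "js = map (\<lambda>c. nat (J c)) as"
      have "N c = m * nat (J c) + i" if "c \<in> set as" for c
      proof -
        have "int (N c) = int (m * nat (J c) + i)" using J[OF that] J0[OF that] by simp
        then show ?thesis by (simp only: of_nat_eq_iff)
      qed
      then have "l = map (\<lambda>j. m * j + i) js" unfolding lN js_def by simp
      moreover have "int (sum_list js) = A i - int (length as)"
        unfolding js_def sum.distinct_set_conv_list[OF distinct_as, symmetric]
        using sum J0 by (simp add: of_nat_sum)
      moreover have "length js = length as" by (simp add: js_def)
      moreover have "1 \<le> i" "i \<le> m - 1" using False im by auto
      ultimately show ?thesis by blast
    qed
  qed
  show "?R \<subseteq> ?L"
  proof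
    fix l assume "l \<in> ?R"
    then obtain i js where i: "1 \<le> i" "i \<le> m - 1" and l: "l = map (\<lambda>j. m * j + i) js"
      and js: "length js = length as" "int (sum_list js) = A i - int (length as)" by blast
    have i': "0 < i" "i < m" using i by auto
    obtain K where K: "js = map K as" using list_as_map js by blast
    define N where "N a = m * K a + i" for a
    have lN: "l = map N as" by (simp add: l K N_def)
    have sumK: "(\<Sum>a\<in>set as. int (K a)) = A i - int (length as)"
      using js(2) unfolding K sum.distinct_set_conv_list[OF distinct_as, symmetric] by simp
    have "(\<lambda>a. nat (int m * int (K a) + int i)) = N"
      by (simp add: N_def fun_eq_iff nat_add_distrib nat_mult_distrib)
    then have N: "map N as \<in> weierstrass_semigroup \<iota> Rs"
      using semigroup_member[OF i', of "\<lambda>a. int (K a)"] sumK by simp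
    have k: "0 < length as" using len by auto
    \<comment> \<open>All components have residue \<open>i\<close>, so the first may serve as the
      fixed one.\<close>
    have "minimal_in {ns \<in> weierstrass_semigroup \<iota> Rs. ns ! 0 = map N as ! 0} (map N as)"
      unfolding minimal_in_map_iff[OF k]
    proof (intro conjI allI impI N)
      fix N' assume N': "map N' as \<in> weierstrass_semigroup \<iota> Rs" "N' (as ! 0) = N (as ! 0)"
        and le: "\<forall>a\<in>set as. N' a \<le> N a"
      have "N' (as ! 0) mod m = i" using i' N'(2) by (simp add: N_def)
      then have sum: "(\<Sum>a\<in>set as. int (K a)) \<le> (\<Sum>a\<in>set as. (int (N' a) - int i) div int m)"
        using semigroup_lower_bound[OF N'(1) nth_mem[OF k]] i' sumK by simp
      have bound: "(int (N' a) - int i) div int m \<le> int (K a)" if "a \<in> set as" for a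
      proof -
        have "N' a \<le> m * K a + i" using le that unfolding N_def by blast
        then have "int (N' a) \<le> int (m * K a + i)" by (simp only: of_nat_le_iff)
        then have "int (N' a) - int i \<le> int m * int (K a)" by simp
        then show ?thesis using zdiv_mono1[OF _ mp, of "int (N' a) - int i" "int m * int (K a)"] mp by simp
      qed
      show "\<forall>a\<in>set as. N' a = N a"
      proof (rule ccontr)
        assume "\<not> (\<forall>a\<in>set as. N' a = N a)"
        then obtain a where a: "a \<in> set as" "N' a < N a" using le by (metis le_neq_implies_less)
        have "int (N' a) < int (N a)" using a by simp
        then have "int (N' a) - int i < int (K a) * int m" by (simp add: N_def mult.commute)
        then have "(int (N' a) - int i) div int m < int (K a)"
          using le_div_iff_mult_le[OF mp, of "int (K a)"] by (simp add: not_le[symmetric])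
        then have "(\<Sum>a\<in>set as. (int (N' a) - int i) div int m) < (\<Sum>a\<in>set as. int (K a))"
          using bound a(1) by (intro sum_strict_mono_ex1) auto
        then show False using sum by simp
      qed
    qed
    then show "l \<in> ?L"
      unfolding minimal_generating_set_def lN using i' k by (auto simp: N_def)
  qed
qed

end

context kummer_galois
begin

text \<open>For a single place the floor in the necessary condition is \<open>h div m\<close>, which
  is also the exponent in the sufficient one, so the two conditions meet.\<close>

lemma semigroup1_iff:
  assumes "ramified_place \<iota> x y m Z \<mu> \<epsilon> P a"
  shows "h \<in> weierstrass_semigroup1 \<iota> P \<longleftrightarrow> h mod m = 0 \<or> A (h mod m) - 1 \<le> int (h div m)"
proof -
  interpret R: ramified_places \<iota> x y m Z \<mu> \<epsilon> "[a]" "\<lambda>_. P"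
    by (intro ramified_places.intro ramified_places_axioms.intro kummer_galois_axioms) (use assms in auto)
  have iff: "h \<in> weierstrass_semigroup1 \<iota> P \<longleftrightarrow> map (\<lambda>_. h) [a] \<in> weierstrass_semigroup \<iota> (map (\<lambda>_. P) [a])"
    by (simp add: weierstrass_semigroup1_def)
  have im: "h mod m < m" using m_pos by simp
  have div: "(int h - int (h mod m)) div int m = int (h div m)"
    using m_pos by (simp add: zmod_int zdiv_int minus_mod_eq_mult_div)
  have h: "nat (int m * int (h div m) + int (h mod m)) = h"
    by (metis mult_div_mod_eq nat_int of_nat_add of_nat_mult)
  show ?thesis
  proof (cases "h mod m = 0")
    case True
    then have "h \<in> weierstrass_semigroup1 \<iota> P"
      using R.semigroup_member_multiple[of "\<lambda>_. int (h div m)"] h unfolding iff by simp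
    then show ?thesis using True by simp
  next
    case False
    show ?thesis
    proof
      assume "h \<in> weierstrass_semigroup1 \<iota> P"
      then show "h mod m = 0 \<or> A (h mod m) - 1 \<le> int (h div m)"
        using R.semigroup_lower_bound[of "\<lambda>_. h" a "h mod m"] False div unfolding iff by simp
    next
      assume "h mod m = 0 \<or> A (h mod m) - 1 \<le> int (h div m)"
      then show "h \<in> weierstrass_semigroup1 \<iota> P"
        using R.semigroup_member[OF _ im, of "\<lambda>_. int (h div m)"] False h unfolding iff by simp
    qed
  qed
qed

theorem gap_set_eq:
  assumes "ramified_place \<iota> x y m Z \<mu> \<epsilon> P a"
  shows "gap_set \<iota> P = {m * j + i | i j. 1 \<le> i \<and> i \<le> m - 1 \<and> int j \<le> A i - 2}"
proof (rule Set.set_eqI)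
  fix h
  have "h \<in> gap_set \<iota> P \<longleftrightarrow> h mod m \<noteq> 0 \<and> int (h div m) \<le> A (h mod m) - 2"
    by (auto simp: gap_set_def semigroup1_iff[OF assms])
  also have "\<dots> \<longleftrightarrow> h \<in> {m * j + i | i j. 1 \<le> i \<and> i \<le> m - 1 \<and> int j \<le> A i - 2}"
  proof
    assume h: "h mod m \<noteq> 0 \<and> int (h div m) \<le> A (h mod m) - 2"
    have "h mod m < m" using m_pos by simp
    then have "1 \<le> h mod m" "h mod m \<le> m - 1" using h by linarith+
    moreover have "h = m * (h div m) + h mod m" by simp
    ultimately show "h \<in> {m * j + i | i j. 1 \<le> i \<and> i \<le> m - 1 \<and> int j \<le> A i - 2}"
      using h by blast
  next
    assume "h \<in> {m * j + i | i j. 1 \<le> i \<and> i \<le> m - 1 \<and> int j \<le> A i - 2}"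
    then obtain i j where "h = m * j + i" "1 \<le> i" "i \<le> m - 1" "int j \<le> A i - 2" by blast
    moreover from this have "i < m" by auto
    ultimately show "h mod m \<noteq> 0 \<and> int (h div m) \<le> A (h mod m) - 2" by simp
  qed
  finally show "h \<in> gap_set \<iota> P \<longleftrightarrow> h \<in> {m * j + i | i j. 1 \<le> i \<and> i \<le> m - 1 \<and> int j \<le> A i - 2}" .
qed

text \<open>Pole orders add under multiplication of the witnesses. A summand 0 is treated apart,
  because its witness might vanish at \<open>P\<close> and cancel part of the other pole.\<close>

lemma semigroup1_add:
  assumes P: "ramified_place \<iota> x y m Z \<mu> \<epsilon> P a"
    and h: "h \<in> weierstrass_semigroup1 \<iota> P" "k \<in> weierstrass_semigroup1 \<iota> P"
  shows "h + k \<in> weierstrass_semigroup1 \<iota> P"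
proof (cases "h = 0 \<or> k = 0")
  case False
  interpret R: ramified_places \<iota> x y m Z \<mu> \<epsilon> "[a]" "\<lambda>_. P"
    by (intro ramified_places.intro ramified_places_axioms.intro kummer_galois_axioms) (use P in auto)
  interpret ramified_place \<iota> x y m Z \<mu> \<epsilon> P a by fact
  have iff: "h \<in> weierstrass_semigroup1 \<iota> P \<longleftrightarrow> (\<exists>z. z \<noteq> 0 \<and> max 0 (- v z) = int h \<and>
      (\<forall>P'\<in>places \<iota>. P' \<noteq> P \<longrightarrow> z \<in> place_ring P'))" for h
    using R.semigroup_iff[of "\<lambda>_. h"] by (simp add: weierstrass_semigroup1_def)
  obtain z w where z: "z \<noteq> 0" "max 0 (- v z) = int h" "\<forall>P'\<in>places \<iota>. P' \<noteq> P \<longrightarrow> z \<in> place_ring P'"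
    and w: "w \<noteq> 0" "max 0 (- v w) = int k" "\<forall>P'\<in>places \<iota>. P' \<noteq> P \<longrightarrow> w \<in> place_ring P'"
    using h unfolding iff by blast
  have "v (z * w) = - int h - int k" using False z w by (auto simp: val_mult max_def split: if_splits)
  moreover have "z * w \<in> place_ring P'" if "P' \<in> places \<iota>" "P' \<noteq> P" for P'
  proof -
    interpret P': function_field_place \<iota> P' using that by unfold_locales
    show ?thesis using P'.mult_in z w that by blast
  qed
  moreover have "z * w \<noteq> 0" using z w by simp
  ultimately show ?thesis unfolding iff by (intro exI[of _ "z * w"]) auto
qed (use h in auto)

text \<open>The generator with residue \<open>i\<close> is the least element of its class modulo
  \<open>m\<close>; every other element of the class arises by adding copies of \<open>m\<close>.
  Together with 0 these generators form the Apery set of \<open>m\<close>.\<close>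

theorem semigroup1_generated:
  assumes rP: "ramified_place \<iota> x y m Z \<mu> \<epsilon> P a"
  shows "int ` weierstrass_semigroup1 \<iota> P = submonoid_generated
    ({int m} \<union> {int m * (A i - 1) + int i | i. 1 \<le> i \<and> i \<le> m - 1})"
  unfolding submonoid_generated_def
proof (rule sym, rule hull_unique)
  interpret ramified_place \<iota> x y m Z \<mu> \<epsilon> P a by fact
  let ?H = "weierstrass_semigroup1 \<iota> P"
  note H = semigroup1_iff[OF rP]
  show "{int m} \<union> {int m * (A i - 1) + int i | i. 1 \<le> i \<and> i \<le> m - 1} \<subseteq> int ` ?H"
  proof
    fix g assume "g \<in> {int m} \<union> {int m * (A i - 1) + int i | i. 1 \<le> i \<and> i \<le> m - 1}"
    then consider "g = int m" | i where "g = int m * (A i - 1) + int i" "0 < i" "i < m" by fastforce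
    then show "g \<in> int ` ?H"
    proof cases
      case 1
      then show ?thesis by (auto simp: H)
    next
      case 2
      define h where "h = m * nat (A i - 1) + i"
      have "A i \<ge> 1" using A_pos[OF 2(2,3) a] .
      then have "g = int h" using 2 by (simp add: h_def)
      moreover have "h \<in> ?H" unfolding H h_def using 2 by simp
      ultimately show ?thesis by blast
    qed
  qed
  show "0 \<in> int ` ?H \<and> (\<forall>a\<in>int ` ?H. \<forall>b\<in>int ` ?H. a + b \<in> int ` ?H)"
    using semigroup1_add[OF rP] H[of 0] by (force simp flip: of_nat_add)
  fix M assume gen: "{int m} \<union> {int m * (A i - 1) + int i | i. 1 \<le> i \<and> i \<le> m - 1} \<subseteq> M"
    and M: "0 \<in> M \<and> (\<forall>a\<in>M. \<forall>b\<in>M. a + b \<in> M)"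
  have mult: "int m * int k \<in> M" for k
    using M gen by (induction k) (auto simp: distrib_left)
  show "int ` ?H \<subseteq> M"
  proof
    fix g assume "g \<in> int ` ?H"
    then obtain h where h: "g = int h" "h \<in> ?H" by blast
    have hm: "int h = int m * int (h div m) + int (h mod m)" by (simp flip: of_nat_mult of_nat_add)
    show "g \<in> M"
    proof (cases "h mod m = 0")
      case True
      then show ?thesis using h hm mult[of "h div m"] by simp
    next
      case False
      let ?i = "h mod m"
      have i: "1 \<le> ?i" "?i \<le> m - 1"
        using False mod_less_divisor[OF m_pos, of h] by linarith+
      have le: "A ?i - 1 \<le> int (h div m)" using h H False by simp
      define k where "k = nat (int (h div m) - (A ?i - 1))"
      have k: "int k = int (h div m) - (A ?i - 1)" using le by (simp add: k_def)
      have "g = (int m * (A ?i - 1) + int ?i) + int m * int k"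
        unfolding h(1) k using hm by (simp add: right_diff_distrib)
      then show ?thesis using mult[of k] gen i M by blast
    qed
  qed
qed

end

subsection \<open>Roots of unity in finite fields\<close>

text \<open>Multiplication by \<open>a\<close> permutes the nonzero elements and so preserves their
  product.\<close>

lemma power_card_minus_one:
  fixes a :: "'k::{field,finite}"
  assumes "a \<noteq> 0" shows "a ^ (CARD('k) - 1) = 1"
proof -
  let ?S = "UNIV - {0 :: 'k}"
  have "(\<Prod>b\<in>?S. b) = (\<Prod>b\<in>?S. a * b)"
    by (rule prod.reindex_bij_witness[of _ "\<lambda>b. a * b" "\<lambda>b. b / a"]) (use assms in auto)
  also have "\<dots> = a ^ (CARD('k) - 1) * (\<Prod>b\<in>?S. b)" by (simp add: prod.distrib)
  finally have "a ^ (CARD('k) - 1) * (\<Prod>b\<in>?S. b) = 1 * (\<Prod>b\<in>?S. b)" by simp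
  moreover have "(\<Prod>b\<in>?S. b) \<noteq> 0" by simp
  ultimately show ?thesis by (metis mult_right_cancel)
qed

text \<open>All k l nonzero elements are zeros of X^(kl) - 1 = (X^k - 1) g. Since g has at most k (l
  - 1) zeros, at least k are left for the first factor.\<close>

lemma card_roots_of_unity:
  assumes "k dvd CARD('k::{field,finite}) - 1" "k > 0"
  shows "card {u :: 'k. u ^ k = 1} = k"
proof -
  obtain l where l: "CARD('k) - 1 = k * l" using assms by (auto elim: dvdE)
  have "card {0, 1 :: 'k} \<le> CARD('k)" by (intro card_mono) auto
  then have "k * l > 0" unfolding l[symmetric] by simp
  then have l0: "l > 0" by simp
  define p :: "'k poly" where "p = monom 1 k - 1"
  define g :: "'k poly" where "g = (\<Sum>j<l. monom 1 (k * j))"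
  have "coeff p k = 1" using assms by (simp add: p_def coeff_diff)
  then have p: "p \<noteq> 0" by auto
  have "coeff g 0 = (\<Sum>j<l. if j = 0 then 1 else 0)"
    unfolding g_def coeff_sum by (intro sum.cong) (use assms in auto)
  then have g: "g \<noteq> 0" using l0 by auto
  have dp: "degree p \<le> k" unfolding p_def by (intro degree_diff_le) (auto simp: degree_monom_le)
  have dg: "degree g \<le> k * (l - 1)" unfolding g_def
    by (intro degree_sum_le) (auto intro!: order_trans[OF degree_monom_le])
  have "UNIV - {0} \<subseteq> {u. poly p u = 0} \<union> {u. poly g u = 0}"
  proof
    fix u :: 'k assume "u \<in> UNIV - {0}"
    then have "u ^ (k * l) - 1 = 0" using power_card_minus_one[of u] l by simp
    moreover have "u ^ (k * l) - 1 = poly p u * poly g u"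
      using power_diff_1_eq[of "u ^ k" l] l0 by (simp add: p_def g_def poly_monom poly_sum power_mult)
    ultimately show "u \<in> {u. poly p u = 0} \<union> {u. poly g u = 0}" by auto
  qed
  then have "card (UNIV - {0 :: 'k}) \<le> card ({u. poly p u = 0} \<union> {u. poly g u = 0})"
    by (intro card_mono) auto
  also have "\<dots> \<le> card {u. poly p u = 0} + card {u. poly g u = 0}" by (rule card_Un_le)
  also have "card {u. poly g u = 0} \<le> k * (l - 1)" using card_poly_roots_bound[OF g] dg by simp
  finally have "k * l \<le> card {u. poly p u = 0} + k * (l - 1)" using l by simp
  moreover have "k * l = k * (l - 1) + k" using l0 by (cases l) auto
  ultimately have "k \<le> card {u. poly p u = 0}" by linarith
  moreover have "card {u. poly p u = 0} \<le> k" using card_poly_roots_bound[OF p] dp by simp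
  moreover have "{u. poly p u = 0} = {u. u ^ k = 1}" by (simp add: p_def poly_monom)
  ultimately show ?thesis by simp
qed

text \<open>Both sides are monic of degree k, so their difference has smaller degree; having k
  zeros, it vanishes.\<close>

lemma unity_polynomial_splits:
  assumes "card {u :: 'k::field. u ^ k = 1} = k" "k > 0"
  shows "monom 1 k - 1 = (\<Prod>a\<in>{u :: 'k. u ^ k = 1}. [:- a, 1:])"
proof -
  let ?S = "{u :: 'k. u ^ k = 1}"
  have fin: "finite ?S" using assms by (intro card_ge_0_finite) simp
  define s where "s = (\<Prod>a\<in>?S. [:- a, 1:])"
  have ds: "degree s = k" unfolding s_def using assms by (subst degree_prod_eq_sum_degree) auto
  have "lead_coeff s = 1" unfolding s_def lead_coeff_prod by simp
  then have cs: "coeff s k = 1" using ds by simp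
  define r where "r = monom 1 k - 1 - s"
  have "r = 0"
  proof (rule ccontr)
    assume r: "r \<noteq> 0"
    have "degree r < k"
    proof (rule degree_lessI)
      show "\<forall>j\<ge>k. coeff r j = 0"
        using cs ds assms(2) by (auto simp: r_def coeff_eq_0 le_less)
    qed (use assms in simp)
    moreover have "?S \<subseteq> {u. poly r u = 0}"
      using fin by (auto simp: r_def s_def poly_monom poly_prod prod_zero_iff)
    then have "card ?S \<le> card {u. poly r u = 0}" using poly_roots_finite[OF r] by (intro card_mono) auto
    ultimately show False using card_poly_roots_bound[OF r] assms(1) by simp
  qed
  then show ?thesis by (simp add: r_def s_def)
qed

lemma (in rational_subfield) x_power_minus_one:
  assumes "card {u :: 'k. u ^ k = 1} = k" "k > 0"
  shows "x ^ k - 1 = (\<Prod>a\<in>{u. u ^ k = 1}. x - \<iota> a)"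
proof -
  have prod: "ev (\<Prod>a\<in>S. [:- a, 1:]) = (\<Prod>a\<in>S. x - \<iota> a)" for S
  proof (induction S rule: infinite_finite_induct)
    case (insert a F)
    then show ?case unfolding prod.insert[OF insert.hyps] ev_simps(3,6) by simp
  qed simp_all
  have "ev (monom 1 k - 1) = x ^ k - 1" unfolding ev_simps(2) by (simp add: poly_monom)
  then show ?thesis unfolding unity_polynomial_splits[OF assms] prod by simp
qed

lemma minus_one_dvd_power_minus_one: "(a::nat) - 1 dvd a ^ n - 1"
proof (cases "a = 0")
  case False
  show ?thesis
  proof (induction n)
    case (Suc n)
    have "a ^ Suc n - 1 = a * (a ^ n - 1) + (a - 1)"
      using False by (simp add: diff_mult_distrib2)
    then show ?case using Suc by simp
  qed simp
qed (simp add: power_0_left)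

text \<open>Translation by 1 preserves the sum of all elements, so the number of elements is zero in
  the field.\<close>

lemma of_nat_eq_zero_of_card_eq_power:
  assumes "CARD('k::{field,finite}) = q ^ r"
  shows "of_nat q = (0 :: 'k)"
proof -
  have "(\<Sum>b\<in>UNIV. b) = (\<Sum>b\<in>UNIV. b + (1 :: 'k))"
    by (rule sum.reindex_bij_witness[of _ "\<lambda>b. b + 1" "\<lambda>b. b - 1"]) auto
  then have "of_nat (q ^ r) = (0 :: 'k)" unfolding assms[symmetric] by (simp add: sum.distrib)
  then show ?thesis by simp
qed

lemma A_num_eq:
  assumes "m > 0"
  shows "A_num q d m i = int d + ceil_div (int i * int d) (int m)
    + int d * (int q - 2) * ceil_div (int i * (int q + 1)) (int m)
    - (int i * (int d * int q * (int q - 1))) div int m"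
proof -
  have "\<lceil>real d * real i / real m\<rceil> = ceil_div (int i * int d) (int m)"
    using ceiling_divide_eq_div[of "int i * int d" "int m", where ?'a = real]
    by (simp add: ceil_div_def mult.commute)
  moreover have "\<lceil>real i * (real q + 1) / real m\<rceil> = ceil_div (int i * (int q + 1)) (int m)"
    using ceiling_divide_eq_div[of "int i * (int q + 1)" "int m", where ?'a = real]
    by (simp add: ceil_div_def)
  moreover have "\<lfloor>real i * real d * real q * (real q - 1) / real m\<rfloor> = (int i * (int d * int q * (int q - 1))) div int m"
    using floor_divide_of_int_eq[of "int i * (int d * int q * (int q - 1))" "int m", where ?'a = real]
    by (simp add: mult.assoc)
  ultimately show ?thesis by (simp add: A_num_def)
qed

text \<open>Up to sign the radicand has the zero 0 with multiplicity d, the d-th roots of unity with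
  multiplicity 1, and the other d(q-2) roots of unity of order dividing d(q-1) with multiplicity
  q+1. The total d + d + d(q-2)(q+1) = dq(q-1) is the factor in the floor of
  \<open>A_num\<close>.\<close>

theorem proposition5p8:
  fixes \<iota> :: "'k::{field,finite} \<Rightarrow> 'f::field"
    and q n m d :: nat
    and x y :: 'f
    and \<alpha> :: "nat \<Rightarrow> 'k"
    and Q :: "nat \<Rightarrow> 'f set"
  assumes "primepow q"
    and "n \<ge> 3" and "odd n"
    and "m \<ge> 2" and "m dvd q ^ n + 1"
    and "d > 0" and "d dvd q + 1"
    and "gcd m (d * (q - 1)) = 1"
    and "CARD('k) = q ^ (2 * n)"
    and "field_hom \<iota>"
    and "transcendental_over \<iota> x"
    and "adjoin \<iota> {x, y} = UNIV"
    and "y ^ m = x ^ d * (x ^ d - 1) * ((1 - x ^ (d * (q - 1))) / (x ^ d - 1)) ^ (q + 1)"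
    and "bij_betw \<alpha> {1..d} {a. a ^ d - 1 = 0}"
    and "\<And>k. k \<in> {1..d} \<Longrightarrow> Q k \<in> places \<iota> \<and> zero_place \<iota> x (\<alpha> k) \<subseteq> Q k"
  shows "(\<forall>k\<in>{1..d}.
            gap_set \<iota> (Q k) =
              {m * j + i | i j. 1 \<le> i \<and> i \<le> m - 1 \<and> int j \<le> A_num q d m i - 2} \<and>
            int ` weierstrass_semigroup1 \<iota> (Q k) =
              submonoid_generated
                ({int m} \<union> {int m * (A_num q d m i - 1) + int i | i. 1 \<le> i \<and> i \<le> m - 1})) \<and>
         (\<forall>s. 2 \<le> s \<and> int s \<le> min (int d) (Max (A_num q d m ` {1..m - 1})) \<longrightarrow>
            minimal_generating_set \<iota> (map Q [1..<s + 1]) =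
              {map (\<lambda>j. m * j + i) js | i js. 1 \<le> i \<and> i \<le> m - 1 \<and> length js = s \<and>
                 int (sum_list js) = A_num q d m i - int s})"
proof -
  have q2: "q \<ge> 2" using primepow_gt_Suc_0[OF assms(1)] by simp
  have mpos: "m > 0" using assms(4) by simp
  interpret rational_subfield \<iota> x
    using assms(10,11) by (intro rational_subfield.intro rational_subfield_axioms.intro)
  define D where "D = {a :: 'k. a ^ d = 1}"
  define W where "W = {a :: 'k. a ^ (d * (q - 1)) = 1}"
  define \<mu> where "\<mu> a = (if a = 0 then d else if a \<in> D then 1 else q + 1)" for a
  define Z where "Z = insert 0 W"
  have q1: "q - 1 > 0" using q2 by simp
  \<comment> \<open>As d divides q + 1, d(q-1) divides q^2 - 1 and hence the order of the
    multiplicative group; so all roots of unity in question are constants.\<close>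
  have dvd2n: "(q ^ 2 - 1) dvd CARD('k) - 1"
    unfolding assms(9) power_mult by (rule minus_one_dvd_power_minus_one)
  have sq: "q ^ 2 - 1 = (q + 1) * (q - 1)" by (simp add: power2_eq_square algebra_simps)
  have "d * (q - 1) dvd q ^ 2 - 1" unfolding sq using assms(7) by (intro mult_dvd_mono) auto
  then have dW: "d * (q - 1) dvd CARD('k) - 1" using dvd2n by (rule dvd_trans)
  then have dD: "d dvd CARD('k) - 1" by (metis dvd_mult_left)
  have "CARD('k) - 1 = (q ^ n) ^ 2 - 1"
    unfolding assms(9) by (simp add: mult.commute[of 2] power_mult)
  also have "\<dots> = (q ^ n + 1) * (q ^ n - 1)" by (simp add: power2_eq_square algebra_simps)
  finally have "m dvd CARD('k) - 1" using dvd_mult2[OF assms(5)] by metis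
  then have card_m: "card {u :: 'k. u ^ m = 1} = m" using card_roots_of_unity mpos by blast
  have cD: "card D = d" unfolding D_def using card_roots_of_unity[OF dD] assms(6) .
  have cW: "card W = d * (q - 1)" unfolding W_def using card_roots_of_unity[OF dW] assms(6) q1 by simp
  have DW: "D \<subseteq> W" by (auto simp: D_def W_def power_mult)
  have W0: "0 \<notin> W" using assms(6) q1 by (simp add: W_def power_0_left)
  have cWD: "int (card (W - D)) = int d * (int q - 2)"
  proof -
    have "card (W - D) = d * (q - 1) - d * 1" by (simp add: card_Diff_subset[OF _ DW] cD cW)
    also have "\<dots> = d * (q - 2)" unfolding diff_mult_distrib2[symmetric] by (simp add: numeral_2_eq_2)
    finally show ?thesis using q2 by (simp add: of_nat_diff)
  qed
  have sumZ: "(\<Sum>a\<in>Z. f (\<mu> a)) = f d + int d * f 1 + int d * (int q - 2) * f (q + 1)" for f :: "nat \<Rightarrow> int"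
  proof -
    have "(\<Sum>a\<in>Z. f (\<mu> a)) = f d + (\<Sum>a\<in>W. f (\<mu> a))" using W0 by (simp add: Z_def \<mu>_def)
    also have "(\<Sum>a\<in>W. f (\<mu> a)) = (\<Sum>a\<in>W - D. f (\<mu> a)) + (\<Sum>a\<in>D. f (\<mu> a))"
      by (rule sum.subset_diff[OF DW]) simp
    also have "(\<Sum>a\<in>D. f (\<mu> a)) = (\<Sum>a\<in>D. f 1)" using W0 DW by (intro sum.cong) (auto simp: \<mu>_def)
    also have "(\<Sum>a\<in>W - D. f (\<mu> a)) = (\<Sum>a\<in>W - D. f (q + 1))" using W0 by (intro sum.cong) (auto simp: \<mu>_def)
    finally show ?thesis by (simp add: cD cWD)
  qed
  have Dp: "x ^ d - 1 = (\<Prod>a\<in>D. x - \<iota> a)"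
    unfolding D_def using cD assms(6) by (intro x_power_minus_one) (simp_all add: D_def)
  have "x ^ (d * (q - 1)) - 1 = (\<Prod>a\<in>W. x - \<iota> a)"
    unfolding W_def using cW assms(6) q1 by (intro x_power_minus_one) (simp_all add: W_def)
  also have "\<dots> = (\<Prod>a\<in>W - D. x - \<iota> a) * (x ^ d - 1)"
    unfolding Dp by (rule prod.subset_diff[OF DW]) simp
  finally have Wp: "x ^ (d * (q - 1)) - 1 = (\<Prod>a\<in>W - D. x - \<iota> a) * (x ^ d - 1)" .
  have "x ^ d - 1 \<noteq> 0" unfolding Dp by simp
  then have quot: "(1 - x ^ (d * (q - 1))) / (x ^ d - 1) = - (\<Prod>a\<in>W - D. x - \<iota> a)"
    using Wp by (simp add: field_simps)
  have "(\<Prod>a\<in>Z. (x - \<iota> a) ^ \<mu> a) = x ^ d * (\<Prod>a\<in>W. (x - \<iota> a) ^ \<mu> a)"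
    using W0 by (simp add: Z_def \<mu>_def)
  also have "(\<Prod>a\<in>W. (x - \<iota> a) ^ \<mu> a) = (\<Prod>a\<in>W - D. (x - \<iota> a) ^ \<mu> a) * (\<Prod>a\<in>D. (x - \<iota> a) ^ \<mu> a)"
    by (rule prod.subset_diff[OF DW]) simp
  also have "(\<Prod>a\<in>D. (x - \<iota> a) ^ \<mu> a) = (\<Prod>a\<in>D. x - \<iota> a)"
    using W0 DW by (intro prod.cong) (auto simp: \<mu>_def)
  also have "(\<Prod>a\<in>W - D. (x - \<iota> a) ^ \<mu> a) = (\<Prod>a\<in>W - D. (x - \<iota> a) ^ (q + 1))"
    using W0 by (intro prod.cong) (auto simp: \<mu>_def)
  also have "\<dots> = (\<Prod>a\<in>W - D. x - \<iota> a) ^ (q + 1)" by (rule prod_power_distrib[symmetric])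
  finally have Zp: "(\<Prod>a\<in>Z. (x - \<iota> a) ^ \<mu> a)
      = x ^ d * ((\<Prod>a\<in>W - D. x - \<iota> a) ^ (q + 1) * (\<Prod>a\<in>D. x - \<iota> a))" .
  \<comment> \<open>The numerator 1 - x^(d(q-1)) has the opposite sign of the product over
    \<open>W\<close>, which leaves the constant (-1)^(q+1).\<close>
  have eq: "y ^ m = \<iota> ((- 1) ^ (q + 1)) * (\<Prod>a\<in>Z. (x - \<iota> a) ^ \<mu> a)"
    unfolding assms(13) quot Zp Dp[symmetric] power_minus[of "prod _ _"]
    by (simp add: hom_power hom_uminus mult_ac)
  \<comment> \<open>Since q vanishes in the constants, q^n + 1 becomes 1 there and its divisor
    \<open>m\<close> is invertible.\<close>
  have "of_nat q = (0 :: 'k)" using of_nat_eq_zero_of_card_eq_power[OF assms(9)] .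
  then have "of_nat (q ^ n + 1) = (1 :: 'k)" using assms(2) by (simp add: power_0_left)
  then have m0: "of_nat m \<noteq> (0 :: 'k)" using assms(5) by (metis dvdE mult_zero_left of_nat_mult zero_neq_one)
  have \<alpha>: "inj_on \<alpha> {1..d}" "\<alpha> ` {1..d} = D"
    using assms(14) by (auto simp: bij_betw_def D_def)
  have \<alpha>D: "\<alpha> k \<in> Z \<and> \<mu> (\<alpha> k) = 1" if "k \<in> {1..d}" for k
  proof -
    have "\<alpha> k \<in> D" using that \<alpha>(2) by blast
    then show ?thesis using DW W0 by (auto simp: Z_def \<mu>_def)
  qed
  interpret kummer_galois \<iota> x y m Z \<mu> "(- 1) ^ (q + 1)"
  proof (intro kummer_galois.intro kummer_extension.intro kummer_galois_axioms.intro
      kummer_extension_axioms.intro)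
    show "\<exists>a\<in>Z. \<mu> a = 1" using \<alpha>D[of 1] assms(6) by auto
  qed (use mpos eq assms(12) m0 card_m rational_subfield_axioms in auto)
  have ram: "ramified_place \<iota> x y m Z \<mu> ((- 1) ^ (q + 1)) (Q k) (\<alpha> k)" if k: "k \<in> {1..d}" for k
  proof (rule ramified_placeI)
    have "x - \<iota> (\<alpha> k) = ev [:- \<alpha> k, 1:] / ev 1 \<and> poly [:- \<alpha> k, 1:] (\<alpha> k) = 0 \<and> poly 1 (\<alpha> k) \<noteq> 0"
      unfolding ev_simps(6) by simp
    then have "x - \<iota> (\<alpha> k) \<in> zero_place \<iota> x (\<alpha> k)" unfolding zero_place_def by blast
    then show "x - \<iota> (\<alpha> k) \<in> Q k" using assms(15)[OF k] by blast
  qed (use assms(15)[OF k] \<alpha>D[OF k] in auto)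
  \<comment> \<open>The three kinds of zeros give the ceiling terms of \<open>A_num\<close>; the
    bare summand d comes from the simple zeros, where each ceiling is 1.\<close>
  have A: "A i = A_num q d m i" if "1 \<le> i \<and> i \<le> m - 1" for i
  proof -
    have i: "0 < i" "i < m" using that by auto
    have "(\<Sum>a\<in>Z. int (\<mu> a)) = int d * int q * (int q - 1)"
      unfolding sumZ[of int] by (simp add: algebra_simps)
    then show ?thesis
      unfolding A_def sumZ[of "\<lambda>u. ceil_div (int i * int u) (int m)"] A_num_eq[OF mpos]
      using ceil_div_less_one[OF i] by (simp add: add.commute)
  qed
  show ?thesis
  proof (intro conjI ballI allI impI)
    fix k assume k: "k \<in> {1..d}"
    show "gap_set \<iota> (Q k) = {m * j + i | i j. 1 \<le> i \<and> i \<le> m - 1 \<and> int j \<le> A_num q d m i - 2}"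
      unfolding gap_set_eq[OF ram[OF k]] using A by (metis (no_types, lifting))
    have "{int m * (A i - 1) + int i | i. 1 \<le> i \<and> i \<le> m - 1}
        = {int m * (A_num q d m i - 1) + int i | i. 1 \<le> i \<and> i \<le> m - 1}"
      using A by (metis (no_types, lifting))
    then show "int ` weierstrass_semigroup1 \<iota> (Q k) = submonoid_generated
        ({int m} \<union> {int m * (A_num q d m i - 1) + int i | i. 1 \<le> i \<and> i \<le> m - 1})"
      using semigroup1_generated[OF ram[OF k]] by simp
  next
    fix s assume s: "2 \<le> s \<and> int s \<le> min (int d) (Max (A_num q d m ` {1..m - 1}))"
    then have sub: "set [1..<s + 1] \<subseteq> {1..d}" by auto
    \<comment> \<open>The general theory indexes places by points of the constant field, the
      statement by numbers; the inverse of the enumeration \<open>\<alpha>\<close>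
      translates.\<close>
    define R where "R = Q \<circ> inv_into {1..d} \<alpha>"
    have R: "R (\<alpha> k) = Q k" if "k \<in> {1..d}" for k using \<alpha>(1) that by (simp add: R_def)
    interpret ramified_places \<iota> x y m Z \<mu> "(- 1) ^ (q + 1)" "map \<alpha> [1..<s + 1]" R
    proof (intro ramified_places.intro ramified_places_axioms.intro kummer_galois_axioms)
      show "distinct (map \<alpha> [1..<s + 1])"
        using inj_on_subset[OF \<alpha>(1) sub] by (simp add: distinct_map)
      show "ramified_place \<iota> x y m Z \<mu> ((- 1) ^ (q + 1)) (R a) a" if "a \<in> set (map \<alpha> [1..<s + 1])" for a
        using that sub R ram by auto
    qed
    have places: "map R (map \<alpha> [1..<s + 1]) = map Q [1..<s + 1]" using R sub by auto
    have len: "length (map \<alpha> [1..<s + 1]) = s" by simp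
    have "minimal_generating_set \<iota> (map Q [1..<s + 1]) =
      {map (\<lambda>j. m * j + i) js | i js. 1 \<le> i \<and> i \<le> m - 1 \<and> length js = s \<and> int (sum_list js) = A i - int s}"
      using minimal_generating_set_eq s unfolding places len by blast
    also have "\<dots> = {map (\<lambda>j. m * j + i) js | i js. 1 \<le> i \<and> i \<le> m - 1 \<and> length js = s \<and>
                 int (sum_list js) = A_num q d m i - int s}"
      using A by (metis (no_types, lifting))
    finally show "minimal_generating_set \<iota> (map Q [1..<s + 1]) =
              {map (\<lambda>j. m * j + i) js | i js. 1 \<le> i \<and> i \<le> m - 1 \<and> length js = s \<and>
                 int (sum_list js) = A_num q d m i - int s}" .
  qed
qed

end
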